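(* Let $\Gamma$ be a connected bipartite graph, $G\leqslant\mathrm{Aut}(\Gamma)$ acting transitively on vertices and on edges. Let $\Delta$ be one of the two parts, of size $n$, and suppose $\mathrm{Alt}(n)\leqslant (G^+)^\Delta\leqslant\mathrm{Sym}(n)$. Then $\Gamma=K_{n,n}$ or $\Gamma=K_{n,n}-nK_2$ and, up to conjugation in $\mathrm{Sym}(n)\times\mathrm{Sym}(n)$, $(\Gamma,G^+)$ is one of: $(K_{n,n},\mathrm{Alt}(n)\times\mathrm{Alt}(n))$; $(K_{n,n},\langle\mathrm{Alt}(n)\times\mathrm{Alt}(n),((1,2),(1,2))\rangle)$; $(K_{n,n},\mathrm{Sym}(n)\times\mathrm{Sym}(n))$; $(K_{n,n}-nK_2,\mathrm{Diag}(\mathrm{Sym}(n)\times\mathrm{Sym}(n)))$; $(K_{n,n}-nK_2,\mathrm{Diag}(\mathrm{Alt}(n)\times\mathrm{Alt}(n)))$; $(K_{6,6},\mathrm{Diag}_\varphi(H\times H))$ with $H=\mathrm{Alt}(6)$ or $\mathrm{Sym}(6)$; $(K_{4,4},\langle V_4\times V_4,\mathrm{Diag}(H\times H)\rangle)$ with $H=\mathrm{Alt}(4)$ or $\mathrm{Sym}(4)$.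
   Context: The parts of $\Gamma$ are $\Delta=\{v_1,\dots,v_n\}$ and $\Delta'=\{u_1,\dots,u_n\}$; $G^+$ is the index-two subgroup of $G$ fixing each part, and $(G^+)^\Delta$ is the permutation group it induces on $\Delta$, viewed in $\mathrm{Sym}(n)$. Elements $(g,g')\in\mathrm{Sym}(n)\times\mathrm{Sym}(n)$ act by $v_i\mapsto v_{i^g}$, $u_i\mapsto u_{i^{g'}}$. $K_{n,n}-nK_2$ is $K_{n,n}$ with the perfect matching $\{v_i,u_i\}$ removed. For $\varphi\in\mathrm{Aut}(H)$, $\mathrm{Diag}_\varphi(H\times H)=\{(h,h^\varphi):h\in H\}$; $\mathrm{Diag}(H\times H)$ is the case $\varphi$ trivial. In the $K_{6,6}$ case $\varphi$ is a chosen outer automorphism of $\mathrm{Sym}(6)$ of order $2$. $V_4$ is the Klein four-group. *)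

theory Defs
  imports
    "HOL-Algebra.Sym_Groups"
    "HOL-Algebra.Bij"
    "HOL-Algebra.Multiplicative_Group"
    "HOL-Algebra.Generated_Groups"
    "Graph_Theory.Graph_Theory"
begin

section \<open>Bipartite graphs and their automorphism groups\<close>

text \<open>A finite simple graph is a \<^locale>\<open>pair_graph\<close>: finite, loopless, with symmetric arc relation.\<close>

definition bipartition :: "'a pair_pre_digraph \<Rightarrow> 'a set \<Rightarrow> 'a set \<Rightarrow> bool" where
  "bipartition \<Gamma> A B \<longleftrightarrow> pverts \<Gamma> = A \<union> B \<and> A \<inter> B = {} \<and> parcs \<Gamma> \<subseteq> A \<times> B \<union> B \<times> A"

text \<open>Undirected edges, one for each pair of opposite arcs.\<close>

definition uedges :: "'a pair_pre_digraph \<Rightarrow> 'a set set" where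
  "uedges \<Gamma> = {{x, y} |x y. (x, y) \<in> parcs \<Gamma>}"

text \<open>Automorphisms are total functions that are the identity off the vertex set, in the same way
  as \<^const>\<open>sym_group\<close> represents permutations.\<close>

definition aut_group :: "'a pair_pre_digraph \<Rightarrow> ('a \<Rightarrow> 'a) monoid" where
  "aut_group \<Gamma> = \<lparr>carrier = {f. f permutes pverts \<Gamma> \<and>
       (\<forall>x\<in>pverts \<Gamma>. \<forall>y\<in>pverts \<Gamma>. (x, y) \<in> parcs \<Gamma> \<longleftrightarrow> (f x, f y) \<in> parcs \<Gamma>)},
     mult = (\<circ>), one = id\<rparr>"

definition vertex_transitive :: "('a \<Rightarrow> 'a) set \<Rightarrow> 'a pair_pre_digraph \<Rightarrow> bool" where
  "vertex_transitive G \<Gamma> \<longleftrightarrow> (\<forall>x\<in>pverts \<Gamma>. \<forall>y\<in>pverts \<Gamma>. \<exists>g\<in>G. g x = y)"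

definition edge_transitive :: "('a \<Rightarrow> 'a) set \<Rightarrow> 'a pair_pre_digraph \<Rightarrow> bool" where
  "edge_transitive G \<Gamma> \<longleftrightarrow> (\<forall>e\<in>uedges \<Gamma>. \<forall>e'\<in>uedges \<Gamma>. \<exists>g\<in>G. g ` e = e')"

text \<open>The subgroup \<open>G\<^sup>+\<close> fixing each of the two parts (setwise).\<close>

definition part_stabilizer :: "('a \<Rightarrow> 'a) set \<Rightarrow> 'a set \<Rightarrow> 'a set \<Rightarrow> ('a \<Rightarrow> 'a) set" where
  "part_stabilizer G A B = {g \<in> G. g ` A = A \<and> g ` B = B}"


section \<open>Labelled parts and the action of \<open>Sym(n) \<times> Sym(n)\<close>\<close>

text \<open>Throughout, \<open>v\<close> and \<open>u\<close> are injective on \<open>{1..n}\<close> with disjoint images, the two parts.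
  The permutation that \<open>g\<close> induces on the part labelled by \<open>v\<close>, viewed in \<open>Sym(n)\<close>:\<close>

definition induced_perm :: "nat \<Rightarrow> (nat \<Rightarrow> 'a) \<Rightarrow> ('a \<Rightarrow> 'a) \<Rightarrow> nat \<Rightarrow> nat" where
  "induced_perm n v g = (\<lambda>i. if i \<in> {1..n} then inv_into {1..n} v (g (v i)) else i)"

definition induced_pair ::
    "nat \<Rightarrow> (nat \<Rightarrow> 'a) \<Rightarrow> (nat \<Rightarrow> 'a) \<Rightarrow> ('a \<Rightarrow> 'a) \<Rightarrow> (nat \<Rightarrow> nat) \<times> (nat \<Rightarrow> nat)" where
  "induced_pair n v u g = (induced_perm n v g, induced_perm n u g)"

abbreviation sym_sym :: "nat \<Rightarrow> ((nat \<Rightarrow> nat) \<times> (nat \<Rightarrow> nat)) monoid" where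
  "sym_sym n \<equiv> sym_group n \<times>\<times> sym_group n"

text \<open>The action \<open>v\<^sub>i \<mapsto> v\<^bsub>a i\<^esub>\<close>, \<open>u\<^sub>i \<mapsto> u\<^bsub>b i\<^esub>\<close> of \<open>(a, b)\<close> on vertices. Maps are written on the left,
  so products are composed from right to left; subgroups and conjugacy do not depend on this choice.\<close>

definition label_act ::
    "nat \<Rightarrow> (nat \<Rightarrow> 'a) \<Rightarrow> (nat \<Rightarrow> 'a) \<Rightarrow> (nat \<Rightarrow> nat) \<times> (nat \<Rightarrow> nat) \<Rightarrow> 'a \<Rightarrow> 'a" where
  "label_act n v u c x =
     (if x \<in> v ` {1..n} then v (fst c (inv_into {1..n} v x))
      else if x \<in> u ` {1..n} then u (snd c (inv_into {1..n} u x))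
      else x)"

definition graph_image :: "('a \<Rightarrow> 'a) \<Rightarrow> 'a pair_pre_digraph \<Rightarrow> 'a pair_pre_digraph" where
  "graph_image f \<Gamma> = \<lparr>pverts = f ` pverts \<Gamma>, parcs = map_prod f f ` parcs \<Gamma>\<rparr>"

text \<open>The pairs \<open>(\<Gamma>, P)\<close> and \<open>(\<Gamma>', P')\<close>, with \<open>P\<close> and \<open>P'\<close> inside \<open>Sym(n) \<times> Sym(n)\<close>, are conjugate:
  one and the same element carries \<open>\<Gamma>\<close> to \<open>\<Gamma>'\<close> and \<open>P\<close> to \<open>P'\<close>.\<close>

definition conjugate_pair where
  "conjugate_pair n v u \<Gamma> P \<Gamma>' P' \<longleftrightarrow>
     (\<exists>c\<in>carrier (sym_sym n).
        graph_image (label_act n v u c) \<Gamma> = \<Gamma>' \<and>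
        (\<lambda>p. c \<otimes>\<^bsub>sym_sym n\<^esub> p \<otimes>\<^bsub>sym_sym n\<^esub> inv\<^bsub>sym_sym n\<^esub> c) ` P = P')"


section \<open>The graphs and groups in the classification\<close>

definition Knn :: "nat \<Rightarrow> (nat \<Rightarrow> 'a) \<Rightarrow> (nat \<Rightarrow> 'a) \<Rightarrow> 'a pair_pre_digraph" where
  "Knn n v u = \<lparr>pverts = v ` {1..n} \<union> u ` {1..n},
     parcs = v ` {1..n} \<times> u ` {1..n} \<union> u ` {1..n} \<times> v ` {1..n}\<rparr>"

definition Knn_minus_matching :: "nat \<Rightarrow> (nat \<Rightarrow> 'a) \<Rightarrow> (nat \<Rightarrow> 'a) \<Rightarrow> 'a pair_pre_digraph" where
  "Knn_minus_matching n v u = \<lparr>pverts = pverts (Knn n v u),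
     parcs = parcs (Knn n v u) - (\<Union>i\<in>{1..n}. {(v i, u i), (u i, v i)})\<rparr>"

abbreviation Sym :: "nat \<Rightarrow> (nat \<Rightarrow> nat) set" where
  "Sym n \<equiv> carrier (sym_group n)"

abbreviation Alt :: "nat \<Rightarrow> (nat \<Rightarrow> nat) set" where
  "Alt n \<equiv> carrier (alt_group n)"

definition Diag_twisted :: "('b \<Rightarrow> 'b) \<Rightarrow> 'b set \<Rightarrow> ('b \<times> 'b) set" where
  "Diag_twisted \<phi> H = {(h, \<phi> h) |h. h \<in> H}"

abbreviation Diag :: "'b set \<Rightarrow> ('b \<times> 'b) set" where
  "Diag H \<equiv> Diag_twisted id H"

text \<open>The normal Klein four-group of \<open>Alt(4)\<close>.\<close>

definition V4 :: "(nat \<Rightarrow> nat) set" where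
  "V4 = {id, transpose 1 2 \<circ> transpose 3 4, transpose 1 3 \<circ> transpose 2 4,
         transpose 1 4 \<circ> transpose 2 3}"

definition inner_auts :: "('b, 'c) monoid_scheme \<Rightarrow> ('b \<Rightarrow> 'b) set" where
  "inner_auts H = (\<lambda>g. \<lambda>h\<in>carrier H. g \<otimes>\<^bsub>H\<^esub> h \<otimes>\<^bsub>H\<^esub> inv\<^bsub>H\<^esub> g) ` carrier H"

definition outer_involution :: "('b, 'c) monoid_scheme \<Rightarrow> ('b \<Rightarrow> 'b) \<Rightarrow> bool" where
  "outer_involution H \<phi> \<longleftrightarrow>
     \<phi> \<in> carrier (AutoGroup H) \<and> \<phi> \<notin> inner_auts H \<and> group.ord (AutoGroup H) \<phi> = 2"

end

theory Submission
  imports Defs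
begin

text \<open>
  Write \<open>P \<subseteq> Sym(n) \<times> Sym(n)\<close> for the group induced by \<open>G\<^sup>+\<close>. An element of \<open>G\<close> exchanging the parts
  makes \<open>P\<close> symmetric, so both projections contain \<open>Alt(n)\<close> and the two kernels, which are normalized
  by \<open>Alt(n)\<close>, are both trivial, both \<open>V\<^sub>4\<close> with \<open>n = 4\<close>, or both contain \<open>Alt(n)\<close>. In the last case
  parities leave three groups. If the kernels are trivial, \<open>P\<close> is the graph of an isomorphism. Unless
  \<open>n = 6\<close> it maps 3-cycles to 3-cycles, because the commutators of a 3-cycle have order 1, 2, 3 or 5,
  and then it is conjugation by some \<open>\<pi>\<close>; two exceptional isomorphisms for \<open>n = 6\<close> differ by such a
  conjugation. The case of \<open>V\<^sub>4\<close> reduces to degree three. The graph is then read off from the orbits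
  of \<open>P\<close> on pairs, connectedness and edge-transitivity.
\<close>

section \<open>Three-cycles\<close>

text \<open>The conjugating element can always be taken of the form (1, \<pi>^-1): only the labels
  of the second part change, and the same element serves graph and group. In the diagonal case the
  omitted matching joins the vertices with labels i and \<pi> i. Small degrees are the obstacle. For
  n = 3 and 4 the 3-cycles split into two classes under Alt(n); recovering a point from supports of
  3-cycles takes four points; and Alt(3) is abelian, so there \<pi> is not determined by P and the
  matching has to be chosen by looking at the graph. In degree six Aut(Sym(6)) is not computed. By
  rigidity, an automorphism of Sym(6) that preserves 3-cycles is inner, so the given \<phi> does not
  preserve them. Any two isomorphisms that do not are then compared on their common first
  coordinates, which treats Alt(6) and Sym(6) at once.\<close>

definition cyc3 :: "'a \<Rightarrow> 'a \<Rightarrow> 'a \<Rightarrow> 'a \<Rightarrow> 'a" where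
  "cyc3 a b c = transpose a b \<circ> transpose b c"

lemma cyc3_apply:
  "distinct [a, b, c] \<Longrightarrow>
    cyc3 a b c x = (if x = a then b else if x = b then c else if x = c then a else x)"
  by (auto simp: cyc3_def transpose_def)

lemma cyc3_rotate: "distinct [a, b, c] \<Longrightarrow> cyc3 a b c = cyc3 b c a"
  by (rule ext) (auto simp: cyc3_apply)

lemma inv_cyc3: "distinct [a, b, c] \<Longrightarrow> inv' (cyc3 a b c) = cyc3 c b a"
  by (rule inv_equality) (auto simp: cyc3_apply split: if_splits)

lemma cyc3_permutes: "{a, b, c} \<subseteq> S \<Longrightarrow> cyc3 a b c permutes S"
  unfolding cyc3_def by (intro permutes_compose permutes_swap_id) auto

lemma evenperm_cyc3: "distinct [a, b, c] \<Longrightarrow> evenperm (cyc3 a b c)"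
  unfolding cyc3_def by (simp add: evenperm_comp evenperm_swap permutation_swap_id)

lemma conj_transpose:
  "bij g \<Longrightarrow> g \<circ> transpose a b \<circ> inv' g = transpose (g a) (g b)"
  by (rule ext) (auto simp: transpose_def bij_inv_eq_iff bij_is_inj bij_is_surj surj_f_inv_f split: if_splits)

lemma conj_comp: "bij g \<Longrightarrow> g \<circ> (a \<circ> b) \<circ> inv' g = (g \<circ> a \<circ> inv' g) \<circ> (g \<circ> b \<circ> inv' g)"
  by (simp add: fun_eq_iff bij_is_inj)

lemma conj_cyc3: "bij g \<Longrightarrow> g \<circ> cyc3 a b c \<circ> inv' g = cyc3 (g a) (g b) (g c)"
  unfolding cyc3_def by (simp only: conj_comp conj_transpose)

lemma permutes_eqI:
  assumes "p permutes S" "q permutes S" "\<And>x. x \<in> S \<Longrightarrow> p x = q x"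
  shows "p = q"
  using assms by (metis ext permutes_not_in)

definition cycles3 :: "nat \<Rightarrow> (nat \<Rightarrow> nat) set" where
  "cycles3 n = {cyc3 a b c |a b c. distinct [a, b, c] \<and> {a, b, c} \<subseteq> {1..n}}"

lemma cycles3E:
  assumes "s \<in> cycles3 n"
  obtains a b c where "distinct [a, b, c]" "{a, b, c} \<subseteq> {1..n}" "s = cyc3 a b c"
  using assms unfolding cycles3_def by (elim CollectE exE conjE) simp

lemma cycles3I:
  "distinct [a, b, c] \<Longrightarrow> {a, b, c} \<subseteq> {1..n} \<Longrightarrow> cyc3 a b c \<in> cycles3 n"
  unfolding cycles3_def by (intro CollectI exI conjI) (rule refl)

text \<open>\<open>cyc3 a b c\<close> has the same factors as
  \<open>cycle_of_list [a, b, c]\<close>, so unfolding suffices. The inclusion makes the generation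
  theorem for \<open>three_cycles\<close> available.\<close>

lemma three_cycles_subset: "three_cycles n \<subseteq> cycles3 n"
proof
  fix s assume "s \<in> three_cycles n"
  then obtain cs where cs: "s = cycle_of_list cs" "cycle cs" "length cs = 3" "set cs \<subseteq> {1..n}"
    by auto
  obtain a b c where "cs = [a, b, c]"
    using stupid_lemma[OF cs(3)] by metis
  with cs show "s \<in> cycles3 n"
    using cycles3I[of a b c n] by (simp add: cyc3_def)
qed

lemma cycles3_conj:
  assumes "s \<in> cycles3 n" "g permutes {1..n}"
  shows "g \<circ> s \<circ> inv' g \<in> cycles3 n"
proof -
  obtain a b c where *: "distinct [a, b, c]" "{a, b, c} \<subseteq> {1..n}" "s = cyc3 a b c"
    using assms(1) by (rule cycles3E)
  have "g \<circ> s \<circ> inv' g = cyc3 (g a) (g b) (g c)"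
    by (simp only: *(3) conj_cyc3[OF permutes_bij[OF assms(2)]])
  moreover have "distinct [g a, g b, g c]"
    using *(1) permutes_inj[OF assms(2)] by (auto dest: injD)
  moreover have "{g a, g b, g c} \<subseteq> {1..n}"
    using *(2) permutes_in_image[OF assms(2)] by blast
  ultimately show ?thesis by (simp only: cycles3I)
qed

section \<open>Generation and multiple transitivity of Alt(n)\<close>

lemma Alt_iff: "p \<in> Alt n \<longleftrightarrow> p permutes {1..n} \<and> evenperm p"
  by (rule alt_group_carrier)

text \<open>Alt(n) is generated by 3-cycles, and the inverse of a 3-cycle is again one, so closure
  under composition is enough.\<close>

lemma Alt_subset_of_cycles3:
  assumes id: "id \<in> N" and comp: "\<And>a b. a \<in> N \<Longrightarrow> b \<in> N \<Longrightarrow> a \<circ> b \<in> N"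
    and cyc: "cycles3 n \<subseteq> N"
  shows "Alt n \<subseteq> N"
proof
  fix p assume "p \<in> Alt n"
  then have "p \<in> generate (alt_group n) (three_cycles n)"
    using alt_group_carrier_as_three_cycles by blast
  then show "p \<in> N"
  proof induction
    case one then show ?case using id by (simp only: alt_group_one)
  next
    case (incl h) then show ?case using cyc three_cycles_subset by blast
  next
    case (inv h)
    obtain a b c where *: "distinct [a, b, c]" "{a, b, c} \<subseteq> {1..n}" "h = cyc3 a b c"
      using subsetD[OF three_cycles_subset inv] by (rule cycles3E)
    have "h \<in> Alt n" using inv three_cycles_incl by blast
    then have "inv\<^bsub>alt_group n\<^esub> h = cyc3 c b a"
      using * alt_group_inv_equality inv_cyc3 by metis
    then show ?case using cyc cycles3I[of c b a n] * by auto
  next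
    case (eng h1 h2) then show ?case using comp by (simp only: alt_group_mult)
  qed
qed

lemma permutes_permutation: "p permutes {1..n::nat} \<Longrightarrow> permutation p"
  using permutes_imp_permutation by blast

lemma Alt_closed:
  "id \<in> Alt n" "a \<in> Alt n \<Longrightarrow> b \<in> Alt n \<Longrightarrow> a \<circ> b \<in> Alt n" "a \<in> Alt n \<Longrightarrow> inv' a \<in> Alt n"
  by (auto simp: Alt_iff permutes_compose permutes_inv evenperm_comp evenperm_inv permutes_permutation)

lemma Alt_cyc3: "distinct [a, b, c] \<Longrightarrow> {a, b, c} \<subseteq> {1..n} \<Longrightarrow> cyc3 a b c \<in> Alt n"
  by (simp add: Alt_iff evenperm_cyc3 cyc3_permutes)

lemma Alt_double_transpose:
  "a \<noteq> b \<Longrightarrow> c \<noteq> d \<Longrightarrow> {a, b, c, d} \<subseteq> {1..n} \<Longrightarrow> transpose a b \<circ> transpose c d \<in> Alt n"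
  by (auto simp: Alt_iff evenperm_comp evenperm_swap permutation_swap_id
      intro!: permutes_compose permutes_swap_id)

lemma Alt_conj: "a \<in> Alt n \<Longrightarrow> g permutes {1..n} \<Longrightarrow> g \<circ> a \<circ> inv' g \<in> Alt n"
  by (auto simp: Alt_iff permutes_compose permutes_inv evenperm_comp evenperm_inv
      permutes_permutation permutation_compose permutation_inverse)

text \<open>\<open>A\<close> and its image have complements of equal size in \<open>S\<close>; any
  bijection between these completes \<open>f\<close>.\<close>

lemma permutes_extend:
  assumes "inj_on f A" "A \<subseteq> S" "f ` A \<subseteq> S" "finite S"
  obtains p where "p permutes S" "\<And>x. x \<in> A \<Longrightarrow> p x = f x"
proof -
  have "card (S - A) = card (S - f ` A)"
    using assms by (simp add: card_Diff_subset card_image finite_subset)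
  then obtain g where g: "bij_betw g (S - A) (S - f ` A)"
    using assms(4) by (metis finite_Diff finite_same_card_bij)
  define p where "p = (\<lambda>x. if x \<in> A then f x else if x \<in> S then g x else x)"
  have "bij_betw p A (f ` A)"
    using assms(1) by (auto simp: p_def bij_betw_def inj_on_def)
  moreover have "bij_betw p (S - A) (S - f ` A)"
    using g by (subst bij_betw_cong[of _ _ g]) (auto simp: p_def)
  ultimately have "bij_betw p (A \<union> (S - A)) (f ` A \<union> (S - f ` A))"
    by (rule bij_betw_combine) auto
  then have "bij_betw p S S" using assms(2,3) by (simp add: Un_absorb1 Un_Diff_cancel)
  then have "p permutes S" by (rule bij_imp_permutes) (use assms(2) in \<open>auto simp: p_def\<close>)
  then show ?thesis using that by (simp add: p_def)
qed

lemma permutes_map_list: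
  assumes "distinct xs" "distinct ys" "length xs = length ys" "set xs \<subseteq> S" "set ys \<subseteq> S" "finite S"
  obtains p where "p permutes S" "map p xs = ys"
proof -
  define f where "f = (\<lambda>x. the (map_of (zip xs ys) x))"
  have f: "f (xs ! i) = ys ! i" if "i < length xs" for i
    using that assms(1,3) by (simp add: f_def map_of_zip_nth)
  have map: "map f xs = ys" using f assms(3) by (intro nth_equalityI) auto
  then have "inj_on f (set xs)" using assms(1,2) by (simp add: distinct_map flip: map)
  moreover have "f ` set xs \<subseteq> S" using assms(5) by (simp flip: map)
  ultimately obtain p where "p permutes S" "\<And>x. x \<in> set xs \<Longrightarrow> p x = f x"
    using permutes_extend[OF _ assms(4) _ assms(6)] by metis
  with that map show ?thesis by (metis map_cong)
qed

text \<open>If the permutation found is odd, it is preceded by a transposition of two points outside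
  \<open>xs\<close>. These two spare points are the \<open>+ 2\<close>.\<close>

lemma Alt_map_list:
  assumes "distinct xs" "distinct ys" "length xs = length ys" "set xs \<subseteq> {1..n}" "set ys \<subseteq> {1..n}"
    and n: "length xs + 2 \<le> n"
  obtains g where "g \<in> Alt n" "map g xs = ys"
proof -
  obtain g where g: "g permutes {1..n}" "map g xs = ys"
    using permutes_map_list[OF assms(1-5)] by auto
  show ?thesis
  proof (cases "evenperm g")
    case True
    then show ?thesis using that[of g] g by (simp add: Alt_iff)
  next
    case False
    have "card ({1..n} - set xs) \<ge> 2" using n assms(1,4) by (simp add: card_Diff_subset distinct_card)
    then obtain T where "T \<subseteq> {1..n} - set xs" "card T = 2"
      by (meson obtain_subset_with_card_n)
    then obtain d e where de: "{d, e} \<subseteq> {1..n} - set xs" "d \<noteq> e"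
      by (elim card_2_iff[THEN iffD1, elim_format] exE) blast
    define h where "h = g \<circ> transpose d e"
    have h: "h permutes {1..n}"
      unfolding h_def using g de by (intro permutes_compose permutes_swap_id) auto
    moreover have "evenperm h"
      using False de permutes_permutation[OF g(1)]
      by (simp add: h_def evenperm_comp evenperm_swap permutation_swap_id)
    moreover have "transpose d e x = x" if "x \<in> set xs" for x
      using de that by (intro transpose_apply_other) auto
    then have "map h xs = map g xs" by (simp add: h_def)
    ultimately show ?thesis using g(2) by (intro that[of h]) (simp_all add: Alt_iff)
  qed
qed

lemma Alt_transitive:
  assumes "n \<ge> 3" "i \<in> {1..n}" "j \<in> {1..n}"
  obtains g where "g \<in> Alt n" "g i = j"
proof -
  obtain g where "g \<in> Alt n" "map g [i] = [j]"
    by (rule Alt_map_list[of "[i]" "[j]" n]) (use assms in simp_all)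
  then show ?thesis using that by simp
qed

lemma Alt_2_transitive:
  assumes "n \<ge> 4" "i \<in> {1..n}" "j \<in> {1..n}" "i \<noteq> j" "k \<in> {1..n}" "l \<in> {1..n}" "k \<noteq> l"
  obtains g where "g \<in> Alt n" "g i = k" "g j = l"
proof -
  obtain g where "g \<in> Alt n" "map g [i, j] = [k, l]"
    by (rule Alt_map_list[of "[i, j]" "[k, l]" n]) (use assms in simp_all)
  then show ?thesis using that by simp
qed

section \<open>Normal subgroups of the alternating group\<close>

lemma permutes_eq_iff:
  assumes "p permutes S"
  shows "p x = p y \<longleftrightarrow> x = y"
  using permutes_inj[OF assms] by (rule inj_eq)

text \<open>\<open>N\<close> is normalized by Alt(n) but need not lie in it: the intended instances
  are kernels inside Sym(n), which may contain odd elements.\<close>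

locale alt_invariant_group =
  fixes n :: nat and N :: "(nat \<Rightarrow> nat) set"
  assumes permutes: "a \<in> N \<Longrightarrow> a permutes {1..n}"
    and id: "id \<in> N"
    and comp: "a \<in> N \<Longrightarrow> b \<in> N \<Longrightarrow> a \<circ> b \<in> N"
    and inv: "a \<in> N \<Longrightarrow> inv' a \<in> N"
    and conj: "a \<in> N \<Longrightarrow> g \<in> Alt n \<Longrightarrow> g \<circ> a \<circ> inv' g \<in> N"
begin

text \<open>The commutator of \<open>s\<close> with t = (a b c), bracketed in two ways: as
  \<open>s\<close> times a conjugate of its inverse it lies in \<open>N\<close>, and as a conjugate
  of t times the inverse of t it is a product of two 3-cycles. The following lemmas choose
  \<open>a\<close>, \<open>b\<close>, \<open>c\<close> so that this product is small.\<close>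

lemma commutator:
  assumes "s \<in> N" "distinct [a, b, c]" "{a, b, c} \<subseteq> {1..n}"
  shows "cyc3 (s a) (s b) (s c) \<circ> cyc3 c b a \<in> N"
proof -
  let ?t = "cyc3 a b c"
  have "s \<circ> (?t \<circ> inv' s \<circ> inv' ?t) \<in> N"
    using assms by (intro comp conj inv Alt_cyc3) auto
  also have "s \<circ> (?t \<circ> inv' s \<circ> inv' ?t) = (s \<circ> ?t \<circ> inv' s) \<circ> inv' ?t"
    by (simp add: fun_eq_iff)
  also have "\<dots> = cyc3 (s a) (s b) (s c) \<circ> cyc3 c b a"
    by (simp only: conj_cyc3[OF permutes_bij[OF permutes[OF assms(1)]]] inv_cyc3[OF assms(2)])
  finally show ?thesis .
qed

lemma in_range: "s \<in> N \<Longrightarrow> s a \<noteq> a \<Longrightarrow> a \<in> {1..n} \<and> s a \<in> {1..n}"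
  using permutes permutes_in_image permutes_not_in by metis

lemma cycles3_if_path:
  assumes "s \<in> N" "s a = b" "s b = c" "s c = d" "distinct [a, b, c, d]"
  shows "cyc3 a d b \<in> N \<and> cyc3 a d b \<in> cycles3 n"
proof
  have r: "{a, b, c, d} \<subseteq> {1..n}"
    using in_range[OF assms(1), of a] in_range[OF assms(1), of b] in_range[OF assms(1), of c] assms by auto
  have "cyc3 b c d \<circ> cyc3 c b a \<in> N"
    using commutator[OF assms(1), of a b c] assms r by auto
  also have "cyc3 b c d \<circ> cyc3 c b a = cyc3 a d b"
    using assms(5) by (auto simp: fun_eq_iff cyc3_apply)
  finally show "cyc3 a d b \<in> N" .
  show "cyc3 a d b \<in> cycles3 n" using assms r by (intro cycles3I) auto
qed

lemma swap_double:
  assumes "s \<in> N" "s a = b" "s b = a" "s c = d" "distinct [a, b, c, d]"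
  shows "transpose a c \<circ> transpose b d \<in> N"
proof -
  have r: "{a, b, c, d} \<subseteq> {1..n}"
    using in_range[OF assms(1), of a] in_range[OF assms(1), of b] in_range[OF assms(1), of c] assms by auto
  have "cyc3 b a d \<circ> cyc3 c b a \<in> N"
    using commutator[OF assms(1), of a b c] assms r by auto
  also have "cyc3 b a d \<circ> cyc3 c b a = transpose a c \<circ> transpose b d"
    using assms(5) by (auto simp: fun_eq_iff cyc3_apply transpose_def)
  finally show ?thesis .
qed

text \<open>An orbit of length at least four contains a path as in \<open>cycles3_if_path\<close>.
  An orbit of length three must be accompanied by another moved point, since \<open>s\<close> itself
  is not a 3-cycle, and a commutator then produces such a path.\<close>

lemma no_cycles3_imp_involution:
  assumes s: "s \<in> N" and no: "N \<inter> cycles3 n = {}"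
  shows "s (s a) = a"
proof (rule ccontr)
  assume neq: "s (s a) \<noteq> a"
  note inj = permutes_eq_iff[OF permutes[OF s]]
  define b c where "b = s a" and "c = s b"
  have d: "distinct [a, b, c]" using neq inj by (auto simp: b_def c_def)
  then have r: "{a, b, c} \<subseteq> {1..n}"
    using in_range[OF s, of a] in_range[OF s, of b] by (auto simp: b_def c_def)
  have ca: "s c = a"
  proof (rule ccontr)
    assume "s c \<noteq> a"
    then have "distinct [a, b, c, s c]" using d inj by (auto simp: b_def c_def)
    then show False using cycles3_if_path[OF s] no b_def c_def by blast
  qed
  have "s \<noteq> cyc3 a b c" using s no cycles3I[OF d r] by blast
  then obtain x where x: "s x \<noteq> cyc3 a b c x" by blast
  then have xn: "x \<notin> {a, b, c}" "s x \<noteq> x"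
    using d ca by (auto simp: cyc3_apply b_def c_def split: if_splits)
  then have d5: "distinct [a, b, c, x, s x]" using d inj ca by (auto simp: b_def c_def)
  define y where "y = s x"
  have d5': "distinct [a, b, c, x, y]" using d5 by (simp only: y_def)
  \<comment> \<open>The commutator with (a b x) is the 5-cycle a, x, c, y, b, which contains a path
    of four points.\<close>
  have "cyc3 b c y \<circ> cyc3 x b a \<in> N"
    using commutator[OF s, of a b x] d5 r in_range[OF s xn(2)] by (auto simp: b_def c_def y_def)
  moreover define t where "t = cyc3 b c y \<circ> cyc3 x b a"
  ultimately have t: "t \<in> N" by simp
  have "cyc3 x b a a = x" "cyc3 x b a x = b" "cyc3 x b a c = c"
    "cyc3 b c y x = x" "cyc3 b c y b = c" "cyc3 b c y c = y"
    using d5' by (auto simp: cyc3_def transpose_def)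
  then have "t a = x" "t x = c" "t c = y" by (simp_all add: t_def)
  moreover have "distinct [a, x, c, y]" using d5' by auto
  ultimately show False using cycles3_if_path[OF t, of a x c y] no by auto
qed

text \<open>For an involution exchanging a and b and fixing c, the commutator with (a b c) is (a b
  c) itself.\<close>

lemma no_cycles3_imp_no_fixpoint:
  assumes s: "s \<in> N" and no: "N \<inter> cycles3 n = {}" and "s \<noteq> id" and c: "c \<in> {1..n}"
  shows "s c \<noteq> c"
proof
  assume sc: "s c = c"
  obtain a where a: "s a \<noteq> a" using assms(3) by (auto simp: fun_eq_iff)
  have inv: "s (s a) = a" using no_cycles3_imp_involution[OF s no] .
  then have d: "distinct [a, s a, c]" using a sc by auto
  then have "cyc3 (s a) a c \<circ> cyc3 c (s a) a \<in> N"
    using commutator[OF s, of a "s a" c] in_range[OF s a] c sc inv by auto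
  also have "cyc3 (s a) a c \<circ> cyc3 c (s a) a = cyc3 a (s a) c"
    using d by (auto simp: fun_eq_iff cyc3_apply)
  finally show False using no cycles3I[OF d] in_range[OF s a] c by auto
qed

text \<open>An odd conjugator is corrected by the transposition of \<open>a\<close> and
  \<open>b\<close>. This reverses the resulting 3-cycle, and inversion inside \<open>N\<close>
  undoes the reversal, so no splitting of the class of 3-cycles under Alt(n) matters.\<close>

lemma Alt_subset_if_cycles3:
  assumes "t \<in> N" "t \<in> cycles3 n"
  shows "Alt n \<subseteq> N"
proof (rule Alt_subset_of_cycles3[OF id comp])
  obtain a b c where t: "distinct [a, b, c]" "{a, b, c} \<subseteq> {1..n}" "t = cyc3 a b c"
    using assms(2) by (rule cycles3E)
  show "cycles3 n \<subseteq> N"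
  proof
    fix s assume "s \<in> cycles3 n"
    then obtain x y z where s: "distinct [x, y, z]" "{x, y, z} \<subseteq> {1..n}" "s = cyc3 x y z"
      by (rule cycles3E)
    obtain g where "g permutes {1..n}" "map g [a, b, c] = [x, y, z]"
      by (rule permutes_map_list[of "[a, b, c]" "[x, y, z]" "{1..n}"]) (use t s in simp_all)
    then have g: "g permutes {1..n}" "g a = x" "g b = y" "g c = z" by auto
    show "s \<in> N"
    proof (cases "evenperm g")
      case True
      then have "g \<circ> t \<circ> inv' g \<in> N" using assms(1) g by (intro conj) (auto simp: Alt_iff)
      then show ?thesis using conj_cyc3[OF permutes_bij[OF g(1)], of a b c] g t(3) s(3) by simp
    next
      case False
      define h where "h = g \<circ> transpose a b"
      have p: "h permutes {1..n}"
        unfolding h_def using g t by (intro permutes_compose permutes_swap_id) auto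
      have "evenperm h"
        using False t permutes_permutation[OF g(1)]
        by (auto simp: h_def evenperm_comp evenperm_swap permutation_swap_id)
      then have "h \<circ> t \<circ> inv' h \<in> N" using assms(1) p by (intro conj) (auto simp: Alt_iff)
      moreover have "h a = y" "h b = x" "h c = z" using g t by (auto simp: h_def)
      ultimately have "cyc3 y x z \<in> N"
        using conj_cyc3[OF permutes_bij[OF p], of a b c] t(3) by simp
      then have "inv' (cyc3 y x z) \<in> N" by (rule inv)
      also have "inv' (cyc3 y x z) = cyc3 z x y" using s(1) by (intro inv_cyc3) auto
      also have "\<dots> = s" using s by (auto simp: cyc3_apply fun_eq_iff)
      finally show ?thesis .
    qed
  qed
qed

end

text \<open>The value \<open>s 1\<close> determines \<open>s\<close>: the two points outside {1, s
  1} have to be exchanged as well.\<close>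

lemma V4_if_fpf_involution:
  assumes p: "s permutes {1..4}" and inv: "\<And>a. s (s a) = a" and "s 1 \<noteq> 1" "\<And>c. c \<in> {1..4} \<Longrightarrow> s c \<noteq> c"
  shows "s \<in> V4"
proof -
  have set: "{1..4::nat} = {1, 2, 3, 4}" by auto
  note inj = permutes_eq_iff[OF p]
  have im: "s x \<in> {1, 2, 3, 4}" if "x \<in> {1, 2, 3, 4}" for x
    using permutes_in_image[OF p, of x] that unfolding set by simp
  have fp: "s 2 \<noteq> 2" "s 3 \<noteq> 3" "s 4 \<noteq> 4" using assms(4) by auto
  have c: "s 1 \<in> {2, 3, 4}" using im[of 1] assms(3) by auto
  let ?u = "transpose 1 (s 1) \<circ> (if s 1 = 2 then transpose 3 4 else if s 1 = 3 then transpose 2 4 else transpose 2 3)"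
  have u: "?u permutes {1..4}"
    using c by (intro permutes_compose permutes_swap_id) (auto intro!: permutes_swap_id)
  have i: "s 1 \<noteq> s 2" "s 1 \<noteq> s 3" "s 1 \<noteq> s 4" "s 2 \<noteq> s 3" "s 2 \<noteq> s 4" "s 3 \<noteq> s 4" by (simp_all add: inj)
  have "s = ?u"
  proof (rule permutes_eqI[OF p u])
    fix x :: nat assume "x \<in> {1..4}"
    then have "x = 1 \<or> x = 2 \<or> x = 3 \<or> x = 4" unfolding set by auto
    note x = this
    consider "s 1 = 2" "s 2 = 1" "s 3 = 4" "s 4 = 3" | "s 1 = 3" "s 3 = 1" "s 2 = 4" "s 4 = 2"
      | "s 1 = 4" "s 4 = 1" "s 2 = 3" "s 3 = 2"
    proof -
      consider "s 1 = 2" "s 2 = 1" | "s 1 = 3" "s 3 = 1" | "s 1 = 4" "s 4 = 1"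
        using c inv[of 1] by auto
      then show thesis
      proof cases
        case 1
        then have "s 3 = 4" using im[of 3] i fp by auto
        then show ?thesis using 1 that(1) inv[of 3] by simp
      next
        case 2
        then have "s 2 = 4" using im[of 2] i fp by auto
        then show ?thesis using 2 that(2) inv[of 2] by simp
      next
        case 3
        then have "s 2 = 3" using im[of 2] i fp by auto
        then show ?thesis using 3 that(3) inv[of 2] by simp
      qed
    qed
    then show "s x = ?u x"
      by cases (use x in \<open>elim disjE; simp add: transpose_def\<close>)+
  qed
  then show "s \<in> V4" using c unfolding V4_def by auto
qed

text \<open>V4 acts regularly on four points.\<close>

lemma V4_eqI:
  assumes "s \<in> V4" "t \<in> V4" "s 1 = t 1" shows "s = t"
  using assms unfolding V4_def by (elim insertE emptyE) (simp_all add: transpose_def)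

context alt_invariant_group
begin

theorem normal_trichotomy:
  assumes n: "n \<ge> 3"
  shows "N = {id} \<or> Alt n \<subseteq> N \<or> (n = 4 \<and> N = V4)"
proof -
  consider "N = {id}" | t where "t \<in> N" "t \<in> cycles3 n" | "N \<noteq> {id}" "N \<inter> cycles3 n = {}"
    by blast
  then show ?thesis
  proof cases
    case 2 then show ?thesis using Alt_subset_if_cycles3 by blast
  next
    case 3
    note inv2 = no_cycles3_imp_involution[OF _ 3(2)]
    note fpf = no_cycles3_imp_no_fixpoint[OF _ 3(2)]
    \<comment> \<open>From \<open>s\<close> and a third point \<open>c\<close>,
      \<open>swap_double\<close> produces (1 c)(s 1, s c). It moves only four points, which forces
      degree four; varying \<open>c\<close> gives all of V4.\<close>
    have key: "\<exists>u\<in>N. u 1 = c \<and> u \<noteq> id \<and> n = 4" if s: "s \<in> N" "s \<noteq> id" and c: "c \<in> {1..n}" "c \<noteq> 1" "c \<noteq> s 1" for s c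
    proof -
      have one: "1 \<in> {1..n}" using n by simp
      have "s 1 \<noteq> 1" "s c \<noteq> c" using fpf[OF s] one c(1) by blast+
      moreover have "s c \<noteq> s 1" using c(2) permutes_eq_iff[OF permutes[OF s(1)]] by simp
      moreover have "s c \<noteq> 1" using c(3) inv2[OF s(1), of c] by auto
      ultimately have d: "distinct [1, s 1, c, s c]" using c by auto
      have u: "transpose 1 c \<circ> transpose (s 1) (s c) \<in> N" (is "?u \<in> N")
        using swap_double[OF s(1) refl inv2[OF s(1)] refl] d by auto
      have u1: "?u 1 = c" using d by auto
      then have "?u \<noteq> id" using c(2) by (metis id_apply)
      have r: "{1, s 1, c, s c} \<subseteq> {1..n}"
        using permutes_in_image[OF permutes[OF s(1)]] one c(1) by simp
      \<comment> \<open>\<open>?u\<close> fixes every other point, whereas nontrivial elements of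
        \<open>N\<close> fix none.\<close>
      have "{1..n} \<subseteq> {1, s 1, c, s c}"
      proof
        fix x assume "x \<in> {1..n}"
        then have "?u x \<noteq> x" using fpf[OF u \<open>?u \<noteq> id\<close>] by blast
        then show "x \<in> {1, s 1, c, s c}" by (auto simp: transpose_def split: if_splits)
      qed
      with r have "{1..n} = {1, s 1, c, s c}" by blast
      then have "card {1..n} = card {1, s 1, c, s c}" by simp
      then have "n = 4" using d by simp
      with u u1 \<open>?u \<noteq> id\<close> show ?thesis by blast
    qed
    obtain s where s: "s \<in> N" "s \<noteq> id" using 3(1) id by blast
    have "\<exists>c. c \<in> {1..n} \<and> c \<noteq> 1 \<and> c \<noteq> s 1"
    proof (cases "s 1 = 2")
      case True then show ?thesis using n by (intro exI[of _ 3]) auto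
    next
      case False then show ?thesis using n by (intro exI[of _ 2]) auto
    qed
    then have n4: "n = 4" using key[OF s] by blast
    have V: "s \<in> V4" if "s \<in> N" for s
    proof (cases "s = id")
      case True then show ?thesis by (simp add: V4_def)
    next
      case False
      then show ?thesis
        using V4_if_fpf_involution[of s] permutes[OF that] inv2[OF that] fpf[OF that False] n4 by auto
    qed
    \<comment> \<open>For \<open>c = s 1\<close> the element \<open>s\<close> itself serves; the
      other values come from \<open>key\<close>.\<close>
    have ex: "\<exists>u\<in>N. u 1 = c \<and> u \<noteq> id" if "c \<in> {2, 3, 4}" for c
      using key[OF s, of c] s that n4 by (cases "c = s 1") auto
    have "V4 \<subseteq> N"
    proof
      fix v assume v: "v \<in> V4"
      show "v \<in> N"
      proof (cases "v = id")
        case True then show ?thesis using id by simp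
      next
        case False
        then have "v 1 \<in> {2, 3, 4}" using v by (auto simp: V4_def)
        then obtain u where u: "u \<in> N" "u 1 = v 1" "u \<noteq> id" using ex by blast
        then show ?thesis using V4_eqI[OF V[OF u(1)] v u(2)] by simp
      qed
    qed
    with V n4 show ?thesis by blast
  qed blast
qed

end

section \<open>Pairs of permutations with trivial kernels\<close>

lemma cycles3_at:
  assumes "s \<in> cycles3 n" "s p \<noteq> p"
  shows "s = cyc3 p (s p) (s (s p))" "distinct [p, s p, s (s p)]" "{p, s p, s (s p)} \<subseteq> {1..n}"
proof -
  obtain a b c where s: "distinct [a, b, c]" "{a, b, c} \<subseteq> {1..n}" "s = cyc3 a b c"
    using assms(1) by (rule cycles3E)
  then have "p = a \<and> s p = b \<and> s (s p) = c \<or> p = b \<and> s p = c \<and> s (s p) = a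
      \<or> p = c \<and> s p = a \<and> s (s p) = b"
    using assms(2) by (auto simp: cyc3_apply split: if_splits)
  moreover have "s = cyc3 b c a" "s = cyc3 c a b" using s by (auto simp: fun_eq_iff cyc3_apply)
  ultimately show "s = cyc3 p (s p) (s (s p))" "distinct [p, s p, s (s p)]" "{p, s p, s (s p)} \<subseteq> {1..n}"
    using s by auto
qed

lemma cycles3_moves:
  assumes "s \<in> cycles3 n" obtains p where "s p \<noteq> p"
proof -
  obtain a b c where s: "distinct [a, b, c]" "{a, b, c} \<subseteq> {1..n}" "s = cyc3 a b c"
    using assms by (rule cycles3E)
  then have "s a \<noteq> a" by (auto simp: cyc3_apply)
  then show ?thesis by (rule that)
qed

lemma cycles3_support:
  assumes "s \<in> cycles3 n" "s p \<noteq> p" "s q \<noteq> q"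
  shows "q \<in> {p, s p, s (s p)}"
proof -
  obtain u v where uv: "u = s p" "v = s (s p)" by blast
  have "s = cyc3 p u v" "distinct [p, u, v]"
    unfolding uv by (fact cycles3_at(1,2)[OF assms(1,2)])+
  then have "q \<in> {p, u, v}" using assms(3) cyc3_apply[of p u v q] by (metis insertCI)
  then show ?thesis by (simp only: uv)
qed

lemma cycles3_cube:
  assumes "s \<in> cycles3 n" shows "s (s (s p)) = p"
  using assms by (elim cycles3E) (auto simp: cyc3_apply)

lemma cycles3_permutes: "s \<in> cycles3 n \<Longrightarrow> s permutes {1..n}"
  by (elim cycles3E) (simp only: cyc3_permutes)

lemma cycles3_Alt: "s \<in> cycles3 n \<Longrightarrow> s \<in> Alt n"
  by (elim cycles3E) (simp only: Alt_cyc3)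

text \<open>If the supports meet, both cycles are rotated to start at a common point
  \<open>p\<close>; what remains is the comparison of two pairs of points.\<close>

lemma cycles3_overlap:
  assumes "s \<in> cycles3 n" "t \<in> cycles3 n"
  obtains (disjoint) "\<And>p. s p = p \<or> t p = p"
  | (meet) p q r u v where "distinct [p, q, r]" "distinct [p, u, v]" "s = cyc3 p q r" "t = cyc3 p u v"
proof (cases "\<exists>p. s p \<noteq> p \<and> t p \<noteq> p")
  case True
  then obtain p where p: "s p \<noteq> p" "t p \<noteq> p" by blast
  show ?thesis
    using meet[OF cycles3_at(2)[OF assms(1) p(1)] cycles3_at(2)[OF assms(2) p(2)]
      cycles3_at(1)[OF assms(1) p(1)] cycles3_at(1)[OF assms(2) p(2)]] .
next
  case False
  then show ?thesis using disjoint by blast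
qed

section \<open>Products of two 3-cycles\<close>

lemma cyc3_funpow_3: "distinct [p, q, r] \<Longrightarrow> cyc3 p q r ^^ 3 = id"
  by (auto simp: fun_eq_iff eval_nat_numeral cyc3_apply)

lemma transpose_comp_funpow_2:
  "distinct [p, q, r, v] \<Longrightarrow> (transpose p q \<circ> transpose r v) ^^ 2 = id"
  by (auto simp: fun_eq_iff eval_nat_numeral transpose_def)

lemma cyc3_comp_same_edge:
  "distinct [p, q, r, v] \<Longrightarrow> cyc3 p q r \<circ> cyc3 p q v = transpose p r \<circ> transpose q v"
  by (auto simp: fun_eq_iff cyc3_apply transpose_def)

lemma cyc3_comp_opposite_edge:
  "distinct [p, q, r, u] \<Longrightarrow> cyc3 p q r \<circ> cyc3 p u q = cyc3 p u r"
  by (auto simp: fun_eq_iff cyc3_apply split: if_splits)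

text \<open>Disjoint 3-cycles commute, giving exponent 3. Exactly one common point gives a 5-cycle.
  Exactly two common points give a double transposition if an oriented edge is shared, and a 3-cycle
  if it is traversed in opposite directions. Equal supports give a 3-cycle or the identity, and the
  identity is recorded under exponent 2.\<close>

lemma cycles3_product_order:
  assumes "s \<in> cycles3 n" "t \<in> cycles3 n"
  shows "\<exists>k\<in>{2, 3, 5}. (s \<circ> t) ^^ k = id"
  using assms
proof (cases rule: cycles3_overlap)
  case disjoint
  have c: "s (t p) = t (s p)" for p
    using disjoint[of p] disjoint[of "s p"] disjoint[of "t p"]
      permutes_eq_iff[OF cycles3_permutes[OF assms(1)]] permutes_eq_iff[OF cycles3_permutes[OF assms(2)]] by metis
  have "(s \<circ> t) ((s \<circ> t) ((s \<circ> t) p)) = p" for p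
  proof -
    have "(s \<circ> t) ((s \<circ> t) ((s \<circ> t) p)) = s (s (s (t (t (t p)))))" by (simp add: c)
    then show ?thesis using cycles3_cube[OF assms(1)] cycles3_cube[OF assms(2)] by simp
  qed
  then have "(s \<circ> t) ^^ 3 = id" by (simp add: fun_eq_iff eval_nat_numeral)
  then show ?thesis by blast
next
  case (meet p q r u v)
  consider "q = u" "r = v" | "q = u" "r \<noteq> v" | "q = v" "r = u" | "q = v" "r \<noteq> u"
    | "q \<noteq> u" "q \<noteq> v" "r = u" | "q \<noteq> u" "q \<noteq> v" "r = v" | "q \<notin> {u, v}" "r \<notin> {u, v}"
    by auto
  then show ?thesis
  proof cases
    case 1 then have "t = s" using meet by simp
    then have "(s \<circ> t) ^^ 3 = id" by (simp add: fun_eq_iff eval_nat_numeral cycles3_cube[OF assms(1)])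
    then show ?thesis by blast
  next
    case 2
    then have "distinct [p, q, r, v]" "s \<circ> t = transpose p r \<circ> transpose q v"
      using meet cyc3_comp_same_edge[of p q r v] by auto
    then have "(s \<circ> t) ^^ 2 = id" using transpose_comp_funpow_2[of p r q v] by auto
    then show ?thesis by blast
  next
    case 3
    then have "s \<circ> t = id" using meet by (auto simp: fun_eq_iff cyc3_apply)
    then have "(s \<circ> t) ^^ 2 = id" by simp
    then show ?thesis by blast
  next
    case 4
    then have "distinct [p, q, r, u]" "s \<circ> t = cyc3 p u r"
      using meet cyc3_comp_opposite_edge[of p q r u] by auto
    then have "(s \<circ> t) ^^ 3 = id" using cyc3_funpow_3[of p u r] by auto
    then show ?thesis by blast
  next
    case 5
    have "s = cyc3 r p q" "t = cyc3 r v p"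
      using 5 meet cyc3_rotate[of p q r] cyc3_rotate[of q r p] cyc3_rotate[of p u v] by auto
    then have "distinct [r, p, q, v]" "s \<circ> t = cyc3 r v q"
      using 5 meet(1,2) cyc3_comp_opposite_edge[of r p q v] by auto
    then have "(s \<circ> t) ^^ 3 = id" using cyc3_funpow_3[of r v q] by auto
    then show ?thesis by blast
  next
    case 6
    have "s = cyc3 r p q" "t = cyc3 r p u"
      using 6 meet cyc3_rotate[of p q r] cyc3_rotate[of q r p] cyc3_rotate[of p u v] cyc3_rotate[of u v p] by auto
    then have "distinct [r, p, q, u]" "s \<circ> t = transpose r q \<circ> transpose p u"
      using 6 meet(1,2) cyc3_comp_same_edge[of r p q u] by auto
    then have "(s \<circ> t) ^^ 2 = id" using transpose_comp_funpow_2[of r q p u] by auto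
    then show ?thesis by blast
  next
    case 7
    define w where "w = s \<circ> t"
    have st: "s p = q" "s q = r" "s r = p" "t p = u" "t u = v" "t v = p"
      "\<And>x. x \<notin> {p, q, r} \<Longrightarrow> s x = x" "\<And>x. x \<notin> {p, u, v} \<Longrightarrow> t x = x"
      using meet by (auto simp: cyc3_apply)
    have "s u = u" "s v = v" by (rule st(7), use 7 meet(2) in force)+
    moreover have "t q = q" "t r = r" by (rule st(8), use 7 meet(1) in force)+
    ultimately have w: "w p = u" "w u = v" "w v = q" "w q = r" "w r = p"
      using st(1-6) by (simp_all add: w_def)
    have "w x = x" if "x \<notin> {p, u, v, q, r}" for x using st(7,8) that by (auto simp: w_def)
    moreover have "w (w (w (w (w x)))) = x" if "x \<in> {p, u, v, q, r}" for x
      using that by (auto simp only: w insert_iff empty_iff)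
    ultimately have "w (w (w (w (w x)))) = x" for x by (cases "x \<in> {p, u, v, q, r}") simp_all
    then have "(s \<circ> t) ^^ 5 = id" unfolding w_def[symmetric] by (simp add: fun_eq_iff eval_nat_numeral)
    then show ?thesis by blast
  qed
qed

text \<open>Among the possible overlaps only a common oriented edge is compatible with a product of
  order exactly two; each other configuration has trivial product or a point not returned by its
  square.\<close>

lemma cycles3_share_edge:
  assumes "s \<in> cycles3 n" "t \<in> cycles3 n" "(s \<circ> t) \<circ> (s \<circ> t) = id" "s \<circ> t \<noteq> id"
  shows "\<exists>p. s p \<noteq> p \<and> t p = s p"
proof -
  have inv: "s (t (s (t x))) = x" for x using assms(3) by (simp add: fun_eq_iff)
  show ?thesis using assms(1,2)
  proof (cases rule: cycles3_overlap)
    case disjoint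
    obtain p where p: "s p \<noteq> p" using cycles3_moves[OF assms(1)] .
    then have "t p = p" "t (s p) = s p"
      using disjoint permutes_eq_iff[OF cycles3_permutes[OF assms(1)]] by metis+
    then show ?thesis using inv[of p] cycles3_at(2)[OF assms(1) p] by auto
  next
    case (meet p q r u v)
    have s: "s p = q" "s q = r" "s r = p" "\<And>x. x \<notin> {p, q, r} \<Longrightarrow> s x = x"
      using meet by (auto simp: cyc3_apply)
    have t: "t p = u" "t u = v" "t v = p" using meet by (auto simp: cyc3_apply)
    show ?thesis
    proof (cases "q = u \<or> r = v")
      case True
      then have "t p = s p \<or> t r = s r" using s(1,3) t(1,3) by (elim disjE) simp_all
      moreover have "s p \<noteq> p" "s r \<noteq> r" using s meet(1) by auto
      ultimately show ?thesis by blast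
    next
      case False
      consider "q = v" "r = u" | "q = v" "r \<noteq> u" | "q \<noteq> v" "r = u" | "q \<noteq> v" "r \<noteq> u" by blast
      then show ?thesis
      proof cases
        case 1
        then have "s \<circ> t = id" using meet by (auto simp: fun_eq_iff cyc3_apply)
        then show ?thesis using assms(4) by blast
      next
        case 2
        then have "s u = u" using s(4)[of u] False meet(2) by auto
        then show ?thesis using inv[of p] s t 2 meet(1) by auto
      next
        case 3
        then have "s v = v" using s(4)[of v] False meet(2) by auto
        then show ?thesis using inv[of u] s t 3 meet(1,2) by auto
      next
        case 4
        then have "s u = u" "s v = v" using s(4)[of u] s(4)[of v] False meet(2) by auto
        then show ?thesis using inv[of p] s t 4 meet(2) by auto
      qed
    qed
  qed
qed

text \<open>Write s = (a b x) and t = (a b y). If \<open>w\<close> avoided the edge from a to b, it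
  would share one of b -> x, x -> a with \<open>s\<close> and one of b -> y, y -> a with
  \<open>t\<close>. Injectivity excludes two choices, and that \<open>w\<close> moves only three
  points settles the other two.\<close>

lemma cycles3_common_edge:
  assumes "s \<in> cycles3 n" "t \<in> cycles3 n" "w \<in> cycles3 n" "s a = b" "t a = b" "a \<noteq> b" "s \<noteq> t"
    and "\<exists>p. s p \<noteq> p \<and> w p = s p" "\<exists>q. t q \<noteq> q \<and> w q = t q"
  shows "w a = b"
proof -
  define x y where "x = s b" and "y = t b"
  have s: "s = cyc3 a b x" "distinct [a, b, x]" and t: "t = cyc3 a b y" "distinct [a, b, y]"
    using cycles3_at[OF assms(1), of a] cycles3_at[OF assms(2), of a] assms(4-6) by (auto simp: x_def y_def)
  have "x \<noteq> y" using s t assms(7) by auto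
  note inj = permutes_eq_iff[OF cycles3_permutes[OF assms(3)]]
  note cube = cycles3_cube[OF assms(3)]
  obtain p q where p: "s p \<noteq> p" "w p = s p" and q: "t q \<noteq> q" "w q = t q" using assms(8,9) by blast
  have pp: "p = a \<and> w a = b \<or> p = b \<and> w b = x \<or> p = x \<and> w x = a"
    using p s by (auto simp: cyc3_apply split: if_splits)
  have qq: "q = a \<and> w a = b \<or> q = b \<and> w b = y \<or> q = y \<and> w y = a"
    using q t by (auto simp: cyc3_apply split: if_splits)
  have "False" if w: "w b = x" "w y = a"
  proof -
    have "y \<in> {b, x, w x}" using cycles3_support[OF assms(3), of b y] w s(2) t(2) by auto
    then show False using w \<open>x \<noteq> y\<close> t(2) s(2) cube[of b] by auto
  qed
  moreover have "w a = b" if w: "w x = a" "w b = y"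
  proof -
    have "b \<in> {x, a, w a}" using cycles3_support[OF assms(3), of x b] w s(2) t(2) by auto
    then show ?thesis using s(2) by auto
  qed
  moreover have "\<not> (w b = x \<and> w b = y)" using \<open>x \<noteq> y\<close> by auto
  moreover have "\<not> (w x = a \<and> w y = a)" using \<open>x \<noteq> y\<close> inj by metis
  ultimately show ?thesis using pp qq by blast
qed

text \<open>A subgroup of Sym(n) x Sym(n), kept as a relation: exchanging the factors is then
  \<open>converse\<close>, and isomorphisms compose by relational composition.\<close>

locale perm_pairs =
  fixes n :: nat and P :: "((nat \<Rightarrow> nat) \<times> (nat \<Rightarrow> nat)) set"
  assumes permutes: "(a, b) \<in> P \<Longrightarrow> a permutes {1..n} \<and> b permutes {1..n}"
    and one: "(id, id) \<in> P"
    and comp: "(a, b) \<in> P \<Longrightarrow> (c, d) \<in> P \<Longrightarrow> (a \<circ> c, b \<circ> d) \<in> P"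
    and inv: "(a, b) \<in> P \<Longrightarrow> (inv' a, inv' b) \<in> P"
begin

lemma conj: "(g, g') \<in> P \<Longrightarrow> (a, b) \<in> P \<Longrightarrow> (g \<circ> a \<circ> inv' g, g' \<circ> b \<circ> inv' g') \<in> P"
  by (intro comp inv)

lemma funpow: "(a, b) \<in> P \<Longrightarrow> (a ^^ k, b ^^ k) \<in> P"
  by (induction k) (simp_all add: one comp del: o_apply)

lemma converse: "perm_pairs n (P\<inverse>)"
  by unfold_locales (auto dest: permutes intro: one comp inv simp del: One_nat_def)

end

text \<open>With both kernels trivial the relation is single-valued in both directions, hence the
  graph of an isomorphism between its projections.\<close>

locale faithful_pairs = perm_pairs +
  assumes left_trivial: "(a, id) \<in> P \<Longrightarrow> a = id"
    and right_trivial: "(id, b) \<in> P \<Longrightarrow> b = id"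
begin

lemma converse: "faithful_pairs n (P\<inverse>)"
  by (intro faithful_pairs.intro converse faithful_pairs_axioms.intro) (auto simp: left_trivial right_trivial)

lemma right_unique:
  assumes "(a, b) \<in> P" "(a, c) \<in> P"
  shows "b = c"
proof -
  note p = permutes[OF assms(1)] permutes[OF assms(2)]
  have "(a \<circ> inv' a, b \<circ> inv' c) \<in> P" using assms by (intro comp inv)
  moreover have "a \<circ> inv' a = id" using p permutes_inv_o(1) by blast
  ultimately have "b \<circ> inv' c = id" using right_trivial by simp
  then have "b \<circ> inv' c \<circ> c = c" by simp
  then show ?thesis using p by (simp add: comp_assoc permutes_inv_o)
qed

interpretation conv: faithful_pairs n "P\<inverse>" by (rule converse)

lemma left_unique: "(a, c) \<in> P \<Longrightarrow> (b, c) \<in> P \<Longrightarrow> a = b"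
  using conv.right_unique by blast

text \<open>A commutator of a 3-cycle is a product of two 3-cycles, hence has order 1, 2, 3 or 5. If \<open>s\<close>
  contains two 3-cycles and there is a seventh point, some commutator of \<open>s\<close> has order 4 or 6.\<close>

lemma cycles3_image:
  assumes alt: "Alt n \<subseteq> snd ` P" and t: "t \<in> cycles3 n" and ts: "(t, s) \<in> P"
    and s: "s \<notin> cycles3 n"
  shows "n = 6" "x \<in> {1..n} \<Longrightarrow> s x \<noteq> x" "s (s (s x)) = x"
proof -
  have ps: "s permutes {1..n}" using permutes[OF ts] by blast
  note inj = permutes_eq_iff[OF ps]
  have "(t ^^ 3, s ^^ 3) \<in> P" using ts by (rule funpow)
  moreover have "t ^^ 3 = id" using cycles3_cube[OF t] by (simp add: fun_eq_iff eval_nat_numeral)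
  ultimately have "s ^^ 3 = id" using right_trivial by simp
  then show cube: "s (s (s x)) = x" for x by (simp add: fun_eq_iff eval_nat_numeral)
  have "s \<noteq> id" using left_trivial[of t] ts cycles3_moves[OF t] by (metis id_apply)
  then obtain a where a: "s a \<noteq> a" by (auto simp: fun_eq_iff)
  define b c where "b = s a" and "c = s b"
  have abc: "s a = b" "s b = c" "s c = a" using cube by (simp_all add: b_def c_def)
  have "a \<noteq> b" using a by (simp add: b_def)
  then have d3: "distinct [a, b, c]" using abc inj by (metis distinct_length_2_or_more distinct_singleton)
  have moved: "x \<in> {1..n}" if "s x \<noteq> x" for x using that permutes_not_in[OF ps] by blast
  have r3: "{a, b, c} \<subseteq> {1..n}" using moved[of a] moved[of b] moved[of c] abc d3 by auto
  have "s \<noteq> cyc3 a b c" using s cycles3I[OF d3 r3] by blast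
  then obtain d where "s d \<noteq> cyc3 a b c d" by blast
  then have d: "d \<notin> {a, b, c}" "s d \<noteq> d"
    using d3 abc by (auto simp: cyc3_apply split: if_splits)
  define e f where "e = s d" and "f = s e"
  have def': "s d = e" "s e = f" "s f = d" using cube by (simp_all add: e_def f_def)
  have e: "e \<notin> {a, b, c, d}" using d abc def' inj by auto
  then have f: "f \<notin> {a, b, c, d, e}" using d abc def' inj by auto
  have d6: "distinct [a, b, c, d, e, f]" using d3 d e f by auto
  have r6: "{d, e, f} \<subseteq> {1..n}" using moved[of d] moved[of e] moved[of f] def' d6 by auto
  have all: "{1..n} \<subseteq> {a, b, c, d, e, f}"
  proof (rule ccontr)
    assume "\<not> {1..n} \<subseteq> {a, b, c, d, e, f}"
    then obtain x where x: "x \<in> {1..n}" "x \<notin> {a, b, c, d, e, f}" by blast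
    define y where "y = s x"
    have y: "y \<notin> {a, b, c, d, e}" using x abc def' inj by (auto simp: y_def)
    \<comment> \<open>\<open>g\<close> is even, so it has a partner \<open>g'\<close>. It links the
      two 3-cycles of \<open>s\<close> through \<open>a\<close> and \<open>d\<close> and brings in
      the further point \<open>x\<close>. If \<open>s\<close> fixes \<open>x\<close>, then
      \<open>y = x\<close>, which the computation allows.\<close>
    define g where "g = transpose a d \<circ> transpose b x"
    have "g \<in> Alt n" unfolding g_def using d6 x r3 r6 by (intro Alt_double_transpose) auto
    then obtain g' where g': "(g', g) \<in> P" using alt by auto
    then have pg: "g' permutes {1..n}" "g permutes {1..n}" using permutes by blast+
    define w where "w = s \<circ> (g \<circ> inv' s \<circ> inv' g)"
    have "(t \<circ> (g' \<circ> inv' t \<circ> inv' g'), w) \<in> P"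
      unfolding w_def using ts g' by (intro comp conj inv)
    moreover have "inv' t \<in> cycles3 n"
      using t by (elim cycles3E) (auto simp: inv_cyc3 intro!: cycles3I)
    then have "g' \<circ> inv' t \<circ> inv' g' \<in> cycles3 n" using pg cycles3_conj by blast
    then obtain k where k: "k \<in> {2, 3, 5}" "(t \<circ> (g' \<circ> inv' t \<circ> inv' g')) ^^ k = id"
      using cycles3_product_order[OF t] by blast
    ultimately have wk: "w ^^ k = id" using funpow right_trivial by metis
    have "inv' g = g"
      unfolding g_def using d6 x by (intro inv_equality) (auto simp: transpose_def)
    then have "w = s \<circ> g \<circ> inv' s \<circ> g" by (simp add: w_def comp_assoc)
    also have "s \<circ> g \<circ> inv' s = transpose b e \<circ> transpose c y"
      using abc def' by (simp only: g_def conj_comp[OF permutes_bij[OF ps]] conj_transpose[OF permutes_bij[OF ps]] y_def)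
    finally have w: "w = transpose b e \<circ> transpose c y \<circ> (transpose a d \<circ> transpose b x)"
      by (simp only: g_def comp_assoc)
    \<comment> \<open>The 2-cycle on \<open>a\<close> and \<open>d\<close> excludes the exponents 3
      and 5, and the point \<open>b\<close> excludes 2.\<close>
    have "w a = d" "w d = a" using d6 x y by (auto simp: w transpose_def)
    moreover have "w (w b) \<noteq> b" using d6 x y by (auto simp: w transpose_def)
    ultimately show False using wk k(1) d6 by (auto simp: fun_eq_iff eval_nat_numeral) metis+
  qed
  then have eq: "{1..n} = {a, b, c, d, e, f}" using r3 r6 by blast
  then have "card {1..n} = card {a, b, c, d, e, f}" by simp
  then show "n = 6" using d6 by simp
  show "s x \<noteq> x" if "x \<in> {1..n}" for x using that abc def' d6 unfolding eq by auto
qed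

end

lemma cyc3_support_eq:
  assumes "distinct [a, b, c]" "distinct [x, y, z]" "cyc3 a b c = cyc3 x y z"
  shows "a \<in> {x, y, z}"
proof (rule ccontr)
  assume "a \<notin> {x, y, z}"
  then have "cyc3 x y z a = a" using assms(2) by (simp add: cyc3_apply)
  moreover have "cyc3 a b c a = b" using assms(1) by (simp add: cyc3_apply)
  ultimately show False using assms by simp
qed

context faithful_pairs
begin

text \<open>The products of distinct 3-cycles \<open>(1 2 i)\<close> are involutions, so their images pairwise share an
  oriented edge, and at least three of them can only share the same one, \<open>\<pi> 1 \<rightarrow> \<pi> 2\<close>.\<close>

lemma point_map:
  assumes n: "n \<ge> 4"
    and cyc: "\<And>t. t \<in> cycles3 n \<Longrightarrow> \<exists>s\<in>cycles3 n. (t, s) \<in> P"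
  obtains \<pi> where "\<pi> permutes {1..n}"
    "\<And>i. i \<in> {3..n} \<Longrightarrow> (cyc3 1 2 i, cyc3 (\<pi> 1) (\<pi> 2) (\<pi> i)) \<in> P"
proof -
  have ci: "cyc3 1 2 i \<in> cycles3 n" if "i \<in> {3..n}" for i
    using that by (intro cycles3I) auto
  have "\<forall>i\<in>{3..n}. \<exists>s. s \<in> cycles3 n \<and> (cyc3 1 2 i, s) \<in> P"
    using cyc ci by blast
  then obtain S where S: "\<And>i. i \<in> {3..n} \<Longrightarrow> S i \<in> cycles3 n"
    "\<And>i. i \<in> {3..n} \<Longrightarrow> (cyc3 1 2 i, S i) \<in> P"
    by metis
  have c12: "cyc3 1 2 i \<noteq> cyc3 1 2 j" if "i \<in> {3..n}" "j \<in> {3..n}" "i \<noteq> j" for i j :: nat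
  proof
    assume "cyc3 1 2 i = cyc3 1 2 j"
    then have "cyc3 1 2 i 2 = cyc3 1 2 j 2" by simp
    then show False using that by (simp add: cyc3_apply)
  qed
  have Sneq: "S i \<noteq> S j" if "i \<in> {3..n}" "j \<in> {3..n}" "i \<noteq> j" for i j
    using S(2)[OF that(1)] S(2)[OF that(2)] c12[OF that] left_unique by metis
  have share: "\<exists>p. S i p \<noteq> p \<and> S j p = S i p" if ij: "i \<in> {3..n}" "j \<in> {3..n}" "i \<noteq> j" for i j
  proof (rule cycles3_share_edge[OF S(1)[OF ij(1)] S(1)[OF ij(2)]])
    let ?c = "cyc3 1 2 i \<circ> cyc3 1 2 j"
    have c: "(?c, S i \<circ> S j) \<in> P" using S ij by (intro comp) auto
    have "?c = transpose 1 i \<circ> transpose 2 j"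
      using cyc3_comp_same_edge[of 1 2 i j] ij by auto
    moreover have "distinct [1, i, 2, j]" using ij by auto
    ultimately have c2: "?c \<circ> ?c = id" and c1: "?c 1 = i"
      using transpose_comp_funpow_2[of 1 i 2 j] by (auto simp: eval_nat_numeral)
    have "(?c \<circ> ?c, (S i \<circ> S j) \<circ> (S i \<circ> S j)) \<in> P" using c c by (rule comp)
    then show "(S i \<circ> S j) \<circ> (S i \<circ> S j) = id" unfolding c2 by (rule right_trivial)
    show "S i \<circ> S j \<noteq> id"
    proof
      assume "S i \<circ> S j = id"
      then have "?c = id" using c left_trivial by simp
      then show False using c1 ij by simp
    qed
  qed
  \<comment> \<open>The images for 3 and 4 supply the common edge from \<open>a\<close> to
    \<open>b\<close>; each further image is compared with both of them.\<close>
  have r: "3 \<in> {3..n}" "4 \<in> {3..n}" using n by auto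
  obtain a where a: "S 3 a \<noteq> a" "S 4 a = S 3 a" using share[OF r] by auto
  define b where "b = S 3 a"
  have Sa: "S i a = b" if i: "i \<in> {3..n}" for i
  proof -
    consider "i = 3" | "i = 4" | "i \<noteq> 3" "i \<noteq> 4" by blast
    then show ?thesis
    proof cases
      case 3
      show ?thesis
        using cycles3_common_edge[OF S(1)[OF r(1)] S(1)[OF r(2)] S(1)[OF i], of a b]
          a Sneq[OF r] share[OF r(1) i] share[OF r(2) i] 3 by (simp add: b_def)
    qed (use a in \<open>simp_all add: b_def\<close>)
  qed
  define z where "z i = S i b" for i
  have ab: "a \<noteq> b" using a b_def by simp
  have Sz: "S i = cyc3 a b (z i)" "distinct [a, b, z i]" "{a, b, z i} \<subseteq> {1..n}" if i: "i \<in> {3..n}" for i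
    using cycles3_at[OF S(1)[OF i], of a] Sa[OF i] ab by (simp_all add: z_def)
  \<comment> \<open>The ends of the common edge are the images of 1 and 2, and the remaining point
    of the cycle \<open>S i\<close> is the image of \<open>i\<close>.\<close>
  define f where "f = (\<lambda>i. if i = 1 then a else if i = 2 then b else z i)"
  have split: "{1..n} = {1, 2} \<union> {3..n}" using n by auto
  have zinj: "z i \<noteq> z j" if "i \<in> {3..n}" "j \<in> {3..n}" "i \<noteq> j" for i j
    using Sneq[OF that] Sz(1)[OF that(1)] Sz(1)[OF that(2)] by auto
  have "inj_on f {1..n}"
  proof (rule inj_onI)
    fix i j assume ij: "i \<in> {1..n}" "j \<in> {1..n}" "f i = f j"
    show "i = j"
    proof (rule ccontr)
      assume "i \<noteq> j"
      consider "i \<in> {3..n}" "j \<in> {3..n}" | "i \<in> {1, 2}" "j \<in> {3..n}" | "i \<in> {3..n}" "j \<in> {1, 2}"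
        | "i \<in> {1, 2}" "j \<in> {1, 2}" using ij split by blast
      then show False
      proof cases
        case 1 then show ?thesis using zinj[OF 1 \<open>i \<noteq> j\<close>] ij(3) by (auto simp: f_def)
      next
        case 2 then show ?thesis using Sz(2)[OF 2(2)] ij(3) by (auto simp: f_def)
      next
        case 3 then show ?thesis using Sz(2)[OF 3(1)] ij(3) by (auto simp: f_def)
      next
        case 4 then show ?thesis using ab ij(3) \<open>i \<noteq> j\<close> by (auto simp: f_def)
      qed
    qed
  qed
  moreover have "f ` {1..n} \<subseteq> {1..n}"
  proof
    fix y assume "y \<in> f ` {1..n}"
    then have "y \<in> {a, b} \<or> (\<exists>i\<in>{3..n}. y = z i)"
      unfolding split by (auto simp: f_def)
    then show "y \<in> {1..n}" using Sz(3) r by blast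
  qed
  ultimately obtain \<pi> where \<pi>: "\<pi> permutes {1..n}" "\<And>x. x \<in> {1..n} \<Longrightarrow> \<pi> x = f x"
    using permutes_extend[of f "{1..n}" "{1..n}"] by blast
  show ?thesis
  proof (rule that[OF \<pi>(1)])
    fix i assume i: "i \<in> {3..n}"
    then have "\<pi> 1 = a" "\<pi> 2 = b" "\<pi> i = z i" using \<pi>(2)[of 1] \<pi>(2)[of 2] \<pi>(2)[of i] by (auto simp: f_def)
    then show "(cyc3 1 2 i, cyc3 (\<pi> 1) (\<pi> 2) (\<pi> i)) \<in> P" using S(2)[OF i] Sz(1)[OF i] by simp
  qed
qed

text \<open>The relation \<open>R\<close> collects the 3-cycles on which \<pi> gives the partner. It
  is closed under rotation, reversal and conjugation of one cycle by another. Conjugating the cycles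
  (1 2 i) and their inverses among themselves yields (2 i j) and (1 i j); conjugating (2 i j) by (1
  2 k) then yields (k i j).\<close>

lemma all_cyc3:
  assumes \<pi>: "\<pi> permutes {1..n}"
    and base: "\<And>i. i \<in> {3..n} \<Longrightarrow> (cyc3 1 2 i, cyc3 (\<pi> 1) (\<pi> 2) (\<pi> i)) \<in> P"
    and xyz: "distinct [x, y, z]" "{x, y, z} \<subseteq> {1..n}"
  shows "(cyc3 x y z, cyc3 (\<pi> x) (\<pi> y) (\<pi> z)) \<in> P"
proof -
  note inj = permutes_eq_iff[OF \<pi>]
  define R where "R x y z \<longleftrightarrow> distinct [x, y, z] \<and> (cyc3 x y z, cyc3 (\<pi> x) (\<pi> y) (\<pi> z)) \<in> P" for x y z
  have dpi: "distinct [\<pi> x, \<pi> y, \<pi> z]" if "distinct [x, y, z]" for x y z using that inj by auto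
  have rot: "R y z x" if "R x y z" for x y z
    using that cyc3_rotate[of x y z] cyc3_rotate[OF dpi, of x y z] by (auto simp: R_def)
  have Rinv: "R z y x" if "R x y z" for x y z
    using that inv[of "cyc3 x y z" "cyc3 (\<pi> x) (\<pi> y) (\<pi> z)"] inv_cyc3[of x y z] inv_cyc3[OF dpi, of x y z]
    by (auto simp: R_def)
  have Rconj: "R (cyc3 x y z i) (cyc3 x y z j) (cyc3 x y z k)" if R: "R x y z" "R i j k" for x y z i j k
  proof -
    let ?t = "cyc3 x y z" and ?s = "cyc3 (\<pi> x) (\<pi> y) (\<pi> z)"
    have d: "distinct [x, y, z]" using R by (simp add: R_def)
    have s: "?s (\<pi> l) = \<pi> (?t l)" for l
      using d dpi[OF d] inj by (simp add: cyc3_apply)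
    have b: "bij ?t" "bij ?s" unfolding cyc3_def by (simp_all add: bij_comp)
    have "(?t \<circ> cyc3 i j k \<circ> inv' ?t, ?s \<circ> cyc3 (\<pi> i) (\<pi> j) (\<pi> k) \<circ> inv' ?s) \<in> P"
      using R by (intro conj) (auto simp: R_def)
    then have "(cyc3 (?t i) (?t j) (?t k), cyc3 (\<pi> (?t i)) (\<pi> (?t j)) (\<pi> (?t k))) \<in> P"
      by (simp only: conj_cyc3[OF b(1)] conj_cyc3[OF b(2)] s)
    moreover have "distinct [?t i, ?t j, ?t k]"
      using R(2) bij_is_inj[OF b(1)] by (auto simp: R_def dest: injD)
    ultimately show ?thesis by (simp add: R_def)
  qed
  have R12: "R 1 2 i" if "i \<in> {3..n}" for i using base[OF that] that by (auto simp: R_def)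
  have R2: "R 2 i j" if "i \<in> {3..n}" "j \<in> {3..n}" "i \<noteq> j" for i j
    using Rconj[OF R12[OF that(1)] R12[OF that(2)]] that by (auto simp: cyc3_apply)
  have R1: "R 1 i j" if "i \<in> {3..n}" "j \<in> {3..n}" "i \<noteq> j" for i j
  proof -
    have "R j 1 i" using Rconj[OF Rinv[OF R12[OF that(2)]] R12[OF that(1)]] that by (auto simp: cyc3_apply)
    then show ?thesis by (rule rot)
  qed
  have R3: "R k i j" if "i \<in> {3..n}" "j \<in> {3..n}" "k \<in> {3..n}" "distinct [i, j, k]" for i j k
    using Rconj[OF R12[OF that(3)] R2[OF that(1,2)]] that by (auto simp: cyc3_apply)
  have with1: "R 1 y z" if yz: "distinct [1, y, z]" "{y, z} \<subseteq> {1..n}" for y z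
  proof -
    consider "y = 2" "z \<in> {3..n}" | "z = 2" "y \<in> {3..n}" | "y \<in> {3..n}" "z \<in> {3..n}"
      using yz by (cases "y = 2"; cases "z = 2") auto
    then show ?thesis
    proof cases
      case 1 then show ?thesis using R12 by simp
    next
      case 2 then show ?thesis using Rinv[OF rot[OF R12[OF 2(2)]]] by (simp add: rot)
    next
      case 3 then show ?thesis using R1 yz by simp
    qed
  qed
  have with2: "R 2 y z" if yz: "distinct [2, y, z]" "{y, z} \<subseteq> {1..n}" "2 \<in> {1..n}" for y z
  proof -
    consider "y = 1" | "z = 1" | "y \<in> {3..n}" "z \<in> {3..n}"
      using yz by (cases "y = 1"; cases "z = 1") auto
    then show ?thesis
    proof cases
      case 1
      then have "R 1 z 2" using yz by (intro with1) auto
      then show ?thesis using rot 1 by blast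
    next
      case 2
      then have "R 1 2 y" using yz by (intro with1) auto
      then show ?thesis using rot 2 by blast
    next
      case 3 then show ?thesis using R2 yz by simp
    qed
  qed
  consider "x = 1" | "y = 1" | "z = 1" | "x = 2" | "y = 2" | "z = 2" | "{x, y, z} \<subseteq> {3..n}"
    using xyz(2) by fastforce
  then have "R x y z"
  proof cases
    case 1 then show ?thesis using with1 xyz by auto
  next
    case 2 then have "R y z x" using with1 xyz by auto
    then show ?thesis using rot by blast
  next
    case 3 then have "R z x y" using with1 xyz by auto
    then show ?thesis using rot by blast
  next
    case 4 then show ?thesis using with2 xyz by auto
  next
    case 5 then have "R y z x" using with2 xyz by auto
    then show ?thesis using rot by blast
  next
    case 6 then have "R z x y" using with2 xyz by auto
    then show ?thesis using rot by blast
  next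
    case 7 then show ?thesis using R3[of y z x] xyz by auto
  qed
  then show ?thesis by (simp add: R_def)
qed

text \<open>An arbitrary pair (h, h') in \<open>P\<close> acts by conjugation on the pairs of
  3-cycles, so h' carries the \<pi>-image of a triple to the \<pi>-image of its h-image. Triples
  isolate points, which determines h' for odd h as well.\<close>

theorem rigid:
  assumes n: "n \<ge> 4"
    and cyc: "\<And>t. t \<in> cycles3 n \<Longrightarrow> \<exists>s\<in>cycles3 n. (t, s) \<in> P"
  obtains \<pi> where "\<pi> permutes {1..n}" "\<And>h h'. (h, h') \<in> P \<Longrightarrow> h' = \<pi> \<circ> h \<circ> inv' \<pi>"
proof -
  obtain \<pi> where \<pi>: "\<pi> permutes {1..n}"
    and base: "\<And>i. i \<in> {3..n} \<Longrightarrow> (cyc3 1 2 i, cyc3 (\<pi> 1) (\<pi> 2) (\<pi> i)) \<in> P"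
    using point_map[OF n cyc] by blast
  have "h' = \<pi> \<circ> h \<circ> inv' \<pi>" if hh: "(h, h') \<in> P" for h h'
  proof -
    have p: "h permutes {1..n}" "h' permutes {1..n}" using permutes[OF hh] by auto
    note injs = permutes_eq_iff[OF p(1)] permutes_eq_iff[OF p(2)] permutes_eq_iff[OF \<pi>]
    have mem: "h' (\<pi> x) \<in> {\<pi> (h x), \<pi> (h y), \<pi> (h z)}"
      if d: "distinct [x, y, z]" "{x, y, z} \<subseteq> {1..n}" for x y z
    proof -
      have "(h \<circ> cyc3 x y z \<circ> inv' h, h' \<circ> cyc3 (\<pi> x) (\<pi> y) (\<pi> z) \<circ> inv' h') \<in> P"
        by (intro conj[OF hh] all_cyc3[OF \<pi> base d]) auto
      then have 1: "(cyc3 (h x) (h y) (h z), cyc3 (h' (\<pi> x)) (h' (\<pi> y)) (h' (\<pi> z))) \<in> P"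
        by (simp only: conj_cyc3[OF permutes_bij[OF p(1)]] conj_cyc3[OF permutes_bij[OF p(2)]])
      have "(cyc3 (h x) (h y) (h z), cyc3 (\<pi> (h x)) (\<pi> (h y)) (\<pi> (h z))) \<in> P"
        using d injs permutes_in_image[OF p(1)] by (intro all_cyc3[OF \<pi> base]) auto
      then have "cyc3 (h' (\<pi> x)) (h' (\<pi> y)) (h' (\<pi> z)) = cyc3 (\<pi> (h x)) (\<pi> (h y)) (\<pi> (h z))"
        using right_unique[OF 1] by blast
      then show ?thesis by (rule cyc3_support_eq[rotated 2]) (use d injs in auto)
    qed
    have eq: "h' (\<pi> x) = \<pi> (h x)" if x: "x \<in> {1..n}" for x
    proof -
      have "card ({1..n} - {x}) \<ge> 3" using n x by simp
      then obtain T where "T \<subseteq> {1..n} - {x}" "card T = 3"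
        by (meson obtain_subset_with_card_n)
      then obtain y z w where T: "{y, z, w} \<subseteq> {1..n} - {x}" "y \<noteq> z" "z \<noteq> w" "y \<noteq> w"
        by (elim card_3_iff[THEN iffD1, elim_format] exE) blast
      then have yzw: "distinct [x, y, z, w]" "{x, y, z, w} \<subseteq> {1..n}" using x by auto
      have d: "distinct [\<pi> (h x), \<pi> (h y), \<pi> (h z), \<pi> (h w)]" using yzw(1) injs by simp
      \<comment> \<open>Three triples from {x, y, z, w} through \<open>x\<close> meet only in
        \<open>x\<close>; this is where four points are used.\<close>
      have "h' (\<pi> x) \<in> {\<pi> (h x), \<pi> (h y), \<pi> (h z)} \<inter> {\<pi> (h x), \<pi> (h y), \<pi> (h w)} \<inter> {\<pi> (h x), \<pi> (h z), \<pi> (h w)}"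
        using yzw by (intro IntI mem) auto
      also have "\<dots> = {\<pi> (h x)}" using d by auto
      finally show ?thesis by blast
    qed
    have "h' \<circ> \<pi> = \<pi> \<circ> h"
    proof (rule permutes_eqI)
      show "h' \<circ> \<pi> permutes {1..n}" "\<pi> \<circ> h permutes {1..n}"
        using p \<pi> by (simp_all add: permutes_compose)
    qed (simp add: eq)
    then have "h' \<circ> (\<pi> \<circ> inv' \<pi>) = \<pi> \<circ> h \<circ> inv' \<pi>" by (simp only: flip: comp_assoc)
    then show ?thesis using permutes_inv_o(1)[OF \<pi>] by simp
  qed
  with \<pi> that show ?thesis by blast
qed

end

text \<open>Degree five leaves two points off the support for correcting the parity of the
  conjugator.\<close>

lemma cycles3_conjugate:
  assumes n: "n \<ge> 5" and s: "s \<in> cycles3 n" and t: "t \<in> cycles3 n"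
  obtains g where "g \<in> Alt n" "t = g \<circ> s \<circ> inv' g"
proof -
  obtain a b c where abc: "distinct [a, b, c]" "{a, b, c} \<subseteq> {1..n}" "s = cyc3 a b c"
    using s by (rule cycles3E)
  obtain x y z where xyz: "distinct [x, y, z]" "{x, y, z} \<subseteq> {1..n}" "t = cyc3 x y z"
    using t by (rule cycles3E)
  obtain g where g: "g \<in> Alt n" "map g [a, b, c] = [x, y, z]"
    by (rule Alt_map_list[OF abc(1) xyz(1), of n]) (use n abc(2) xyz(2) in simp_all)
  then have "g permutes {1..n}" by (simp only: Alt_iff)
  from conj_cyc3[OF permutes_bij[OF this], of a b c] have "t = g \<circ> s \<circ> inv' g"
    using g(2) abc(3) xyz(3) by simp
  with g(1) show ?thesis by (rule that)
qed

lemma triple_transpose_apply: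
  assumes "distinct [a, b, c, d, e, f]"
  shows "(transpose a d \<circ> (transpose b e \<circ> transpose c f)) a = d"
    "(transpose a d \<circ> (transpose b e \<circ> transpose c f)) b = e"
    "(transpose a d \<circ> (transpose b e \<circ> transpose c f)) c = f"
    "(transpose a d \<circ> (transpose b e \<circ> transpose c f)) d = a"
    "(transpose a d \<circ> (transpose b e \<circ> transpose c f)) e = b"
    "(transpose a d \<circ> (transpose b e \<circ> transpose c f)) f = c"
  using assms by (auto simp: transpose_def)

section \<open>The exceptional isomorphisms of degree six\<close>

text \<open>In degree six these are exactly the elements of cycle type 3 + 3, the other class of
  elements of order three.\<close>

definition double_cycles3 :: "(nat \<Rightarrow> nat) set" where
  "double_cycles3 = {s. s permutes {1..6} \<and> (\<forall>x\<in>{1..6}. s x \<noteq> x) \<and> (\<forall>x. s (s (s x)) = x)}"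

lemma double_cycles3_orbit:
  assumes r: "r \<in> double_cycles3" and x: "x \<in> {1..6}"
  shows "distinct [x, r x, r (r x)] \<and> r (r (r x)) = x \<and> r x \<in> {1..6} \<and> r (r x) \<in> {1..6}"
proof -
  have p: "r permutes {1..6}" and fp: "\<And>x. x \<in> {1..6} \<Longrightarrow> r x \<noteq> x" and cube: "\<And>x. r (r (r x)) = x"
    using r by (auto simp: double_cycles3_def)
  have im: "r x \<in> {1..6}" if "x \<in> {1..6}" for x using permutes_in_image[OF p] that by blast
  have "r (r x) \<noteq> x" using fp[OF x] cube[of x] by metis
  then show ?thesis using fp[OF x] fp[OF im[OF x]] im[OF x] im[OF im[OF x]] cube[of x] by auto
qed

lemma double_cycles3_points:
  assumes "s \<in> double_cycles3"
  obtains a d where "distinct [a, s a, s (s a), d, s d, s (s d)]"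
    "{1..6} = {a, s a, s (s a), d, s d, s (s d)}"
proof -
  note orb = double_cycles3_orbit[OF assms]
  have p: "s permutes {1..6}" using assms by (simp add: double_cycles3_def)
  note inj = permutes_eq_iff[OF p]
  define b where "b = s 1"
  define c where "c = s b"
  have abc: "s 1 = b" "s b = c" "s c = 1" "distinct [1, b, c]" "{1, b, c} \<subseteq> {1..6}"
    using orb[of 1] by (auto simp: b_def c_def)
  have "card ({1..6} - {1, b, c}) = 3" using abc(4,5) by (subst card_Diff_subset) auto
  then obtain d where d: "d \<in> {1..6}" "d \<notin> {1, b, c}" by (metis Diff_iff card.empty ex_in_conv zero_neq_numeral)
  have step: "s x \<notin> {1, b, c}" if "x \<notin> {1, b, c}" for x
  proof -
    have "s x \<noteq> s c" "s x \<noteq> s 1" "s x \<noteq> s b" using that by (simp_all add: inj)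
    then show ?thesis by (simp only: abc) simp
  qed
  have e: "s d \<notin> {1, b, c}" and f: "s (s d) \<notin> {1, b, c}" using step d(2) by blast+
  have dist: "distinct [1, b, c, d, s d, s (s d)]" using abc(4) orb[OF d(1)] d(2) e f by auto
  have sub: "{1, b, c, d, s d, s (s d)} \<subseteq> {1..6}" using abc(5) d(1) orb[OF d(1)] by auto
  have "card {1, b, c, d, s d, s (s d)} = 6" using dist by simp
  then have "{1, b, c, d, s d, s (s d)} = {1..6}" using sub by (intro card_subset_eq) auto
  then show ?thesis using that[of 1 d] dist abc(1,2) by auto
qed

text \<open>The class does not split under Alt(6): the element \<open>k\<close> exchanging the two
  3-cycles of \<open>s\<close> pointwise commutes with \<open>s\<close> and is odd, being a product
  of three disjoint transpositions. It corrects the parity of a conjugator.\<close>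

lemma double_cycles3_conjugate:
  assumes s: "s \<in> double_cycles3" and t: "t \<in> double_cycles3"
  obtains g where "g \<in> Alt 6" "t = g \<circ> s \<circ> inv' g"
proof -
  have p: "s permutes {1..6}" "t permutes {1..6}"
    and cube: "\<And>x. s (s (s x)) = x" "\<And>x. t (t (t x)) = x"
    using s t by (auto simp: double_cycles3_def)
  obtain a d where ad: "distinct [a, s a, s (s a), d, s d, s (s d)]"
    "{1..6} = {a, s a, s (s a), d, s d, s (s d)}" using s by (rule double_cycles3_points)
  obtain a' d' where ad': "distinct [a', t a', t (t a'), d', t d', t (t d')]"
    "{1..6} = {a', t a', t (t a'), d', t d', t (t d')}" using t by (rule double_cycles3_points)
  obtain g where g: "g permutes {1..6}"
    "map g [a, s a, s (s a), d, s d, s (s d)] = [a', t a', t (t a'), d', t d', t (t d')]"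
    by (rule permutes_map_list[OF ad(1) ad'(1), of "{1..6}"]) (use ad(2) ad'(2) in simp_all)
  have conj: "t = h \<circ> s \<circ> inv' h" if h: "h permutes {1..6}" and hs: "\<And>x. x \<in> {1..6} \<Longrightarrow> h (s x) = t (h x)" for h
  proof -
    have "h \<circ> s = t \<circ> h"
      by (rule permutes_eqI[of _ "{1..6}"]) (use h p hs in \<open>simp_all add: permutes_compose\<close>)
    then have "h \<circ> s \<circ> inv' h = t \<circ> (h \<circ> inv' h)" by (simp add: comp_assoc)
    then show ?thesis using permutes_inv_o(1)[OF h] by simp
  qed
  have gs: "g (s x) = t (g x)" if x: "x \<in> {1..6}" for x
  proof -
    from x ad(2) consider "x = a" | "x = s a" | "x = s (s a)" | "x = d" | "x = s d" | "x = s (s d)" by blast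
    then show ?thesis using g(2) cube by cases simp_all
  qed
  show ?thesis
  proof (cases "evenperm g")
    case True
    then show ?thesis using that[of g] conj[OF g(1) gs] g(1) by (simp add: Alt_iff)
  next
    case False
    define k where "k = transpose a d \<circ> (transpose (s a) (s d) \<circ> transpose (s (s a)) (s (s d)))"
    have kp: "k permutes {1..6}"
      unfolding k_def using ad(2) by (intro permutes_compose permutes_swap_id) auto
    have "\<not> evenperm k"
      using ad(1) by (simp add: k_def evenperm_comp evenperm_swap permutation_swap_id permutation_compose)
    then have ev: "evenperm (g \<circ> k)"
      using False evenperm_comp[OF permutes_permutation[OF g(1)] permutes_permutation[OF kp]] by simp
    have k: "k a = d" "k (s a) = s d" "k (s (s a)) = s (s d)" "k d = a" "k (s d) = s a" "k (s (s d)) = s (s a)"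
      unfolding k_def by (fact triple_transpose_apply[OF ad(1)])+
    have ks: "k (s x) = s (k x)" if x: "x \<in> {1..6}" for x
    proof -
      from x ad(2) consider "x = a" | "x = s a" | "x = s (s a)" | "x = d" | "x = s d" | "x = s (s d)" by blast
      then show ?thesis using k cube by cases simp_all
    qed
    have gk: "g \<circ> k permutes {1..6}" using g(1) kp by (simp add: permutes_compose)
    have "t = (g \<circ> k) \<circ> s \<circ> inv' (g \<circ> k)"
    proof (rule conj[OF gk])
      fix x :: nat assume x: "x \<in> {1..6}"
      then have "k x \<in> {1..6}" using permutes_in_image[OF kp] by blast
      then show "(g \<circ> k) (s x) = t ((g \<circ> k) x)" using gs ks[OF x] by simp
    qed
    then show ?thesis using that[of "g \<circ> k"] ev gk by (simp add: Alt_iff)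
  qed
qed

context faithful_pairs
begin

text \<open>For n >= 5 the 3-cycles form one class under Alt(n), and conjugation lifts to
  \<open>P\<close>. So an isomorphism sends either all 3-cycles to 3-cycles or none.\<close>

lemma cycles3_preserved_if_one:
  assumes n: "n \<ge> 5" and alt: "Alt n \<subseteq> fst ` P"
    and t: "t \<in> cycles3 n" "(t, s) \<in> P" "s \<in> cycles3 n" and u: "u \<in> cycles3 n"
  shows "\<exists>w\<in>cycles3 n. (u, w) \<in> P"
proof -
  obtain g where g: "g \<in> Alt n" "u = g \<circ> t \<circ> inv' g" using cycles3_conjugate[OF n t(1) u] .
  then obtain g' where g': "(g, g') \<in> P" using alt by auto
  then have "(u, g' \<circ> s \<circ> inv' g') \<in> P" unfolding g(2) using t(2) by (rule conj)
  moreover have "g' \<circ> s \<circ> inv' g' \<in> cycles3 n" using t(3) permutes[OF g'] cycles3_conj by blast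
  ultimately show ?thesis by blast
qed

end

locale exotic_pairs = faithful_pairs 6 P for P +
  assumes alt: "Alt 6 \<subseteq> fst ` P" "Alt 6 \<subseteq> snd ` P"
    and not_preserved: "\<exists>t\<in>cycles3 6. \<exists>s. (t, s) \<in> P \<and> s \<notin> cycles3 6"
begin

interpretation conv: faithful_pairs 6 "P\<inverse>" by (rule converse)

lemma image_not_cycles3:
  assumes "t \<in> cycles3 6" "(t, s) \<in> P" shows "s \<notin> cycles3 6"
proof
  assume s: "s \<in> cycles3 6"
  obtain u w where u: "u \<in> cycles3 6" "(u, w) \<in> P" "w \<notin> cycles3 6" using not_preserved by blast
  obtain w' where "w' \<in> cycles3 6" "(u, w') \<in> P"
    using cycles3_preserved_if_one[OF _ alt(1) assms s u(1)] by auto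
  then show False using right_unique u by blast
qed

lemma cycles3_to_double:
  assumes "t \<in> cycles3 6" "(t, s) \<in> P" shows "s \<in> double_cycles3"
  using cycles3_image(2,3)[OF alt(2) assms image_not_cycles3[OF assms]] permutes[OF assms(2)]
  by (auto simp: double_cycles3_def)

text \<open>Since no 3-cycle is sent to a 3-cycle, the preimage of (1 2 3) is a witness for the
  inverse isomorphism.\<close>

lemma converse_exotic: "exotic_pairs (P\<inverse>)"
proof (intro exotic_pairs.intro exotic_pairs_axioms.intro)
  show "faithful_pairs 6 (P\<inverse>)" by (rule converse)
  show "Alt 6 \<subseteq> fst ` (P\<inverse>)" "Alt 6 \<subseteq> snd ` (P\<inverse>)" using alt by force+
  have c: "cyc3 1 2 3 \<in> cycles3 6" by (rule cycles3I) auto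
  then obtain x where x: "(x, cyc3 1 2 3) \<in> P" using alt(2) cycles3_Alt by fastforce
  then have "x \<notin> cycles3 6" using image_not_cycles3 c by blast
  then show "\<exists>t\<in>cycles3 6. \<exists>s. (t, s) \<in> P\<inverse> \<and> s \<notin> cycles3 6" using c x by blast
qed

text \<open>The preimage of (1 2 3) is one double 3-cycle with this property, by the previous lemmas
  applied to the converse; conjugacy under Alt(6) spreads it to all.\<close>

lemma double_to_cycles3:
  assumes d: "d \<in> double_cycles3"
  shows "\<exists>s\<in>cycles3 6. (d, s) \<in> P"
proof -
  have c: "cyc3 1 2 3 \<in> cycles3 6" by (rule cycles3I) auto
  then obtain x where x: "(x, cyc3 1 2 3) \<in> P" using alt(2) cycles3_Alt by fastforce
  then have "x \<in> double_cycles3" using exotic_pairs.cycles3_to_double[OF converse_exotic c] by blast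
  then obtain g where g: "g \<in> Alt 6" "d = g \<circ> x \<circ> inv' g" using double_cycles3_conjugate d by metis
  then obtain g' where g': "(g, g') \<in> P" using alt by auto
  then have "(d, g' \<circ> cyc3 1 2 3 \<circ> inv' g') \<in> P" unfolding g(2) using x by (rule conj)
  moreover have "g' \<circ> cyc3 1 2 3 \<circ> inv' g' \<in> cycles3 6" using c permutes[OF g'] cycles3_conj by blast
  ultimately show ?thesis by blast
qed

end

text \<open>Two isomorphisms that each exchange the two classes of elements of order 3 differ by one that
  preserves 3-cycles, to which rigidity applies.\<close>

theorem exotic_unique:
  assumes "exotic_pairs P" "exotic_pairs Q"
  obtains \<pi> where "\<pi> permutes {1..6}"
    "\<And>h h' q. (h, h') \<in> P \<Longrightarrow> (h, q) \<in> Q \<Longrightarrow> h' = \<pi> \<circ> q \<circ> inv' \<pi>"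
proof -
  interpret P: exotic_pairs P by fact
  interpret Q: exotic_pairs Q by fact
  interpret C: exotic_pairs "Q\<inverse>" by (rule Q.converse_exotic)
  \<comment> \<open>The composite consists of the pairs (q, h') with a common first coordinate h. It
    sends 3-cycles to double 3-cycles and these back to 3-cycles.\<close>
  interpret R: faithful_pairs 6 "Q\<inverse> O P"
  proof
    fix a b assume "(a, b) \<in> Q\<inverse> O P"
    then obtain x where x: "(x, a) \<in> Q" "(x, b) \<in> P" by blast
    show "a permutes {1..6} \<and> b permutes {1..6}" using Q.permutes[OF x(1)] P.permutes[OF x(2)] by blast
    show "(inv' a, inv' b) \<in> Q\<inverse> O P" using Q.inv[OF x(1)] P.inv[OF x(2)] by blast
    fix c d assume "(c, d) \<in> Q\<inverse> O P"
    then obtain y where y: "(y, c) \<in> Q" "(y, d) \<in> P" by blast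
    show "(a \<circ> c, b \<circ> d) \<in> Q\<inverse> O P" using Q.comp[OF x(1) y(1)] P.comp[OF x(2) y(2)] by blast
  next
    show "(id, id) \<in> Q\<inverse> O P" using Q.one P.one by blast
  next
    fix a assume "(a, id) \<in> Q\<inverse> O P"
    then show "a = id" using P.left_trivial Q.right_trivial by blast
  next
    fix a assume "(id, a) \<in> Q\<inverse> O P"
    then show "a = id" using P.right_trivial Q.left_trivial by blast
  qed
  have "\<exists>s\<in>cycles3 6. (t, s) \<in> Q\<inverse> O P" if t: "t \<in> cycles3 6" for t
  proof -
    obtain x where x: "(x, t) \<in> Q" using Q.alt(2) cycles3_Alt[OF t] by auto
    then have "x \<in> double_cycles3" using C.cycles3_to_double t by blast
    then show ?thesis using P.double_to_cycles3 x by blast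
  qed
  then obtain \<pi> where "\<pi> permutes {1..6}" "\<And>h h'. (h, h') \<in> Q\<inverse> O P \<Longrightarrow> h' = \<pi> \<circ> h \<circ> inv' \<pi>"
    using R.rigid by auto
  then show ?thesis using that by blast
qed

lemma insert3_eq_cases:
  assumes "{x, p, q} = {x, u, v}" "distinct [x, p, q]" "distinct [x, u, v]"
  shows "u = p \<and> v = q \<or> u = q \<and> v = p"
proof -
  have "{p, q} = {x, p, q} - {x}" "{u, v} = {x, u, v} - {x}" using assms(2,3) by auto
  then have "{p, q} = {u, v}" using assms(1) by simp
  then show ?thesis by (auto simp: doubleton_eq_iff)
qed

text \<open>All orbits of \<open>s\<close> and \<open>t\<close> have three points, so the invariant
  set \<open>A\<close> and its complement are common orbits of both. On an orbit of size three,
  \<open>t\<close> agrees with \<open>s\<close> or with its inverse.\<close>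

lemma double_cycles3_commute:
  assumes s: "s \<in> double_cycles3" and t: "t \<in> double_cycles3"
    and A: "A \<subseteq> {1..6}" "A \<noteq> {}" "A \<noteq> {1..6}"
    and inv: "\<And>x. x \<in> {1..6} \<Longrightarrow> s x \<in> A \<longleftrightarrow> x \<in> A" "\<And>x. x \<in> {1..6} \<Longrightarrow> t x \<in> A \<longleftrightarrow> x \<in> A"
  shows "s \<circ> t = t \<circ> s"
proof -
  have le: "card B \<ge> 3" if B: "B \<subseteq> {1..6}" "B \<noteq> {}" "\<And>x. x \<in> {1..6} \<Longrightarrow> s x \<in> B \<longleftrightarrow> x \<in> B" for B
  proof -
    obtain x where x: "x \<in> B" "x \<in> {1..6}" using B(1,2) by blast
    have "{x, s x, s (s x)} \<subseteq> B" using x B(3) double_cycles3_orbit[OF s x(2)] by auto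
    then have "card {x, s x, s (s x)} \<le> card B" using finite_subset[OF B(1)] by (intro card_mono) auto
    then show ?thesis using double_cycles3_orbit[OF s x(2)] by simp
  qed
  have sinv: "s x \<in> {1..6} - A \<longleftrightarrow> x \<in> {1..6} - A" if "x \<in> {1..6}" for x
    using inv(1)[OF that] double_cycles3_orbit[OF s that] that by auto
  have "card A + card ({1..6} - A) = 6"
    using A(1) card_Diff_subset[of A "{1..6}"] card_mono[of "{1..6}" A] finite_subset[OF A(1)] by simp
  moreover have "card A \<ge> 3" using le[OF A(1,2)] inv(1) by blast
  moreover have "card ({1..6} - A) \<ge> 3" using le[of "{1..6} - A"] A sinv by blast
  ultimately have c3: "card A = 3" "card ({1..6} - A) = 3" by auto
  have com: "s (t x) = t (s x)"
    if B: "B \<subseteq> {1..6}" "card B = 3" "x \<in> B" "\<And>x. x \<in> {1..6} \<Longrightarrow> s x \<in> B \<longleftrightarrow> x \<in> B"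
      "\<And>x. x \<in> {1..6} \<Longrightarrow> t x \<in> B \<longleftrightarrow> x \<in> B" for B x
  proof -
    have x: "x \<in> {1..6}" using B by blast
    note os = double_cycles3_orbit[OF s x] and ot = double_cycles3_orbit[OF t x]
    have fin: "finite B" using B(1) finite_subset by blast
    have "{x, s x, s (s x)} = B"
      using os B x by (intro card_subset_eq[OF fin]) auto
    moreover have "{x, t x, t (t x)} = B"
      using ot B x by (intro card_subset_eq[OF fin]) auto
    ultimately have "{x, s x, s (s x)} = {x, t x, t (t x)}" by simp
    then have "t x = s x \<and> t (t x) = s (s x) \<or> t x = s (s x) \<and> t (t x) = s x"
      by (rule insert3_eq_cases) (use os ot in auto)
    then show ?thesis using os ot by metis
  qed
  have tinv: "t x \<in> {1..6} - A \<longleftrightarrow> x \<in> {1..6} - A" if "x \<in> {1..6}" for x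
    using inv(2)[OF that] double_cycles3_orbit[OF t that] that by auto
  have p: "s permutes {1..6}" "t permutes {1..6}" using s t by (auto simp: double_cycles3_def)
  show ?thesis
  proof (rule permutes_eqI)
    show "s \<circ> t permutes {1..6}" "t \<circ> s permutes {1..6}" using p by (simp_all add: permutes_compose)
    fix x :: nat assume x: "x \<in> {1..6}"
    show "(s \<circ> t) x = (t \<circ> s) x"
    proof (cases "x \<in> A")
      case True
      then show ?thesis using com[OF A(1) c3(1)] inv by simp
    next
      case False
      then have "x \<in> {1..6} - A" using x by blast
      then show ?thesis using com[of "{1..6} - A" x] c3(2) sinv tinv by simp
    qed
  qed
qed

text \<open>Otherwise the images of the 3-cycles \<open>(x y z)\<close> and \<open>(x y w)\<close>, which fix \<open>i\<close>, preserve the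
  proper subset of neighbours of \<open>i\<close> and therefore commute, although the 3-cycles do not.\<close>

lemma (in exotic_pairs) invariant_relation_full:
  assumes E: "E \<subseteq> {1..6} \<times> {1..6}" "E \<noteq> {}"
    and E_inv: "\<And>i j h h'. (i, j) \<in> E \<Longrightarrow> (h, h') \<in> P \<Longrightarrow> (h i, h' j) \<in> E"
  shows "E = {1..6} \<times> {1..6}"
proof (rule ccontr)
  assume neq: "E \<noteq> {1..6} \<times> {1..6}"
  have full: "{1..6} \<subseteq> {j. (i, j) \<in> E}" if i: "i \<in> {1..6}" "(i, j0) \<in> E" for i j0
  proof (rule ccontr)
    assume n: "\<not> {1..6} \<subseteq> {j. (i, j) \<in> E}"
    define A where "A = {j. (i, j) \<in> E}"
    have A: "A \<subseteq> {1..6}" "A \<noteq> {}" "A \<noteq> {1..6}" using n E(1) i by (auto simp: A_def)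
    \<comment> \<open>Moving 1 to \<open>i\<close> turns 2, 3, 4, 5 into four distinct points other
      than \<open>i\<close>.\<close>
    obtain p where p: "p permutes {1..6}" "p 1 = i"
      using permutes_swap_id[of 1 "{1..6::nat}" i] i(1) by (metis atLeastAtMost_iff one_le_numeral order_refl transpose_apply_first)
    define x y z w where "x = p 2" and "y = p 3" and "z = p 4" and "w = p 5"
    then have xyzw: "distinct [i, x, y, z, w]" "{x, y, z, w} \<subseteq> {1..6}"
      using permutes_in_image[OF p(1)] by (simp_all flip: p(2) add: permutes_eq_iff[OF p(1)])
    let ?t = "cyc3 x y z" and ?u = "cyc3 x y w"
    have c: "?t \<in> cycles3 6" "?u \<in> cycles3 6" using xyzw by (auto intro!: cycles3I)
    obtain s where s: "(?t, s) \<in> P" using alt(1) cycles3_Alt[OF c(1)] by auto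
    obtain r where r: "(?u, r) \<in> P" using alt(1) cycles3_Alt[OF c(2)] by auto
    have d: "s \<in> double_cycles3" "r \<in> double_cycles3" using cycles3_to_double c s r by blast+
    have Ainv: "h' j \<in> A \<longleftrightarrow> j \<in> A" if h: "(h, h') \<in> P" "h i = i" for h h' j
    proof
      assume "j \<in> A" then show "h' j \<in> A" using E_inv[of i j, OF _ h(1)] h(2) by (simp add: A_def)
    next
      have p: "h permutes {1..6}" "h' permutes {1..6}" using permutes[OF h(1)] by auto
      assume "h' j \<in> A"
      then have "(inv' h i, inv' h' (h' j)) \<in> E" using E_inv[OF _ inv[OF h(1)]] by (simp add: A_def)
      moreover have "inv' h i = i" using h(2) p(1) by (metis permutes_inverses(2))
      ultimately show "j \<in> A" using permutes_inverses(2)[OF p(2)] by (simp add: A_def)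
    qed
    have "?t i = i" "?u i = i" using xyzw by (auto simp: cyc3_apply)
    then have "s \<circ> r = r \<circ> s" using double_cycles3_commute[OF d A] Ainv s r by blast
    then have "(?t \<circ> ?u, s \<circ> r) \<in> P" "(?u \<circ> ?t, s \<circ> r) \<in> P" using comp[OF s r] comp[OF r s] by simp_all
    then have "?t \<circ> ?u = ?u \<circ> ?t" by (rule left_unique)
    then have "?t (?u x) = ?u (?t x)" by (simp add: fun_eq_iff)
    moreover have "?t x = y" "?u x = y" "?t y = z" "?u y = w" using xyzw by (auto simp: cyc3_apply)
    ultimately show False using xyzw(1) by simp
  qed
  obtain i j where ij: "(i, j) \<in> E" using E(2) by auto
  have "{1..6} \<times> {1..6} \<subseteq> E"
  proof (rule subsetI, elim SigmaE, hypsubst)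
    fix k l :: nat assume kl: "k \<in> {1..6}" "l \<in> {1..6}"
    have i: "i \<in> {1..6}" using ij E(1) by blast
    obtain g where "g \<in> Alt 6" "g i = k" using Alt_transitive[OF _ i kl(1)] by auto
    then obtain g g' where g: "(g, g') \<in> P" "g i = k" using alt(1) by force
    then have "(k, g' j) \<in> E" using E_inv[OF ij g(1)] by simp
    then show "(k, l) \<in> E" using full[OF kl(1)] kl(2) by blast
  qed
  then show False using neq E(1) by blast
qed

section \<open>Degrees three and four\<close>

lemma sym3_cases:
  fixes p :: "nat \<Rightarrow> nat"
  assumes p: "p permutes {1..3}"
  shows "p \<in> {id, transpose 1 2, transpose 1 3, transpose 2 3, cyc3 1 2 3, cyc3 1 3 2}"
proof -
  have set: "{1..3::nat} = {1, 2, 3}" by auto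
  have im: "p x \<in> {1, 2, 3}" if "x \<in> {1, 2, 3}" for x
    using permutes_in_image[OF p, of x] that unfolding set by simp
  have inj: "p 1 \<noteq> p 2" "p 1 \<noteq> p 3" "p 2 \<noteq> p 3" by (simp_all add: permutes_eq_iff[OF p])
  have eq: "p = q" if "q permutes {1..3}" "p 1 = q 1" "p 2 = q 2" "p 3 = q 3" for q
  proof (rule permutes_eqI[OF p that(1)])
    fix x :: nat assume "x \<in> {1..3}"
    then have "x \<in> {1, 2, 3}" unfolding set .
    then show "p x = q x" using that(2-) by (elim insertE emptyE) simp_all
  qed
  consider "p 1 = 1" "p 2 = 2" "p 3 = 3" | "p 1 = 1" "p 2 = 3" "p 3 = 2" | "p 1 = 2" "p 2 = 1" "p 3 = 3"
    | "p 1 = 2" "p 2 = 3" "p 3 = 1" | "p 1 = 3" "p 2 = 1" "p 3 = 2" | "p 1 = 3" "p 2 = 2" "p 3 = 1"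
    using im[of 1] im[of 2] im[of 3] inj by auto
  then show ?thesis
  proof cases
    case 1 then have "p = id" by (intro eq) (simp_all add: permutes_id)
    then show ?thesis by simp
  next
    case 2 then have "p = transpose 2 3" by (intro eq permutes_swap_id) (simp_all add: transpose_def)
    then show ?thesis by simp
  next
    case 3 then have "p = transpose 1 2" by (intro eq permutes_swap_id) (simp_all add: transpose_def)
    then show ?thesis by simp
  next
    case 4 then have "p = cyc3 1 2 3" by (intro eq cyc3_permutes) (simp_all add: cyc3_apply)
    then show ?thesis by simp
  next
    case 5 then have "p = cyc3 1 3 2" by (intro eq cyc3_permutes) (simp_all add: cyc3_apply)
    then show ?thesis by simp
  next
    case 6 then have "p = transpose 1 3" by (intro eq permutes_swap_id) (simp_all add: transpose_def)
    then show ?thesis by simp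
  qed
qed

text \<open>Conjugation by Sym(3) is simply transitive on the six pairs of a 3-cycle and a
  transposition; the proof names the conjugator for each pair.\<close>

lemma sym3_generators_conj:
  assumes "s \<in> {cyc3 1 2 3, cyc3 1 3 2 :: nat \<Rightarrow> nat}" "y \<in> {transpose 1 2, transpose 1 3, transpose 2 3}"
  obtains \<pi> where "\<pi> permutes {1..3}" "s = \<pi> \<circ> cyc3 1 2 3 \<circ> inv' \<pi>" "y = \<pi> \<circ> transpose 1 2 \<circ> inv' \<pi>"
proof -
  have *: thesis if "\<pi> permutes {1..3}" "s = cyc3 (\<pi> 1) (\<pi> 2) (\<pi> 3)" "y = transpose (\<pi> 1) (\<pi> 2)" for \<pi>
    using \<open>\<And>\<pi>. _ \<Longrightarrow> _ \<Longrightarrow> _ \<Longrightarrow> thesis\<close>[OF that(1)] that conj_cyc3[OF permutes_bij[OF that(1)], of 1 2 3]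
      conj_transpose[OF permutes_bij[OF that(1)], of 1 2] by simp
  have c: "cyc3 1 2 3 permutes {1..3::nat}" "cyc3 1 3 2 permutes {1..3::nat}" by (rule cyc3_permutes, simp)+
  have t: "transpose 1 2 permutes {1..3::nat}" "transpose 1 3 permutes {1..3::nat}" "transpose 2 3 permutes {1..3::nat}"
    by (rule permutes_swap_id, simp_all)+
  have rot: "cyc3 2 3 1 = cyc3 1 2 (3::nat)" "cyc3 3 1 2 = cyc3 1 2 (3::nat)"
    "cyc3 2 1 3 = cyc3 1 3 (2::nat)" "cyc3 3 2 1 = cyc3 1 3 (2::nat)"
    by (auto simp: fun_eq_iff cyc3_apply)
  consider "s = cyc3 1 2 3" "y = transpose 1 2" | "s = cyc3 1 2 3" "y = transpose 1 3"
    | "s = cyc3 1 2 3" "y = transpose 2 3" | "s = cyc3 1 3 2" "y = transpose 1 2"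
    | "s = cyc3 1 3 2" "y = transpose 1 3" | "s = cyc3 1 3 2" "y = transpose 2 3"
    using assms by blast
  then show thesis
  proof cases
    case 1 then show ?thesis by (intro *[OF permutes_id]) simp_all
  next
    case 2 then show ?thesis using rot by (intro *[OF c(2)]) (simp_all add: cyc3_apply transpose_commute)
  next
    case 3 then show ?thesis using rot by (intro *[OF c(1)]) (simp_all add: cyc3_apply)
  next
    case 4 then show ?thesis using rot by (intro *[OF t(1)]) (simp_all add: transpose_def[of 1 2] transpose_commute)
  next
    case 5 then show ?thesis using rot by (intro *[OF t(3)]) (simp_all add: transpose_def[of 2 3])
  next
    case 6 then show ?thesis using rot by (intro *[OF t(2)]) (simp_all add: transpose_def[of 1 3] transpose_commute)
  qed
qed

text \<open>Separating points by triples fails in degree three, so generators are compared instead: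
  the partner of (1 2 3) has order three and the partner of (1 2), if there is one, is an
  involution. Such a pair is conjugate to the original generators.\<close>

lemma rigid3:
  assumes "faithful_pairs 3 P" and t: "cyc3 1 2 3 \<in> fst ` P"
  obtains \<pi> where "\<pi> permutes {1..3}" "\<And>h h'. (h, h') \<in> P \<Longrightarrow> h' = \<pi> \<circ> h \<circ> inv' \<pi>"
proof -
  interpret faithful_pairs 3 P by fact
  let ?t = "cyc3 1 2 3 :: nat \<Rightarrow> nat" and ?x = "transpose 1 2 :: nat \<Rightarrow> nat"
  have t2: "?t \<circ> ?t = cyc3 1 3 2" by (auto simp: fun_eq_iff cyc3_apply)
  have tx: "?t \<circ> ?x = transpose 1 3" "?t \<circ> transpose 1 3 = transpose 2 3"
    by (auto simp: fun_eq_iff cyc3_apply transpose_def)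
  obtain s where ts: "(?t, s) \<in> P" using t by auto
  have ne: "transpose 1 2 \<noteq> (id :: nat \<Rightarrow> nat)" "transpose 1 3 \<noteq> (id :: nat \<Rightarrow> nat)" "transpose 2 3 \<noteq> (id :: nat \<Rightarrow> nat)"
    by (simp_all add: transpose_eq_id_iff)
  have "(?t ^^ 3, s ^^ 3) \<in> P" using ts by (rule funpow)
  then have s3: "s \<circ> (s \<circ> s) = id" using right_trivial cyc3_funpow_3[of 1 2 "3::nat"] by (simp add: eval_nat_numeral)
  have "?t 1 \<noteq> id 1" by (simp add: cyc3_apply)
  then have "s \<noteq> id" using left_trivial ts by metis
  moreover have "s \<notin> {transpose 1 2, transpose 1 3, transpose 2 3}" using s3 ne by auto
  ultimately have s: "s \<in> {cyc3 1 2 3, cyc3 1 3 2}" using sym3_cases permutes[OF ts] by blast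
  show ?thesis
  proof (cases "fst ` P \<subseteq> {id, ?t, ?t \<circ> ?t}")
    case True
    obtain \<pi> where \<pi>: "\<pi> permutes {1..3}" "s = \<pi> \<circ> ?t \<circ> inv' \<pi>"
      using sym3_generators_conj[OF s, of "transpose 1 2"] by blast
    have "(?t \<circ> ?t, s \<circ> s) \<in> P" using ts ts by (rule comp)
    moreover have "s \<circ> s = \<pi> \<circ> (?t \<circ> ?t) \<circ> inv' \<pi>"
      unfolding conj_comp[OF permutes_bij[OF \<pi>(1)]] \<pi>(2) by simp
    moreover have "id = \<pi> \<circ> id \<circ> inv' \<pi>" using permutes_inv_o[OF \<pi>(1)] by simp
    ultimately have *: "(h, \<pi> \<circ> h \<circ> inv' \<pi>) \<in> P" if "h \<in> {id, ?t, ?t \<circ> ?t}" for h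
      using that one ts \<pi>(2) by (elim insertE emptyE) simp_all
    have "h' = \<pi> \<circ> h \<circ> inv' \<pi>" if hh: "(h, h') \<in> P" for h h'
    proof -
      have "h \<in> fst ` P" using hh by (rule image_eqI[rotated]) simp
      then show ?thesis using True * right_unique[OF hh] by blast
    qed
    then show ?thesis using that \<pi>(1) by blast
  next
    case False
    then obtain h h' where h: "(h, h') \<in> P" "h \<notin> {id, ?t, ?t \<circ> ?t}" by force
    \<comment> \<open>Outside the subgroup generated by \<open>?t\<close>, the element
      \<open>h\<close> is a transposition, and multiplication by a power of \<open>?t\<close> turns
      it into \<open>?x\<close>.\<close>
    have "h \<in> {?x, ?t \<circ> ?x, ?t \<circ> (?t \<circ> ?x)}"
      using sym3_cases[OF conjunct1[OF permutes[OF h(1)]]] h(2) unfolding t2 tx insert_iff empty_iff by argo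
    moreover have tt: "?t \<circ> (?t \<circ> (?t \<circ> ?x)) = ?x"
      using cyc3_funpow_3[of 1 2 "3::nat"] by (simp add: eval_nat_numeral fun_eq_iff)
    moreover have th: "(?t \<circ> h, s \<circ> h') \<in> P" using ts h(1) by (rule comp)
    moreover have "(?t \<circ> (?t \<circ> h), s \<circ> (s \<circ> h')) \<in> P" using ts th by (rule comp)
    ultimately obtain y where y: "(?x, y) \<in> P" using h(1) by (elim insertE emptyE) auto
    then have "(?x \<circ> ?x, y \<circ> y) \<in> P" by (intro comp)
    then have "y \<circ> y = id" using right_trivial by simp
    have "y \<noteq> id" using left_trivial y ne(1) by blast
    moreover have "cyc3 1 2 3 \<circ> cyc3 1 2 3 \<noteq> (id :: nat \<Rightarrow> nat)" "cyc3 1 3 2 \<circ> cyc3 1 3 2 \<noteq> (id :: nat \<Rightarrow> nat)"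
      by (auto simp: fun_eq_iff cyc3_apply intro!: exI[of _ 1])
    ultimately have "y \<in> {transpose 1 2, transpose 1 3, transpose 2 3}"
      using sym3_cases permutes[OF y] \<open>y \<circ> y = id\<close> by blast
    then obtain \<pi> where \<pi>: "\<pi> permutes {1..3}" "s = \<pi> \<circ> ?t \<circ> inv' \<pi>" "y = \<pi> \<circ> ?x \<circ> inv' \<pi>"
      using sym3_generators_conj[OF s] by metis
    define C where "C h = \<pi> \<circ> h \<circ> inv' \<pi>" for h
    have Ccomp: "C (a \<circ> b) = C a \<circ> C b" for a b
      unfolding C_def by (rule conj_comp[OF permutes_bij[OF \<pi>(1)]])
    have C1: "(id, C id) \<in> P" using one permutes_inv_o[OF \<pi>(1)] by (simp add: C_def)
    have Ct: "(?t, C ?t) \<in> P" and Cx: "(?x, C ?x) \<in> P" using ts y \<pi>(2,3) by (simp_all add: C_def)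
    have Cc: "(a \<circ> b, C (a \<circ> b)) \<in> P" if "(a, C a) \<in> P" "(b, C b) \<in> P" for a b
      unfolding Ccomp using that by (rule comp)
    have "(h, C h) \<in> P" if "h permutes {1..3}" for h
    proof -
      have "h \<in> {id, ?x, ?t \<circ> ?x, ?t \<circ> (?t \<circ> ?x), ?t, ?t \<circ> ?t}"
        using sym3_cases[OF that] unfolding t2 tx .
      then show ?thesis using C1 Ct Cx Cc by (elim insertE emptyE) auto
    qed
    then have "h' = C h" if "(h, h') \<in> P" for h h'
      using that permutes[OF that] right_unique by blast
    then show ?thesis using that \<pi>(1) unfolding C_def by blast
  qed
qed

section \<open>The Klein four-group and degree four\<close>

lemma V4_props:
  assumes "v \<in> V4"
  shows "v permutes {1..4}" "v (v x) = x" "v = id \<or> v 1 \<noteq> 1 \<and> v 2 \<noteq> 2 \<and> v 3 \<noteq> 3 \<and> v 4 \<noteq> 4"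
proof -
  show "v permutes {1..4}"
    using assms unfolding V4_def
    by (elim insertE emptyE; hypsubst) (auto intro!: permutes_compose permutes_swap_id permutes_id)
  show "v (v x) = x" "v = id \<or> v 1 \<noteq> 1 \<and> v 2 \<noteq> 2 \<and> v 3 \<noteq> 3 \<and> v 4 \<noteq> 4"
    using assms unfolding V4_def by (elim insertE emptyE; simp add: transpose_def)+
qed

text \<open>Being a fixed-point-free involution is invariant under conjugation, and in degree four
  this describes the nontrivial elements of V4.\<close>

lemma V4_conj:
  assumes v: "v \<in> V4" and p: "p permutes {1..4}"
  shows "p \<circ> v \<circ> inv' p \<in> V4"
proof (cases "v = id")
  case True
  then show ?thesis using permutes_inv_o(1)[OF p] by (simp add: V4_def)
next
  case False
  note V = V4_props[OF v]
  have pinv: "inv' p (p x) = x" "p (inv' p x) = x" for x using permutes_inverses[OF p] by auto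
  have fp: "v x \<noteq> x" if "x \<in> {1..4}" for x
  proof -
    from that have "x = 1 \<or> x = 2 \<or> x = 3 \<or> x = 4" by auto
    then show ?thesis using V(3) False by auto
  qed
  have nf: "(p \<circ> v \<circ> inv' p) c \<noteq> c" if c: "c \<in> {1..4}" for c
  proof
    assume "(p \<circ> v \<circ> inv' p) c = c"
    then have "inv' p (p (v (inv' p c))) = inv' p c" by simp
    then have "v (inv' p c) = inv' p c" by (simp only: pinv)
    then show False using fp c permutes_in_image[OF permutes_inv[OF p]] by blast
  qed
  show ?thesis
  proof (rule V4_if_fpf_involution)
    show "p \<circ> v \<circ> inv' p permutes {1..4}" using V(1) p by (intro permutes_compose permutes_inv)
    show "(p \<circ> v \<circ> inv' p) ((p \<circ> v \<circ> inv' p) a) = a" for a by (simp add: pinv V(2))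
    show "(p \<circ> v \<circ> inv' p) 1 \<noteq> 1" by (rule nf) simp
  qed (rule nf)
qed

lemma V4_transitive:
  assumes "i \<in> {1..4}" "j \<in> {1..4}"
  obtains v where "v \<in> V4" "v i = j"
proof -
  have "i = 1 \<or> i = 2 \<or> i = 3 \<or> i = 4" "j = 1 \<or> j = 2 \<or> j = 3 \<or> j = 4" using assms by auto
  then have "\<exists>v\<in>V4. v i = j" by (elim disjE; simp add: V4_def transpose_def)
  then show ?thesis using that by blast
qed

text \<open>Since \<open>Sym(4)\<close> is \<open>V\<^sub>4\<close> extended by the stabilizer of 4, the pairs fixing 4 in both
  coordinates reduce the claim to degree three.\<close>

lemma rigid4:
  assumes "perm_pairs 4 P" and L: "\<And>a. (a, id) \<in> P \<longleftrightarrow> a \<in> V4" and R: "\<And>b. (id, b) \<in> P \<longleftrightarrow> b \<in> V4"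
    and t: "cyc3 1 2 3 \<in> fst ` P"
  obtains \<pi> where "\<pi> permutes {1..4}" "\<And>h h'. (h, h') \<in> P \<Longrightarrow> (h, \<pi> \<circ> h \<circ> inv' \<pi>) \<in> P"
proof -
  interpret perm_pairs 4 P by fact
  define P0 where "P0 = {(a, b) \<in> P. a 4 = 4 \<and> b 4 = 4}"
  have V1: "v = id" if "v \<in> V4" "v 4 = 4" for v using V4_props(3)[OF that(1)] that(2) by auto
  have p3: "a permutes {1..3}" if "a permutes {1..4}" "a 4 = 4" for a :: "nat \<Rightarrow> nat"
  proof (rule permutes_superset[OF that(1)])
    fix x :: nat assume "x \<in> {1..4} - {1..3}"
    then have "x = 4" by auto
    then show "a x = x" using that(2) by simp
  qed
  have i4: "inv' a 4 = 4" if "a permutes {1..4}" "a 4 = 4" for a :: "nat \<Rightarrow> nat"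
    using that permutes_inverses(2)[OF that(1), of 4] by simp
  have P0: "faithful_pairs 3 P0"
  proof
    show "a permutes {1..3} \<and> b permutes {1..3}" if "(a, b) \<in> P0" for a b
      using that permutes p3 unfolding P0_def by blast
    show "(id, id) \<in> P0" using one by (simp add: P0_def)
    show "(a \<circ> c, b \<circ> d) \<in> P0" if "(a, b) \<in> P0" "(c, d) \<in> P0" for a b c d
      using that comp by (simp add: P0_def)
    show "(inv' a, inv' b) \<in> P0" if "(a, b) \<in> P0" for a b
      using that inv[of a b] i4[of a] i4[of b] permutes[of a b] by (simp add: P0_def del: One_nat_def)
    show "a = id" if "(a, id) \<in> P0" for a using that L V1 by (auto simp: P0_def)
    show "b = id" if "(id, b) \<in> P0" for b using that R V1 by (auto simp: P0_def)
  qed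
  \<comment> \<open>V4 is transitive, so each of its cosets contains an element fixing 4.\<close>
  have move: "\<exists>v\<in>V4. v (h 4) = 4" if "h permutes {1..4}" for h
  proof -
    have "h 4 \<in> {1..4}" "(4::nat) \<in> {1..4}" using permutes_in_image[OF that, of 4] by auto
    then show ?thesis using V4_transitive by metis
  qed
  obtain s where s: "(cyc3 1 2 3, s) \<in> P" using t by auto
  then obtain v where v: "v \<in> V4" "v (s 4) = 4" using move permutes by blast
  have "(id \<circ> cyc3 1 2 3, v \<circ> s) \<in> P" using R v(1) s by (intro comp) auto
  then have "(cyc3 1 2 3, v \<circ> s) \<in> P0" using v(2) by (simp add: P0_def cyc3_apply)
  then have "cyc3 1 2 3 \<in> fst ` P0" by force
  then obtain \<pi> where \<pi>: "\<pi> permutes {1..3}"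
    and conj: "\<And>h h'. (h, h') \<in> P0 \<Longrightarrow> h' = \<pi> \<circ> h \<circ> inv' \<pi>"
    using rigid3[OF P0] by blast
  have \<pi>4: "\<pi> permutes {1..4}" using permutes_subset[OF \<pi>] by auto
  have "(h, \<pi> \<circ> h \<circ> inv' \<pi>) \<in> P" if hh: "(h, h') \<in> P" for h h'
  proof -
    obtain v where v: "v \<in> V4" "v (h 4) = 4" using move permutes[OF hh] by blast
    obtain w where w: "w \<in> V4" "w (h' 4) = 4" using move permutes[OF hh] by blast
    have "(v \<circ> id, id \<circ> w) \<in> P" using L R v w by (intro comp) auto
    then have "(v \<circ> h, w \<circ> h') \<in> P" using hh comp by force
    then have "(v \<circ> h, w \<circ> h') \<in> P0" using v w by (simp add: P0_def)
    then have "w \<circ> h' = \<pi> \<circ> (v \<circ> h) \<circ> inv' \<pi>" by (rule conj)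
    also have "\<dots> = (\<pi> \<circ> v \<circ> inv' \<pi>) \<circ> (\<pi> \<circ> h \<circ> inv' \<pi>)"
      by (rule conj_comp[OF permutes_bij[OF \<pi>4]])
    finally have eq: "w \<circ> h' = (\<pi> \<circ> v \<circ> inv' \<pi>) \<circ> (\<pi> \<circ> h \<circ> inv' \<pi>)" .
    \<comment> \<open>The second coordinate is determined only modulo V4: \<open>h'\<close> and the
      conjugate of \<open>h\<close> differ by \<open>u\<close> and \<open>w\<close>, both in the
      right kernel, and \<open>u\<close> is its own inverse. Hence the claim is membership in
      \<open>P\<close> and not an equation for \<open>h'\<close>.\<close>
    define u where "u = \<pi> \<circ> v \<circ> inv' \<pi>"
    have u: "u \<in> V4" unfolding u_def using v(1) \<pi>4 by (rule V4_conj)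
    have "(id, u \<circ> w) \<in> P" using comp[of id u id w] R u w by simp
    from comp[OF this hh] have "(h, u \<circ> (w \<circ> h')) \<in> P" by (simp add: comp_assoc)
    also have "u \<circ> (w \<circ> h') = \<pi> \<circ> h \<circ> inv' \<pi>"
      unfolding eq using V4_props(2)[OF u] by (simp add: fun_eq_iff flip: u_def)
    finally show ?thesis .
  qed
  then show ?thesis using that \<pi>4 by blast
qed

section \<open>Invariant edge sets\<close>

lemma Sym_2_transitive:
  fixes n :: nat
  assumes "i \<in> {1..n}" "j \<in> {1..n}" "i \<noteq> j" "k \<in> {1..n}" "l \<in> {1..n}" "k \<noteq> l"
  obtains g where "g permutes {1..n}" "g i = k" "g j = l"
proof -
  obtain g where "g permutes {1..n}" "map g [i, j] = [k, l]"
    by (rule permutes_map_list[of "[i, j]" "[k, l]" "{1..n}"]) (use assms in simp_all)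
  then show ?thesis using that by simp
qed

lemma Sym_iff: "p \<in> Sym n \<longleftrightarrow> p permutes {1..n}"
  by (rule sym_group_carrier)

lemma odd_comp_inv:
  assumes "p permutes {1..n::nat}" "q permutes {1..n}" "\<not> evenperm p" "\<not> evenperm q"
  shows "p \<circ> inv' q \<in> Alt n"
  using assms
  by (simp add: Alt_iff permutes_compose permutes_inv evenperm_comp evenperm_inv
      permutes_permutation permutation_inverse del: One_nat_def)

text \<open>Any two odd permutations differ by an even one, so a single odd element of
  \<open>H\<close> brings in all of Sym(n).\<close>

lemma Alt_or_Sym:
  assumes sub: "Alt n \<subseteq> H" "\<And>h. h \<in> H \<Longrightarrow> h permutes {1..n}"
    and comp: "\<And>a b. a \<in> H \<Longrightarrow> b \<in> H \<Longrightarrow> a \<circ> b \<in> H"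
  shows "H = Alt n \<or> H = Sym n"
proof (cases "H \<subseteq> Alt n")
  case False
  then obtain x where x: "x \<in> H" "\<not> evenperm x" "x permutes {1..n}" using sub(2) Alt_iff by blast
  have "p \<in> H" if p: "p permutes {1..n}" for p
  proof (cases "evenperm p")
    case True then show ?thesis using sub(1) p Alt_iff by blast
  next
    case False
    then have "p \<circ> inv' x \<circ> x \<in> H" using odd_comp_inv[OF p x(3)] x sub(1) comp by blast
    then show ?thesis using permutes_inv_o(2)[OF x(3)] by (simp add: comp_assoc)
  qed
  then have "H = Sym n" using sub(2) Sym_iff by blast
  then show ?thesis ..
qed (use sub(1) in blast)

text \<open>Here \<open>(i, j) \<in> E\<close> encodes the edge joining \<open>v\<^sub>i\<close> and \<open>u\<^sub>j\<close>, and \<open>(a, b) \<in> Q\<close> the part-exchanging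
  automorphism \<open>v\<^sub>i \<mapsto> u\<^bsub>a i\<^esub>\<close>, \<open>u\<^sub>j \<mapsto> v\<^bsub>b j\<^esub>\<close>.\<close>

locale edge_pairs = perm_pairs n P for n P +
  fixes E :: "(nat \<times> nat) set" and Q :: "((nat \<Rightarrow> nat) \<times> (nat \<Rightarrow> nat)) set"
  assumes n_pos: "n \<ge> 1"
    and alt: "Alt n \<subseteq> fst ` P"
    and trans: "i \<in> {1..n} \<Longrightarrow> k \<in> {1..n} \<Longrightarrow> \<exists>h h'. (h, h') \<in> P \<and> h i = k"
    and E_sub: "E \<subseteq> {1..n} \<times> {1..n}"
    and E_inv: "(i, j) \<in> E \<Longrightarrow> (h, h') \<in> P \<Longrightarrow> (h i, h' j) \<in> E"
    and conn: "A \<subseteq> {1..n} \<Longrightarrow> B \<subseteq> {1..n} \<Longrightarrow> A \<noteq> {} \<or> B \<noteq> {} \<Longrightarrow>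
      (\<And>i j. (i, j) \<in> E \<Longrightarrow> i \<in> A \<longleftrightarrow> j \<in> B) \<Longrightarrow> A = {1..n} \<and> B = {1..n}"
    and Q_perm: "(a, b) \<in> Q \<Longrightarrow> a permutes {1..n} \<and> b permutes {1..n}"
    and Q_ne: "Q \<noteq> {}"
    and swap: "(a, b) \<in> Q \<Longrightarrow> (h, h') \<in> P \<Longrightarrow> (b \<circ> h' \<circ> inv' b, a \<circ> h \<circ> inv' a) \<in> P"
    and coset: "(a, b) \<in> Q \<Longrightarrow> (a', b') \<in> Q \<Longrightarrow> (inv' a' \<circ> a, inv' b' \<circ> b) \<in> P"
    and edge: "(i, j) \<in> E \<Longrightarrow> (k, l) \<in> E \<Longrightarrow>
      (\<exists>h h'. (h, h') \<in> P \<and> h i = k \<and> h' j = l) \<or> (\<exists>a b. (a, b) \<in> Q \<and> a i = l \<and> b j = k)"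
begin

definition H where "H = fst ` P"

lemma H_cases: "H = Alt n \<or> H = Sym n"
proof (rule Alt_or_Sym)
  show "Alt n \<subseteq> H" unfolding H_def by (rule alt)
  show "h permutes {1..n}" if "h \<in> H" for h using that permutes unfolding H_def by auto
  show "a \<circ> b \<in> H" if "a \<in> H" "b \<in> H" for a b
  proof -
    obtain a' b' where "(a, a') \<in> P" "(b, b') \<in> P" using \<open>a \<in> H\<close> \<open>b \<in> H\<close> unfolding H_def by auto
    then have "(a \<circ> b, a' \<circ> b') \<in> P" by (rule comp)
    then show ?thesis unfolding H_def by (rule image_eqI[rotated]) simp
  qed
qed

lemma E_nonempty: "E \<noteq> {}"
  using conn[of "{1}" "{}"] n_pos by auto

text \<open>\<open>P\<close> moves the first end of some edge anywhere, and the right kernel then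
  moves the second end while the first stays fixed.\<close>

lemma full_if_right_transitive:
  assumes "\<And>j l. j \<in> {1..n} \<Longrightarrow> l \<in> {1..n} \<Longrightarrow> \<exists>b. (id, b) \<in> P \<and> b j = l"
  shows "E = {1..n} \<times> {1..n}"
proof -
  obtain i j where ij: "(i, j) \<in> E" using E_nonempty by auto
  then have i: "i \<in> {1..n}" using E_sub by blast
  have "(k, l) \<in> E" if kl: "k \<in> {1..n}" "l \<in> {1..n}" for k l
  proof -
    obtain h h' where h: "(h, h') \<in> P" "h i = k" using trans[OF i kl(1)] by blast
    then have k: "(k, h' j) \<in> E" using E_inv[OF ij h(1)] by simp
    then have "h' j \<in> {1..n}" using E_sub by blast
    then obtain b where b: "(id, b) \<in> P" "b (h' j) = l" using assms kl(2) by blast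
    show ?thesis using E_inv[OF k b(1)] b(2) by simp
  qed
  then show ?thesis using E_sub by auto
qed

text \<open>For n = 2 the choices of sets in \<open>conn\<close> show that each parallel class of
  edges occurs and that no u-vertex is isolated. An element of \<open>P\<close> exchanging the two
  v-vertices then fills in the remaining edges, whether it fixes or exchanges the
  u-vertices.\<close>

lemma full_if_n_le_2:
  assumes "n \<le> 2"
  shows "E = {1..n} \<times> {1..n}"
proof -
  consider "n = 1" | "n = 2" using assms n_pos by linarith
  then show ?thesis
  proof cases
    case 1
    then have "E \<subseteq> {(1, 1)}" using E_sub by auto
    then show ?thesis using E_nonempty 1 by auto
  next
    case 2
    have set: "{1..n} = {1, 2}" unfolding 2 by auto
    note c = conn[unfolded set]
    have E: "E \<subseteq> {1, 2} \<times> {1, 2}" using E_sub unfolding set .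
    have "(1, 2) \<in> E \<or> (2, 1) \<in> E" using c[of "{1}" "{1}"] E by auto
    moreover have "(1, 1) \<in> E \<or> (2, 2) \<in> E" using c[of "{1}" "{2}"] E by auto
    moreover have "(1, 2) \<in> E \<or> (2, 2) \<in> E" using c[of "{1, 2}" "{1}"] E by auto
    moreover have "(1, 1) \<in> E \<or> (2, 1) \<in> E" using c[of "{1, 2}" "{2}"] E by auto
    moreover obtain h h' where h: "(h, h') \<in> P" "h 1 = 2" using trans[of 1 2] 2 by auto
    have p: "h permutes {1, 2}" "h' permutes {1, 2}" using permutes[OF h(1)] unfolding set by auto
    have "h = transpose 1 2" using p(1) h(2) unfolding permutes_doubleton_iff by auto
    then have h12: "h 1 = 2" "h 2 = 1" by auto
    have "h' = id \<or> h' = transpose 1 2" using p(2) unfolding permutes_doubleton_iff .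
    then have "h' 1 = 1 \<and> h' 2 = 2 \<or> h' 1 = 2 \<and> h' 2 = 1" by auto
    ultimately have "{1, 2} \<times> {1, 2} \<subseteq> E"
      using E_inv[OF _ h(1), of 1 1] E_inv[OF _ h(1), of 1 2] E_inv[OF _ h(1), of 2 1]
        E_inv[OF _ h(1), of 2 2] h12 by auto
    then show ?thesis using E unfolding set by blast
  qed
qed

end

section \<open>Computation in Sym(n) x Sym(n)\<close>

lemma sym_sym_simps:
  "(a, b) \<in> carrier (sym_sym n) \<longleftrightarrow> a permutes {1..n} \<and> b permutes {1..n}"
  "(a, b) \<otimes>\<^bsub>sym_sym n\<^esub> (c, d) = (a \<circ> c, b \<circ> d)"
  "\<one>\<^bsub>sym_sym n\<^esub> = (id, id)"
  by (auto simp: DirProd_def sym_group_def)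

lemma group_sym_sym: "group (sym_sym n)"
  by (intro DirProd_group sym_group_is_group)

lemma inv_sym_sym:
  assumes "a permutes {1..n}" "b permutes {1..n}"
  shows "inv\<^bsub>sym_sym n\<^esub> (a, b) = (inv' a, inv' b)"
  using assms inv_DirProd[OF sym_group_is_group sym_group_is_group, of a n b n]
  by (simp add: sym_group_carrier)

lemma (in perm_pairs) subgroup_sym_sym: "subgroup P (sym_sym n)"
proof
  show "P \<subseteq> carrier (sym_sym n)"
    by (rule subrelI) (simp only: sym_sym_simps permutes)
  show "x \<otimes>\<^bsub>sym_sym n\<^esub> y \<in> P" if "x \<in> P" "y \<in> P" for x y
    using that comp by (cases x, cases y) (simp only: sym_sym_simps)
  show "\<one>\<^bsub>sym_sym n\<^esub> \<in> P" by (simp only: sym_sym_simps one)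
  show "inv\<^bsub>sym_sym n\<^esub> x \<in> P" if "x \<in> P" for x
    using that inv permutes by (cases x) (simp only: inv_sym_sym)
qed

lemma (in perm_pairs) generate_subset: "S \<subseteq> P \<Longrightarrow> generate (sym_sym n) S \<subseteq> P"
  using group.generate_subgroup_incl[OF group_sym_sym] subgroup_sym_sym by blast

lemma generate_comp:
  assumes "(a, b) \<in> generate (sym_sym n) S" "(c, d) \<in> generate (sym_sym n) S"
  shows "(a \<circ> c, b \<circ> d) \<in> generate (sym_sym n) S"
  using generate.eng[OF assms] by (simp only: sym_sym_simps)

text \<open>If \<open>w\<close> moved \<open>i\<close>, some \<open>h\<close> in \<open>H\<close>
  would fix \<open>i\<close> and move \<open>w i\<close> to a third point, although w i = w (h i) =
  h (w i).\<close>

lemma centralizer_trivial: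
  fixes n :: nat
  assumes n: "n \<ge> 3" and w: "w permutes {1..n}"
    and two: "\<And>i j k l. {i, j, k, l} \<subseteq> {1..n} \<Longrightarrow> i \<noteq> j \<Longrightarrow> k \<noteq> l \<Longrightarrow> \<exists>h\<in>H. h i = k \<and> h j = l"
    and comm: "\<And>h. h \<in> H \<Longrightarrow> w \<circ> h = h \<circ> w"
  shows "w = id"
proof (rule permutes_eqI[OF w permutes_id])
  fix i assume i: "i \<in> {1..n}"
  show "w i = id i"
  proof (rule ccontr)
    assume "w i \<noteq> id i"
    then have k: "w i \<noteq> i" by simp
    have kn: "w i \<in> {1..n}" using permutes_in_image[OF w] i by blast
    have "card ({1..n} - {i, w i}) \<ge> 1" using n i kn k by (simp add: card_Diff_subset)
    then obtain l where l: "l \<in> {1..n}" "l \<noteq> i" "l \<noteq> w i"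
      by (metis DiffE card.empty equals0I insertCI not_one_le_zero)
    obtain h where h: "h \<in> H" "h i = i" "h (w i) = l" using two[of i "w i" i l] i kn l k by auto
    have "w (h i) = h (w i)" using comm[OF h(1)] by (simp add: fun_eq_iff)
    then show False using h l by simp
  qed
qed

lemma Alt3_cases: "h \<in> Alt 3 \<longleftrightarrow> h \<in> {id, cyc3 1 2 3, cyc3 1 3 2}"
proof
  assume "h \<in> Alt 3"
  then have h: "h permutes {1..3}" "evenperm h" by (simp_all only: Alt_iff)
  have "\<not> evenperm (transpose 1 (2::nat))" "\<not> evenperm (transpose 1 (3::nat))" "\<not> evenperm (transpose 2 (3::nat))"
    by (simp_all add: evenperm_swap)
  with sym3_cases[OF h(1)] h(2) show "h \<in> {id, cyc3 1 2 3, cyc3 1 3 2}"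
    by (elim insertE emptyE) simp_all
next
  assume "h \<in> {id, cyc3 1 2 3, cyc3 1 3 2}"
  then show "h \<in> Alt 3" using Alt_closed(1) by (elim insertE emptyE) (auto intro!: Alt_cyc3 simp del: id_apply)
qed

text \<open>The reason for the special treatment of Alt(3): it centralizes itself, so
  \<open>centralizer_trivial\<close> cannot hold for it.\<close>

lemma Alt3_commute: "g \<in> Alt 3 \<Longrightarrow> h \<in> Alt 3 \<Longrightarrow> g \<circ> h = h \<circ> g"
  unfolding Alt3_cases by (elim insertE emptyE; simp add: fun_eq_iff cyc3_apply)

lemma Alt3_fixpoint: "h \<in> Alt 3 \<Longrightarrow> h 1 = 1 \<Longrightarrow> h = id"
  unfolding Alt3_cases by (elim insertE emptyE) (simp_all add: cyc3_apply)

section \<open>Diagonal groups and the omitted matching\<close>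

context edge_pairs
begin

text \<open>A matching with at least two edges is disconnected: the edge at 1 already forms a
  component.\<close>

lemma not_matching:
  assumes n: "n \<ge> 2" and s: "s permutes {1..n}"
  shows "\<exists>i j. (i, j) \<in> E \<and> j \<noteq> s i"
proof (rule ccontr)
  assume *: "\<not> ?thesis"
  have "{1} = {1..n} \<and> {s 1} = {1..n}"
  proof (rule conn)
    show "i \<in> {1} \<longleftrightarrow> j \<in> {s 1}" if "(i, j) \<in> E" for i j
    proof -
      have "j = s i" using * that by blast
      then show ?thesis using permutes_eq_iff[OF s] by simp
    qed
  qed (use n permutes_in_image[OF s, of 1] in auto)
  then have "card {1..n} = 1" by (metis card.empty card.insert empty_iff finite.emptyI One_nat_def)
  then show False using n by simp
qed

text \<open>A part-exchanging element normalizes the diagonal group. Since the latter has trivial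
  centralizer, the exchange preserves the matching \<open>i \<mapsto> \<pi> i\<close>, so edge-transitivity separates the
  matching from its complement.\<close>

lemma diagonal_two_transitive:
  assumes n: "n \<ge> 3" and pi: "\<pi> permutes {1..n}"
    and diag: "\<And>h h'. (h, h') \<in> P \<Longrightarrow> h' = \<pi> \<circ> h \<circ> inv' \<pi>"
    and two: "\<And>i j k l. {i, j, k, l} \<subseteq> {1..n} \<Longrightarrow> i \<noteq> j \<Longrightarrow> k \<noteq> l \<Longrightarrow> \<exists>h\<in>H. h i = k \<and> h j = l"
  shows "E = {(i, j). i \<in> {1..n} \<and> j \<in> {1..n} \<and> j \<noteq> \<pi> i}"
proof -
  note pinv = permutes_inverses[OF pi]
  have HP: "(h, \<pi> \<circ> h \<circ> inv' \<pi>) \<in> P" if "h \<in> H" for h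
    using that diag unfolding H_def by auto
  obtain i0 j0 where ij0: "(i0, j0) \<in> E" "j0 \<noteq> \<pi> i0" using not_matching[OF _ pi] n by auto
  have r0: "i0 \<in> {1..n}" "j0 \<in> {1..n}" using ij0 E_sub by auto
  have off: "(k, l) \<in> E" if kl: "k \<in> {1..n}" "l \<in> {1..n}" "l \<noteq> \<pi> k" for k l
  proof -
    have "i0 \<noteq> inv' \<pi> j0" "k \<noteq> inv' \<pi> l" using ij0(2) kl(3) pinv by auto
    moreover have "inv' \<pi> j0 \<in> {1..n}" "inv' \<pi> l \<in> {1..n}"
      using r0 kl permutes_in_image[OF permutes_inv[OF pi]] by blast+
    ultimately obtain h where h: "h \<in> H" "h i0 = k" "h (inv' \<pi> j0) = inv' \<pi> l"
      using two[of i0 "inv' \<pi> j0" k "inv' \<pi> l"] r0 kl by auto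
    then show ?thesis using E_inv[OF ij0(1) HP[OF h(1)]] pinv by simp
  qed
  have on: "(i, \<pi> i) \<notin> E" for i
  proof
    assume i: "(i, \<pi> i) \<in> E"
    from edge[OF i ij0(1)] show False
    proof (elim disjE exE conjE)
      fix h h' assume h: "(h, h') \<in> P" "h i = i0" "h' (\<pi> i) = j0"
      have "h' (\<pi> i) = \<pi> (h i)" unfolding diag[OF h(1)] by (simp add: pinv)
      then show False using h ij0(2) by simp
    next
      fix a b assume ab: "(a, b) \<in> Q" "a i = j0" "b (\<pi> i) = i0"
      have p: "a permutes {1..n}" "b permutes {1..n}" using Q_perm[OF ab(1)] by auto
      note ainv = permutes_inverses[OF p(1)] and binv = permutes_inverses[OF p(2)]
      \<comment> \<open>The exchange given by \<open>a\<close>, \<open>b\<close> sends the matching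
        edge at i to the pair with labels b (\<pi> i) and a i. This is a matching edge iff a i =
        \<pi> (b (\<pi> i)), that is, iff \<open>w\<close> fixes i.\<close>
      define w where "w = inv' a \<circ> (\<pi> \<circ> (b \<circ> \<pi>))"
      have wp: "w permutes {1..n}" unfolding w_def using p pi by (intro permutes_compose permutes_inv)
      have "w = id"
      proof (rule centralizer_trivial[OF n wp two])
        fix h assume h: "h \<in> H"
        have "a \<circ> h \<circ> inv' a = \<pi> \<circ> (b \<circ> (\<pi> \<circ> h \<circ> inv' \<pi>) \<circ> inv' b) \<circ> inv' \<pi>"
          using swap[OF ab(1) HP[OF h]] by (rule diag)
        then have "a (h (inv' a x)) = \<pi> (b (\<pi> (h (inv' \<pi> (inv' b (inv' \<pi> x))))))" for x
          by (simp add: fun_eq_iff)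
        from this[of "\<pi> (b (\<pi> x))" for x]
        have "a (h (inv' a (\<pi> (b (\<pi> x))))) = \<pi> (b (\<pi> (h x)))" for x by (simp add: pinv binv)
        then have "h (inv' a (\<pi> (b (\<pi> x)))) = inv' a (\<pi> (b (\<pi> (h x))))" for x by (metis ainv(2))
        then show "w \<circ> h = h \<circ> w" by (simp add: w_def fun_eq_iff)
      qed
      then have "w i = i" by simp
      then have "a i = a (inv' a (\<pi> (b (\<pi> i))))" by (simp add: w_def)
      then have "a i = \<pi> (b (\<pi> i))" by (simp add: ainv)
      then show False using ab ij0(2) by simp
    qed
  qed
  show ?thesis using off on E_sub by auto
qed

text \<open>\<open>Alt(3)\<close> has three orbits on pairs, all of them matchings. Connectedness excludes one of them,
  edge-transitivity all three, and \<open>\<rho>\<close> is the matching that is left out.\<close>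

lemma diagonal_Alt3:
  assumes n: "n = 3" and H: "H = Alt 3" and pi: "\<pi> permutes {1..n}"
    and diag: "\<And>h h'. (h, h') \<in> P \<Longrightarrow> h' = \<pi> \<circ> h \<circ> inv' \<pi>"
  obtains \<rho> where "\<rho> permutes {1..n}" "\<And>h h'. (h, h') \<in> P \<Longrightarrow> h' = \<rho> \<circ> h \<circ> inv' \<rho>"
    "E = {(i, j). i \<in> {1..n} \<and> j \<in> {1..n} \<and> j \<noteq> \<rho> i}"
proof -
  note pinv = permutes_inverses[OF pi] and pinj = permutes_eq_iff[OF pi]
  have set: "{1..n} = {1, 2, 3}" unfolding n by auto
  have HP: "(h, \<pi> \<circ> h \<circ> inv' \<pi>) \<in> P" if "h \<in> Alt 3" for h
    using that diag unfolding H[symmetric] H_def by auto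
  have PH: "h \<in> Alt 3" if "(h, h') \<in> P" for h h'
    using that unfolding H[symmetric] H_def by (rule image_eqI[rotated]) simp
  \<comment> \<open>By invariance the edges at 1 determine \<open>E\<close>: each m in
    \<open>S\<close> contributes the matching of i with \<pi> (c i), where \<open>c\<close> is the
    element of Alt(3) taking 1 to m.\<close>
  define S where "S = {j \<in> {1..n}. (1, \<pi> j) \<in> E}"
  have mem: "(g 1, \<pi> j) \<in> E \<longleftrightarrow> inv' g j \<in> S" if g: "g \<in> Alt 3" and j: "j \<in> {1..n}" for g j
  proof -
    have gp: "g permutes {1..n}" using g unfolding Alt_iff n by blast
    note ginv = permutes_inverses[OF gp]
    have ig: "inv' g j \<in> {1..n}" using permutes_in_image[OF permutes_inv[OF gp]] j by blast
    have "(g 1, \<pi> j) \<in> E \<longleftrightarrow> (1, \<pi> (inv' g j)) \<in> E"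
    proof
      assume "(g 1, \<pi> j) \<in> E"
      from E_inv[OF this HP[OF Alt_closed(3)[OF g]]]
      show "(1, \<pi> (inv' g j)) \<in> E" by (simp add: ginv pinv)
    next
      assume "(1, \<pi> (inv' g j)) \<in> E"
      from E_inv[OF this HP[OF g]] show "(g 1, \<pi> j) \<in> E" by (simp add: ginv pinv)
    qed
    then show ?thesis using ig by (simp add: S_def)
  qed
  have shift: "\<exists>c. c \<in> Alt 3 \<and> c 1 = m" if "m \<in> {1..n}" for m
    using Alt_transitive[of 3 1 m] that unfolding n by auto
  have mem': "(i, \<pi> j) \<in> E \<longleftrightarrow> (\<exists>g. g \<in> Alt 3 \<and> g 1 = i \<and> inv' g j \<in> S)"
    if "i \<in> {1..n}" "j \<in> {1..n}" for i j
    using shift[OF that(1)] mem that(2) by blast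
  have eqc: "inv' g j = m \<longleftrightarrow> j = c (g 1)" if "g \<in> Alt 3" "c \<in> Alt 3" "c 1 = m" for g c j m
  proof -
    have gp: "g permutes {1..n}" using that(1) unfolding Alt_iff n by blast
    have "inv' g j = m \<longleftrightarrow> j = g m" using permutes_inverses[OF gp] by metis
    also have "g m = (g \<circ> c) 1" using that(3) by simp
    also have "\<dots> = c (g 1)" using Alt3_commute[OF that(1,2)] by simp
    finally show ?thesis .
  qed
  \<comment> \<open>With at most the one element m in \<open>S\<close>, all edges would lie in a
    single matching, contradicting connectedness.\<close>
  have ex: "\<exists>x\<in>S. x \<noteq> m" if m: "m \<in> {1..n}" for m
  proof (rule ccontr)
    assume *: "\<not> ?thesis"
    obtain c where c: "c \<in> Alt 3" "c 1 = m" using shift[OF m] by blast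
    then have cp: "c permutes {1..n}" unfolding Alt_iff n by blast
    obtain i j where ij: "(i, j) \<in> E" "j \<noteq> (\<pi> \<circ> c) i"
      using not_matching[OF _ permutes_compose[OF cp pi]] n by auto
    have r: "i \<in> {1..n}" "j \<in> {1..n}" using ij E_sub by auto
    then have "inv' \<pi> j \<in> {1..n}" using permutes_in_image[OF permutes_inv[OF pi]] by blast
    then obtain g where g: "g \<in> Alt 3" "g 1 = i" "inv' g (inv' \<pi> j) \<in> S"
      using mem'[OF r(1), of "inv' \<pi> j"] ij(1) pinv by auto
    then have "inv' g (inv' \<pi> j) = m" using * by blast
    then have "inv' \<pi> j = c i" using eqc[OF g(1) c] g(2) by simp
    then show False using ij(2) pinv(1)[of j] by simp
  qed
  have "S \<noteq> {1..n}"
  proof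
    assume S: "S = {1..n}"
    have E1: "(1, \<pi> j) \<in> E" if "j \<in> {1, 2, 3}" for j using S that unfolding S_def set by blast
    \<comment> \<open>Only the identity of Alt(3) fixes 1, so an edge at 1 can be carried to another
      with the same end 1 only by an exchange of the parts. Two such exchanges, for j = 2 and j = 3,
      differ by an element of \<open>P\<close> fixing \<pi> 1, hence trivial in its first
      coordinate, which contradicts their different values at 1.\<close>
    have q: "\<exists>a b. (a, b) \<in> Q \<and> a 1 = \<pi> j \<and> b (\<pi> 1) = 1" if j: "j \<in> {2, 3}" for j
    proof -
      have "(1, \<pi> 1) \<in> E" "(1, \<pi> j) \<in> E" using E1 j by auto
      from edge[OF this] show ?thesis
      proof
        assume "\<exists>h h'. (h, h') \<in> P \<and> h 1 = 1 \<and> h' (\<pi> 1) = \<pi> j"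
        then obtain h h' where h: "(h, h') \<in> P" "h 1 = 1" "h' (\<pi> 1) = \<pi> j" by blast
        have "h' (\<pi> 1) = \<pi> (h 1)" unfolding diag[OF h(1)] by (simp add: pinv)
        then have "\<pi> 1 = \<pi> j" using h by simp
        then show ?thesis using j pinj by auto
      qed
    qed
    obtain a b where ab: "(a, b) \<in> Q" "a 1 = \<pi> 2" "b (\<pi> 1) = 1" using q[of 2] by auto
    obtain c d where cd: "(c, d) \<in> Q" "c 1 = \<pi> 3" "d (\<pi> 1) = 1" using q[of 3] by auto
    have pp: "(inv' c \<circ> a, inv' d \<circ> b) \<in> P" using coset[OF ab(1) cd(1)] .
    have dp: "d permutes {1..n}" "c permutes {1..n}" using Q_perm[OF cd(1)] by auto
    have "(inv' d \<circ> b) (\<pi> 1) = \<pi> 1" using ab(3) cd(3) permutes_inverses(2)[OF dp(1), of "\<pi> 1"] by simp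
    moreover have "(inv' d \<circ> b) (\<pi> 1) = \<pi> ((inv' c \<circ> a) 1)" unfolding diag[OF pp] by (simp add: pinv)
    ultimately have "(inv' c \<circ> a) 1 = 1" using pinj by simp
    then have "inv' c \<circ> a = id" using Alt3_fixpoint PH[OF pp] by blast
    then have "a 1 = c 1" using permutes_inverses(1)[OF dp(2), of "a 1"] by (simp add: fun_eq_iff)
    then show False using ab cd pinj by simp
  qed
  then obtain m where m: "m \<in> {1..n}" "m \<notin> S" unfolding S_def by blast
  have Sm: "x \<in> S" if x: "x \<in> {1..n}" "x \<noteq> m" for x
  proof (rule ccontr)
    assume "x \<notin> S"
    have "card ({1, 2, 3} - {x, m}) = 1" using x m unfolding set by auto
    then obtain y where "{1..n} - {x, m} = {y}" unfolding set by (metis card_1_singletonE)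
    moreover have "S \<subseteq> {1..n} - {x, m}" using m(2) \<open>x \<notin> S\<close> unfolding S_def by blast
    ultimately have "y \<in> {1..n}" "S \<subseteq> {y}" by blast+
    then show False using ex by blast
  qed
  \<comment> \<open>Since Alt(3) is abelian, \<pi> \<circ> c conjugates it exactly as \<pi> does,
    while its matching is the one missing from \<open>E\<close>.\<close>
  obtain c where c: "c \<in> Alt 3" "c 1 = m" using shift[OF m(1)] by blast
  then have cp: "c permutes {1..n}" unfolding Alt_iff n by blast
  show ?thesis
  proof (rule that)
    show rp: "\<pi> \<circ> c permutes {1..n}" using cp pi by (rule permutes_compose)
    show "h' = \<pi> \<circ> c \<circ> h \<circ> inv' (\<pi> \<circ> c)" if h: "(h, h') \<in> P" for h h'
    proof -
      have "inv' (\<pi> \<circ> c) = inv' c \<circ> inv' \<pi>" using cp pi permutes_bij by (intro o_inv_distrib)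
      then have "\<pi> \<circ> c \<circ> h \<circ> inv' (\<pi> \<circ> c) = \<pi> \<circ> (c \<circ> h) \<circ> inv' c \<circ> inv' \<pi>" by (simp add: comp_assoc)
      also have "c \<circ> h = h \<circ> c" using Alt3_commute c(1) PH[OF h] by blast
      also have "\<pi> \<circ> (h \<circ> c) \<circ> inv' c \<circ> inv' \<pi> = \<pi> \<circ> h \<circ> (c \<circ> inv' c) \<circ> inv' \<pi>" by (simp add: comp_assoc)
      also have "\<dots> = h'" using diag[OF h] permutes_inv_o(1)[OF cp] by simp
      finally show ?thesis by (rule sym)
    qed
    show "E = {(i, j). i \<in> {1..n} \<and> j \<in> {1..n} \<and> j \<noteq> (\<pi> \<circ> c) i}"
    proof -
      have "(i, j) \<in> E \<longleftrightarrow> j \<noteq> (\<pi> \<circ> c) i" if ij: "i \<in> {1..n}" "j \<in> {1..n}" for i j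
      proof -
        obtain g where g: "g \<in> Alt 3" "g 1 = i" using shift[OF ij(1)] by blast
        then have gp: "g permutes {1..n}" unfolding Alt_iff n by blast
        have ip: "inv' \<pi> j \<in> {1..n}" using permutes_in_image[OF permutes_inv[OF pi]] ij(2) by blast
        then have ig: "inv' g (inv' \<pi> j) \<in> {1..n}" using permutes_in_image[OF permutes_inv[OF gp]] by blast
        have "(i, j) \<in> E \<longleftrightarrow> inv' g (inv' \<pi> j) \<in> S" using mem[OF g(1) ip] g(2) pinv by simp
        also have "\<dots> \<longleftrightarrow> inv' g (inv' \<pi> j) \<noteq> m" using Sm[OF ig] m(2) by blast
        also have "\<dots> \<longleftrightarrow> inv' \<pi> j \<noteq> c i" using eqc[OF g(1) c] g(2) by simp
        also have "\<dots> \<longleftrightarrow> j \<noteq> (\<pi> \<circ> c) i" using pinv by (metis o_apply)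
        finally show ?thesis .
      qed
      then show ?thesis using E_sub by auto
    qed
  qed
qed

end

section \<open>The classification for pairs of permutations\<close>

lemma AutoGroup_sym_groupD:
  assumes "\<phi> \<in> carrier (AutoGroup (sym_group n))"
  shows "bij_betw \<phi> (Sym n) (Sym n)" "\<phi> \<in> extensional (Sym n)"
    "\<And>a b. a \<in> Sym n \<Longrightarrow> b \<in> Sym n \<Longrightarrow> \<phi> (a \<circ> b) = \<phi> a \<circ> \<phi> b"
    "\<phi> id = id" "\<And>a. a \<in> Sym n \<Longrightarrow> \<phi> (inv' a) = inv' (\<phi> a)"
proof -
  have h: "\<phi> \<in> hom (sym_group n) (sym_group n)" and b: "\<phi> \<in> Bij (Sym n)"
    using assms by (simp_all add: AutoGroup_def auto_def)
  show bb: "bij_betw \<phi> (Sym n) (Sym n)" "\<phi> \<in> extensional (Sym n)"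
    using b by (simp_all add: Bij_def)
  interpret group_hom "sym_group n" "sym_group n" \<phi>
    using h sym_group_is_group by (simp add: group_hom_def group_hom_axioms_def)
  show "\<phi> (a \<circ> b) = \<phi> a \<circ> \<phi> b" if "a \<in> Sym n" "b \<in> Sym n" for a b
    using hom_mult[OF that] by (simp only: sym_group_mult)
  show "\<phi> id = id" using hom_one by (simp only: sym_group_one)
  show "\<phi> (inv' a) = inv' (\<phi> a)" if a: "a \<in> Sym n" for a
    using hom_inv[OF a] sym_group_inv_equality[OF a] sym_group_inv_equality[OF hom_closed[OF a]] by simp
qed

lemma Alt_conj_surj:
  assumes p: "p permutes {1..n}" and x: "x \<in> Alt n"
  shows "x \<in> (\<lambda>y. p \<circ> y \<circ> inv' p) ` Alt n"
proof
  have "inv' (inv' p) = p" using p permutes_bij inv_inv_eq by blast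
  then have "p \<circ> (inv' p \<circ> x \<circ> inv' (inv' p)) \<circ> inv' p = (p \<circ> inv' p) \<circ> x \<circ> (p \<circ> inv' p)"
    by (simp add: comp_assoc)
  also have "\<dots> = x" using permutes_inv_o(1)[OF p] by simp
  finally show "x = p \<circ> (inv' p \<circ> x \<circ> inv' (inv' p)) \<circ> inv' p" by simp
  show "inv' p \<circ> x \<circ> inv' (inv' p) \<in> Alt n" using x permutes_inv[OF p] by (rule Alt_conj)
qed

text \<open>If \<phi> sent all 3-cycles to 3-cycles, \<open>rigid\<close> would make it conjugation
  by some \<pi>, hence inner.\<close>

lemma exotic_outer_involution:
  assumes "outer_involution (sym_group 6) \<phi>"
  shows "exotic_pairs {(h, \<phi> h) |h. h \<in> Sym 6}" (is "exotic_pairs ?F")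
proof -
  have aut: "\<phi> \<in> carrier (AutoGroup (sym_group 6))" and outer: "\<phi> \<notin> inner_auts (sym_group 6)"
    using assms by (simp_all add: outer_involution_def)
  note phi = AutoGroup_sym_groupD[OF aut]
  have S: "\<phi> h \<in> Sym 6" if "h \<in> Sym 6" for h using phi(1) that bij_betwE by blast
  have SC: "a \<circ> b \<in> Sym 6" "inv' a \<in> Sym 6" if "a \<in> Sym 6" "b \<in> Sym 6" for a b
    using that by (simp_all add: Sym_iff permutes_compose permutes_inv del: One_nat_def)
  have S1: "id \<in> Sym 6" by (simp add: Sym_iff permutes_id)
  have F: "faithful_pairs 6 ?F"
  proof
    show "a permutes {1..6} \<and> b permutes {1..6}" if "(a, b) \<in> ?F" for a b
      using that S by (auto simp only: Sym_iff[symmetric])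
    show "(id, id) \<in> ?F" using S1 phi(4) by force
    show "(a \<circ> c, b \<circ> d) \<in> ?F" if "(a, b) \<in> ?F" "(c, d) \<in> ?F" for a b c d
    proof -
      have "a \<in> Sym 6" "b = \<phi> a" "c \<in> Sym 6" "d = \<phi> c" using that by auto
      then show ?thesis using phi(3)[of a c] SC(1)[of a c] by auto
    qed
    show "(inv' a, inv' b) \<in> ?F" if "(a, b) \<in> ?F" for a b
    proof -
      have "a \<in> Sym 6" "b = \<phi> a" using that by auto
      then show ?thesis using phi(5)[of a] SC(2)[of a a] by auto
    qed
    show "a = id" if "(a, id) \<in> ?F" for a
    proof -
      have "a \<in> Sym 6" "\<phi> a = \<phi> id" using that phi(4) by auto
      then show ?thesis using phi(1) S1 by (meson bij_betw_def inj_onD)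
    qed
    show "b = id" if "(id, b) \<in> ?F" for b using that phi(4) by auto
  qed
  have AS: "Alt 6 \<subseteq> Sym 6" by (auto simp: Alt_iff Sym_iff)
  have alt: "Alt 6 \<subseteq> fst ` ?F" "Alt 6 \<subseteq> snd ` ?F"
  proof -
    have "Sym 6 \<subseteq> fst ` ?F" by force
    then show "Alt 6 \<subseteq> fst ` ?F" using AS by blast
    have "\<phi> ` Sym 6 = Sym 6" using phi(1) by (simp add: bij_betw_def)
    moreover have "\<phi> ` Sym 6 \<subseteq> snd ` ?F" by force
    ultimately show "Alt 6 \<subseteq> snd ` ?F" using AS by simp
  qed
  have "\<exists>t\<in>cycles3 6. \<exists>s. (t, s) \<in> ?F \<and> s \<notin> cycles3 6"
  proof (rule ccontr)
    assume "\<not> ?thesis"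
    moreover have "cycles3 6 \<subseteq> Sym 6" using cycles3_Alt AS by blast
    ultimately have "\<exists>s\<in>cycles3 6. (t, s) \<in> ?F" if "t \<in> cycles3 6" for t using that by blast
    then obtain \<pi> where pi: "\<pi> permutes {1..6}" "\<And>h h'. (h, h') \<in> ?F \<Longrightarrow> h' = \<pi> \<circ> h \<circ> inv' \<pi>"
      using faithful_pairs.rigid[OF F] by auto
    have piS: "\<pi> \<in> Sym 6" using pi(1) by (simp only: Sym_iff)
    have "\<phi> = (\<lambda>h\<in>Sym 6. \<pi> \<otimes>\<^bsub>sym_group 6\<^esub> h \<otimes>\<^bsub>sym_group 6\<^esub> inv\<^bsub>sym_group 6\<^esub> \<pi>)"
    proof (rule extensionalityI[OF phi(2)])
      fix h assume h: "h \<in> Sym 6"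
      then have "(h, \<phi> h) \<in> ?F" by blast
      then have "\<phi> h = \<pi> \<circ> h \<circ> inv' \<pi>" by (rule pi(2))
      then show "\<phi> h = (\<lambda>h\<in>Sym 6. \<pi> \<otimes>\<^bsub>sym_group 6\<^esub> h \<otimes>\<^bsub>sym_group 6\<^esub> inv\<^bsub>sym_group 6\<^esub> \<pi>) h"
        using h sym_group_inv_equality[OF piS] by (simp only: restrict_apply' sym_group_mult)
    qed simp
    then show False using outer piS unfolding inner_auts_def by blast
  qed
  then show ?thesis
    using F alt by (intro exotic_pairs.intro exotic_pairs_axioms.intro)
qed

section \<open>Kernels and conjugates of the group of pairs\<close>

lemma (in perm_pairs) alt_invariant_left_kernel:
  assumes alt: "Alt n \<subseteq> fst ` P"
  shows "alt_invariant_group n {a. (a, id) \<in> P}"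
proof
  show "a permutes {1..n}" if "a \<in> {a. (a, id) \<in> P}" for a using that permutes by simp
  show "id \<in> {a. (a, id) \<in> P}" using one by simp
  show "a \<circ> b \<in> {a. (a, id) \<in> P}" if "a \<in> {a. (a, id) \<in> P}" "b \<in> {a. (a, id) \<in> P}" for a b
    using that comp[of a id b id] by simp
  show "inv' a \<in> {a. (a, id) \<in> P}" if "a \<in> {a. (a, id) \<in> P}" for a using that inv[of a id] by simp
  show "g \<circ> a \<circ> inv' g \<in> {a. (a, id) \<in> P}" if "a \<in> {a. (a, id) \<in> P}" "g \<in> Alt n" for a g
  proof -
    obtain g' where g: "(g, g') \<in> P" using subsetD[OF alt \<open>g \<in> Alt n\<close>] by auto
    then have "g' \<circ> id \<circ> inv' g' = id" using permutes[OF g] permutes_inv_o(1) by fastforce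
    then show ?thesis using conj[OF g, of a id] that by simp
  qed
qed

context edge_pairs
begin

text \<open>The conjugate of \<open>P\<close> by \<open>(id, inv' \<pi>)\<close>, which corresponds
  to relabelling the second part only.\<close>

definition conj_right :: "(nat \<Rightarrow> nat) \<Rightarrow> ((nat \<Rightarrow> nat) \<times> (nat \<Rightarrow> nat)) set" where
  "conj_right \<pi> = (\<lambda>(h, h'). (h, inv' \<pi> \<circ> h' \<circ> \<pi>)) ` P"

lemma conj_right_id: "conj_right id = P"
  by (auto simp: conj_right_def)

lemma conj_right_iff:
  assumes "\<pi> permutes {1..n}"
  shows "(h, x) \<in> conj_right \<pi> \<longleftrightarrow> (h, \<pi> \<circ> x \<circ> inv' \<pi>) \<in> P"
proof -
  note p = permutes_inv_o[OF assms]
  have 1: "inv' \<pi> \<circ> (\<pi> \<circ> x \<circ> inv' \<pi>) \<circ> \<pi> = x"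
    by (simp add: comp_assoc p(2)) (simp add: p(2) flip: comp_assoc)
  have 2: "\<pi> \<circ> (inv' \<pi> \<circ> h' \<circ> \<pi>) \<circ> inv' \<pi> = h'" for h'
    by (simp add: comp_assoc p(1)) (simp add: p(1) flip: comp_assoc)
  show ?thesis
  proof
    assume "(h, x) \<in> conj_right \<pi>"
    then obtain h' where "(h, h') \<in> P" "x = inv' \<pi> \<circ> h' \<circ> \<pi>" by (auto simp: conj_right_def)
    then show "(h, \<pi> \<circ> x \<circ> inv' \<pi>) \<in> P" using 2 by simp
  next
    assume "(h, \<pi> \<circ> x \<circ> inv' \<pi>) \<in> P"
    then have "(h, inv' \<pi> \<circ> (\<pi> \<circ> x \<circ> inv' \<pi>) \<circ> \<pi>) \<in> conj_right \<pi>"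
      unfolding conj_right_def by (rule image_eqI[rotated]) simp
    then show "(h, x) \<in> conj_right \<pi>" unfolding 1 .
  qed
qed

lemma perm_pairs_conj_right:
  assumes pi: "\<pi> permutes {1..n}"
  shows "perm_pairs n (conj_right \<pi>)"
proof
  note iff = conj_right_iff[OF pi] and b = permutes_bij[OF pi]
  show "a permutes {1..n} \<and> b permutes {1..n}" if "(a, b) \<in> conj_right \<pi>" for a b
  proof -
    obtain h' where h: "(a, h') \<in> P" "b = inv' \<pi> \<circ> h' \<circ> \<pi>" using \<open>(a, b) \<in> conj_right \<pi>\<close> by (auto simp: conj_right_def)
    then show ?thesis using permutes[OF h(1)] pi by (auto intro!: permutes_compose permutes_inv)
  qed
  show "(id, id) \<in> conj_right \<pi>" using one permutes_inv_o(1)[OF pi] by (simp add: iff)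
  show "(a \<circ> c, b \<circ> d) \<in> conj_right \<pi>" if "(a, b) \<in> conj_right \<pi>" "(c, d) \<in> conj_right \<pi>" for a b c d
    using that comp unfolding iff conj_comp[OF \<open>bij \<pi>\<close>] by blast
  show "(inv' a, inv' b) \<in> conj_right \<pi>" if ab: "(a, b) \<in> conj_right \<pi>" for a b
  proof -
    obtain h' where h: "(a, h') \<in> P" "b = inv' \<pi> \<circ> h' \<circ> \<pi>" using ab by (auto simp: conj_right_def)
    have bh: "bij h'" using permutes[OF h(1)] permutes_bij by blast
    have "inv' b = inv' \<pi> \<circ> inv' h' \<circ> \<pi>"
      unfolding h(2) using bh permutes_bij[OF pi]
      by (simp add: o_inv_distrib bij_comp bij_imp_bij_inv inv_inv_eq comp_assoc)
    then show ?thesis using inv[OF h(1)] unfolding conj_right_def by (auto intro: rev_image_eqI)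
  qed
qed

lemma conj_right_Diag:
  assumes pi: "\<pi> permutes {1..n}" and diag: "\<And>h h'. (h, h') \<in> P \<Longrightarrow> h' = \<pi> \<circ> f h \<circ> inv' \<pi>"
  shows "conj_right \<pi> = Diag_twisted f H"
proof -
  note p = permutes_inv_o[OF pi]
  have 1: "inv' \<pi> \<circ> (\<pi> \<circ> x \<circ> inv' \<pi>) \<circ> \<pi> = x" for x
    by (simp add: comp_assoc p(2)) (simp add: p(2) flip: comp_assoc)
  have "(\<lambda>(h, h'). (h, inv' \<pi> \<circ> h' \<circ> \<pi>)) p = (fst p, f (fst p))" if "p \<in> P" for p
    using that diag[of "fst p" "snd p"] 1 by (cases p) simp
  then have "conj_right \<pi> = (\<lambda>p. (fst p, f (fst p))) ` P"
    unfolding conj_right_def by (intro image_cong) simp_all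
  then show ?thesis by (auto simp: Diag_twisted_def H_def)
qed

lemma exists_Q: obtains a b where "(a, b) \<in> Q" "a permutes {1..n}" "b permutes {1..n}"
  using Q_ne Q_perm by (metis ex_in_conv surj_pair)

lemma alt_snd: "Alt n \<subseteq> snd ` P"
proof
  fix x assume x: "x \<in> Alt n"
  obtain a b where ab: "(a, b) \<in> Q" "a permutes {1..n}" "b permutes {1..n}" by (rule exists_Q)
  obtain y where y: "y \<in> Alt n" "x = a \<circ> y \<circ> inv' a" using Alt_conj_surj[OF ab(2) x] by blast
  obtain y' where "(y, y') \<in> P" using subsetD[OF alt y(1)] by auto
  from swap[OF ab(1) this] show "x \<in> snd ` P" unfolding y(2) by (rule image_eqI[rotated]) simp
qed

definition L where "L = {a. (a, id) \<in> P}"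
definition R where "R = {b. (id, b) \<in> P}"

lemma alt_invariant_L: "alt_invariant_group n L"
  unfolding L_def using alt by (rule alt_invariant_left_kernel)

lemma alt_invariant_R: "alt_invariant_group n R"
proof -
  have "Alt n \<subseteq> fst ` (P\<inverse>)" using alt_snd by force
  from perm_pairs.alt_invariant_left_kernel[OF converse this] show ?thesis by (simp add: R_def)
qed

lemma L_R_swap:
  assumes "(a, b) \<in> Q"
  shows "x \<in> L \<Longrightarrow> a \<circ> x \<circ> inv' a \<in> R" "x \<in> R \<Longrightarrow> b \<circ> x \<circ> inv' b \<in> L"
proof -
  have "a \<circ> inv' a = id" "b \<circ> inv' b = id" using Q_perm[OF assms] permutes_inv_o(1) by blast+
  then show "x \<in> L \<Longrightarrow> a \<circ> x \<circ> inv' a \<in> R" "x \<in> R \<Longrightarrow> b \<circ> x \<circ> inv' b \<in> L"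
    using swap[OF assms, of x id] swap[OF assms, of id x] by (simp_all add: L_def R_def)
qed

lemma Alt_swap:
  shows "Alt n \<subseteq> L \<longleftrightarrow> Alt n \<subseteq> R"
proof -
  obtain a b where ab: "(a, b) \<in> Q" "a permutes {1..n}" "b permutes {1..n}" by (rule exists_Q)
  show ?thesis using Alt_conj_surj[OF ab(2)] Alt_conj_surj[OF ab(3)] L_R_swap[OF ab(1)] by blast
qed

lemma trivial_swap: "L = {id} \<longleftrightarrow> R = {id}"
proof -
  obtain a b where ab: "(a, b) \<in> Q" "a permutes {1..n}" "b permutes {1..n}" by (rule exists_Q)
  have key: "x = id" if p: "p permutes {1..n}" and x: "p \<circ> x \<circ> inv' p = id" for p x :: "nat \<Rightarrow> nat"
  proof -
    have "inv' p \<circ> (p \<circ> x \<circ> inv' p) \<circ> p = (inv' p \<circ> p) \<circ> x \<circ> (inv' p \<circ> p)" by (simp add: comp_assoc)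
    then show ?thesis using x permutes_inv_o(2)[OF p] by simp
  qed
  have "id \<in> L" "id \<in> R" using one by (simp_all add: L_def R_def)
  then show ?thesis using key[OF ab(2)] key[OF ab(3)] L_R_swap[OF ab(1)] by blast
qed

lemma Alt_times_Alt_subset:
  assumes "Alt n \<subseteq> L" shows "Alt n \<times> Alt n \<subseteq> P"
proof (rule subrelI)
  fix x y assume "(x, y) \<in> Alt n \<times> Alt n"
  then have "(x, id) \<in> P" "(id, y) \<in> P" using assms Alt_swap unfolding L_def R_def by blast+
  from comp[OF this] show "(x, y) \<in> P" by simp
qed

text \<open>Once \<open>P\<close> contains Alt(n) x Alt(n), it is determined by the pairs of
  parities that occur. They form a subgroup of C2 x C2 invariant under exchanging the coordinates:
  trivial, diagonal, or everything.\<close>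

lemma product_cases:
  assumes A: "Alt n \<subseteq> L"
  shows "P = Alt n \<times> Alt n
    \<or> P = generate (sym_sym n) (Alt n \<times> Alt n \<union> {(transpose 1 2, transpose 1 2)})
    \<or> P = Sym n \<times> Sym n"
proof -
  note AA = Alt_times_Alt_subset[OF A]
  have PS: "P \<subseteq> Sym n \<times> Sym n" using permutes by (auto simp only: Sym_iff)
  have idA: "id \<in> Alt n" by (rule Alt_closed(1))
  consider (even) "P \<subseteq> Alt n \<times> Alt n"
    | (mixed) x y where "(x, y) \<in> P" "evenperm x \<noteq> evenperm y"
    | (odd) x y where "\<And>p q. (p, q) \<in> P \<Longrightarrow> evenperm p = evenperm q" "(x, y) \<in> P" "\<not> evenperm x" "\<not> evenperm y"
    using permutes Alt_iff by (metis SigmaI subrelI)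
  then show ?thesis
  proof cases
    case even
    then show ?thesis using AA by blast
  next
    case (mixed x y)
    obtain a b where ab: "(a, b) \<in> Q" "a permutes {1..n}" "b permutes {1..n}" by (rule exists_Q)
    have "(b \<circ> y \<circ> inv' b, a \<circ> x \<circ> inv' a) \<in> P" using swap[OF ab(1) mixed(1)] .
    moreover have "evenperm (p \<circ> z \<circ> inv' p) = evenperm z" if "p permutes {1..n}" "z permutes {1..n}" for p z
      using that by (simp add: evenperm_comp evenperm_inv permutes_permutation permutation_compose permutation_inverse del: One_nat_def) blast
    \<comment> \<open>The exchange of the parts supplies the opposite mixed parity, which rules out
      groups such as Alt(n) x Sym(n).\<close>
    ultimately have sw: "\<exists>x' y'. (x', y') \<in> P \<and> evenperm x' = evenperm y \<and> evenperm y' = evenperm x"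
      using ab permutes[OF mixed(1)] by blast
    have ex: "\<exists>x y. (x, y) \<in> P \<and> \<not> evenperm x \<and> evenperm y" "\<exists>x y. (x, y) \<in> P \<and> evenperm x \<and> \<not> evenperm y"
      using sw mixed by blast+
    obtain x1 y1 where 1: "(x1, y1) \<in> P" "\<not> evenperm x1" "evenperm y1" using ex(1) by blast
    obtain x2 y2 where 2: "(x2, y2) \<in> P" "evenperm x2" "\<not> evenperm y2" using ex(2) by blast
    have p: "x1 permutes {1..n}" "y1 permutes {1..n}" "x2 permutes {1..n}" "y2 permutes {1..n}"
      using permutes 1(1) 2(1) by blast+
    \<comment> \<open>The even coordinates cancel within Alt(n) x Alt(n), which leaves an odd
      element in each kernel.\<close>
    have "(id, inv' y1) \<in> P" "(inv' x2, id) \<in> P"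
      using AA idA p 1 2 Alt_closed(3) Alt_iff by blast+
    from comp[OF 1(1) this(1)] comp[OF 2(1) this(2)]
    have x1: "(x1, id) \<in> P" and y2: "(id, y2) \<in> P" using p permutes_inv_o(1) by (simp_all add: permutes_inv_o(1)[OF p(2)] permutes_inv_o(1)[OF p(3)])
    have "(q, id) \<in> P" if q: "q permutes {1..n}" for q
    proof (cases "evenperm q")
      case True then show ?thesis using AA idA q Alt_iff by blast
    next
      case False
      then have "(q \<circ> inv' x1, id) \<in> P" using odd_comp_inv[OF q p(1)] 1(2) AA idA by blast
      from comp[OF this x1] show ?thesis using permutes_inv_o(2)[OF p(1)] by (simp add: comp_assoc)
    qed
    moreover have "(id, q) \<in> P" if q: "q permutes {1..n}" for q
    proof (cases "evenperm q")
      case True then show ?thesis using AA idA q Alt_iff by blast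
    next
      case False
      then have "(id, q \<circ> inv' y2) \<in> P" using odd_comp_inv[OF q p(4)] 2(3) AA idA by blast
      from comp[OF this y2] show ?thesis using permutes_inv_o(2)[OF p(4)] by (simp add: comp_assoc)
    qed
    ultimately have "Sym n \<times> Sym n \<subseteq> P" using comp unfolding Sym_iff[abs_def] by (force simp: Sym_iff)
    then show ?thesis using PS by blast
  next
    case (odd x y)
    let ?t = "transpose 1 2 :: nat \<Rightarrow> nat"
    let ?G = "generate (sym_sym n) (Alt n \<times> Alt n \<union> {(?t, ?t)})"
    have xy: "x permutes {1..n}" "y permutes {1..n}" using permutes[OF odd(2)] by auto
    \<comment> \<open>An odd permutation exists, so there are two points for the transposition (1
      2).\<close>
    have "n \<ge> 2"
    proof (rule ccontr)
      assume "\<not> n \<ge> 2"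
      then have "{1..n} = {} \<or> {1..n} = {1}" by (cases n) auto
      then have "x = id" using xy(1) by auto
      then show False using odd(3) by simp
    qed
    then have tp: "?t permutes {1..n}" by (intro permutes_swap_id) auto
    have todd: "\<not> evenperm ?t" by (simp add: evenperm_swap)
    have tt: "?t \<circ> ?t = id" by simp
    have it: "inv' ?t = ?t" by simp
    have "(?t \<circ> inv' x, ?t \<circ> inv' y) \<in> P" using AA odd_comp_inv[OF tp] xy odd(3,4) todd by blast
    from comp[OF this odd(2)] have "(?t, ?t) \<in> P"
      using permutes_inv_o(2)[OF xy(1)] permutes_inv_o(2)[OF xy(2)] by (simp add: comp_assoc)
    then have sub: "?G \<subseteq> P" using AA by (intro generate_subset) blast
    have "P \<subseteq> ?G"
    proof (rule subrelI)
      fix p q assume pq: "(p, q) \<in> P"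
      have perm: "p permutes {1..n}" "q permutes {1..n}" using permutes[OF pq] by auto
      show "(p, q) \<in> ?G"
      proof (cases "evenperm p")
        case True
        then have "(p, q) \<in> Alt n \<times> Alt n" using odd(1)[OF pq] perm Alt_iff by blast
        then show ?thesis by (intro generate.incl) blast
      next
        case False
        then have "(p \<circ> inv' ?t, q \<circ> inv' ?t) \<in> Alt n \<times> Alt n"
          using odd(1)[OF pq] perm tp todd odd_comp_inv by blast
        then have "(p \<circ> inv' ?t, q \<circ> inv' ?t) \<in> ?G" by (intro generate.incl) blast
        moreover have "(?t, ?t) \<in> ?G" by (intro generate.incl) blast
        ultimately have "(p \<circ> inv' ?t \<circ> ?t, q \<circ> inv' ?t \<circ> ?t) \<in> ?G" by (rule generate_comp)
        then show ?thesis unfolding it by (simp only: comp_assoc tt comp_id)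
      qed
    qed
    then show ?thesis using sub by blast
  qed
qed

theorem classification:
  assumes phi: "n = 6 \<Longrightarrow> outer_involution (sym_group 6) \<phi>"
  obtains (complete) \<pi> where "\<pi> permutes {1..n}" "E = {1..n} \<times> {1..n}"
    "conj_right \<pi> = Alt n \<times> Alt n
      \<or> conj_right \<pi> = generate (sym_sym n) (Alt n \<times> Alt n \<union> {(transpose 1 2, transpose 1 2)})
      \<or> conj_right \<pi> = Sym n \<times> Sym n
      \<or> n = 6 \<and> (\<exists>H\<in>{Alt 6, Sym 6}. conj_right \<pi> = Diag_twisted \<phi> H)
      \<or> n = 4 \<and> (\<exists>H\<in>{Alt 4, Sym 4}. conj_right \<pi> = generate (sym_sym n) (V4 \<times> V4 \<union> Diag H))"
  | (matching) \<pi> where "\<pi> permutes {1..n}" "E = {(i, j). i \<in> {1..n} \<and> j \<in> {1..n} \<and> j \<noteq> \<pi> i}"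
    "conj_right \<pi> = Diag (Sym n) \<or> conj_right \<pi> = Diag (Alt n)"
proof -
  interpret L: alt_invariant_group n L by (rule alt_invariant_L)
  interpret R: alt_invariant_group n R by (rule alt_invariant_R)
  have idA: "id \<in> Alt n" by (rule Alt_closed(1))
  consider (product) "Alt n \<subseteq> L" | (faithful) "n \<ge> 3" "L = {id}" "R = {id}"
    | (klein) "n = 4" "L = V4" "R = V4"
  proof (cases "n \<ge> 3")
    case True
    \<comment> \<open>This lets \<open>trivial_swap\<close> exclude that one kernel is V4 and the
      other trivial.\<close>
    have "V4 \<noteq> {id}"
    proof -
      have "transpose 1 2 \<circ> transpose 3 4 \<in> V4" by (simp add: V4_def)
      moreover have "(transpose 1 2 \<circ> transpose 3 4) 1 \<noteq> id (1::nat)" by (simp add: transpose_def)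
      ultimately show ?thesis by (metis singletonD)
    qed
    then show ?thesis
      using that L.normal_trichotomy[OF True] R.normal_trichotomy[OF True] Alt_swap trivial_swap True by blast
  next
    case False
    \<comment> \<open>Below degree three Alt(n) is trivial, so these degrees belong to the product
      case.\<close>
    have "Alt n \<subseteq> {id}"
    proof
      fix x assume "x \<in> Alt n"
      then have x: "x permutes {1..n}" "evenperm x" by (simp_all only: Alt_iff)
      have "n = 1 \<or> n = 2" using False n_pos by linarith
      then have "{1..n} = {1} \<or> {1..n} = {1, 2}" by auto
      then have "x permutes {1, 1} \<or> x permutes {1, 2}" using x(1) by auto
      then have "x = id \<or> x = transpose 1 2" unfolding permutes_doubleton_iff by auto
      then show "x \<in> {id}" using x(2) by (auto simp: evenperm_swap)
    qed
    then have "Alt n \<subseteq> L" using L.id by blast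
    then show ?thesis by (rule that(1))
  qed
  then show ?thesis
  proof cases
    case product
    have "E = {1..n} \<times> {1..n}"
    proof (cases "n \<le> 2")
      case True then show ?thesis by (rule full_if_n_le_2)
    next
      case False
      show ?thesis
      proof (rule full_if_right_transitive)
        fix j l assume jl: "j \<in> {1..n}" "l \<in> {1..n}"
        obtain g where "g \<in> Alt n" "g j = l" using Alt_transitive[OF _ jl] False by auto
        then show "\<exists>b. (id, b) \<in> P \<and> b j = l"
          using Alt_times_Alt_subset[OF product] idA by blast
      qed
    qed
    then show ?thesis using product_cases[OF product] by (intro complete[of id]) (auto simp: conj_right_id permutes_id)
  next
    case klein
    have full: "E = {1..n} \<times> {1..n}"
    proof (rule full_if_right_transitive)
      fix j l assume "j \<in> {1..n}" "l \<in> {1..n}"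
      then obtain v where "v \<in> V4" "v j = l" using V4_transitive klein(1) by metis
      then show "\<exists>b. (id, b) \<in> P \<and> b j = l" using klein(3) by (auto simp: R_def)
    qed
    have P4: "perm_pairs 4 P" using perm_pairs_axioms klein(1) by simp
    have "cyc3 1 2 3 \<in> fst ` P" using alt Alt_cyc3[of 1 2 3 n] klein(1) by auto
    then obtain \<pi> where pi: "\<pi> permutes {1..4}" and diag: "\<And>h h'. (h, h') \<in> P \<Longrightarrow> (h, \<pi> \<circ> h \<circ> inv' \<pi>) \<in> P"
      using rigid4[OF P4] klein(2,3) unfolding L_def R_def by blast
    have pin: "\<pi> permutes {1..n}" using pi klein(1) by simp
    interpret C: perm_pairs n "conj_right \<pi>" by (rule perm_pairs_conj_right[OF pin])
    let ?G = "generate (sym_sym n) (V4 \<times> V4 \<union> Diag H)"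
    have V: "(v, id) \<in> conj_right \<pi>" "(id, v) \<in> conj_right \<pi>" if "v \<in> V4" for v
    proof -
      have "(v, id) \<in> P" "(id, \<pi> \<circ> v \<circ> inv' \<pi>) \<in> P"
        using that klein(2,3) V4_conj[OF that pi] unfolding L_def R_def by blast+
      then show "(v, id) \<in> conj_right \<pi>" "(id, v) \<in> conj_right \<pi>"
        using permutes_inv_o(1)[OF pi] by (simp_all add: conj_right_iff[OF pin])
    qed
    have D: "(h, h) \<in> conj_right \<pi>" if "h \<in> H" for h
      using that diag unfolding H_def by (auto simp: conj_right_iff[OF pin])
    have "V4 \<times> V4 \<union> Diag H \<subseteq> conj_right \<pi>"
    proof (rule Un_least; rule subrelI)
      fix x y assume "(x, y) \<in> V4 \<times> V4"
      then show "(x, y) \<in> conj_right \<pi>" using C.comp[OF V(1) V(2), of x y] by simp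
    next
      fix x y assume "(x, y) \<in> Diag H"
      then show "(x, y) \<in> conj_right \<pi>" using D by (auto simp: Diag_twisted_def)
    qed
    then have "?G \<subseteq> conj_right \<pi>" by (rule C.generate_subset)
    moreover have "conj_right \<pi> \<subseteq> ?G"
    proof (rule subrelI)
      fix h x assume hx: "(h, x) \<in> conj_right \<pi>"
      then have hH: "h \<in> H" unfolding conj_right_def H_def by force
      have ph: "h permutes {1..n}" "x permutes {1..n}" using C.permutes[OF hx] by auto
      \<comment> \<open>Cancelling the diagonal pair of \<open>h\<close> leaves an element of the
        right kernel, which is V4 because V4 is normal.\<close>
      have "(inv' h \<circ> h, inv' h \<circ> x) \<in> conj_right \<pi>" using C.comp[OF C.inv[OF D[OF hH]] hx] .
      then have "(id, inv' h \<circ> x) \<in> conj_right \<pi>" using permutes_inv_o(2)[OF ph(1)] by simp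
      then have "\<pi> \<circ> (inv' h \<circ> x) \<circ> inv' \<pi> \<in> V4"
        using klein(3) permutes_inv_o(1)[OF pi] by (simp add: conj_right_iff[OF pin] R_def set_eq_iff)
      then have "inv' \<pi> \<circ> (\<pi> \<circ> (inv' h \<circ> x) \<circ> inv' \<pi>) \<circ> inv' (inv' \<pi>) \<in> V4"
        using permutes_inv[OF pi] by (rule V4_conj)
      moreover have "inv' (inv' \<pi>) = \<pi>" using pi permutes_bij inv_inv_eq by blast
      moreover have "inv' \<pi> \<circ> (\<pi> \<circ> y \<circ> inv' \<pi>) \<circ> \<pi> = y" for y
        using permutes_inverses[OF pi] by (simp add: fun_eq_iff)
      ultimately have v: "inv' h \<circ> x \<in> V4" by simp
      have "id \<in> V4" by (simp add: V4_def)
      then have "(id, inv' h \<circ> x) \<in> ?G" using v by (intro generate.incl) blast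
      moreover have "(h, h) \<in> ?G" using hH by (intro generate.incl) (auto simp: Diag_twisted_def)
      ultimately have "(h \<circ> id, h \<circ> (inv' h \<circ> x)) \<in> ?G" by (intro generate_comp)
      then show "(h, x) \<in> ?G" using permutes_inv_o(1)[OF ph(1)] by (simp flip: comp_assoc)
    qed
    ultimately have "conj_right \<pi> = ?G" by blast
    moreover have "H \<in> {Alt 4, Sym 4}" using H_cases klein(1) by simp
    ultimately have "\<exists>H\<in>{Alt 4, Sym 4}. conj_right \<pi> = generate (sym_sym n) (V4 \<times> V4 \<union> Diag H)"
      by (intro bexI)
    with klein(1) show ?thesis by (intro complete[OF pin full] disjI2 conjI)
  next
    case faithful
    interpret faithful_pairs n P
      using faithful(2,3) unfolding L_def R_def by unfold_locales blast+
    have case_diag: thesis if pi: "\<pi> permutes {1..n}" and diag: "\<And>h h'. (h, h') \<in> P \<Longrightarrow> h' = \<pi> \<circ> h \<circ> inv' \<pi>" for \<pi>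
    \<comment> \<open>Among the possible \<open>H\<close> only Alt(3) fails to be 2-transitive;
      there \<pi> is replaced by the \<open>\<rho>\<close> read off from the graph.\<close>
    proof (cases "n = 3 \<and> H = Alt 3")
      case True
      then obtain \<rho> where \<rho>: "\<rho> permutes {1..n}" "\<And>h h'. (h, h') \<in> P \<Longrightarrow> h' = \<rho> \<circ> h \<circ> inv' \<rho>"
        "E = {(i, j). i \<in> {1..n} \<and> j \<in> {1..n} \<and> j \<noteq> \<rho> i}"
        using diagonal_Alt3[OF _ _ pi diag] by blast
      have "conj_right \<rho> = Diag H" using \<rho>(2) by (intro conj_right_Diag[OF \<rho>(1)]) simp
      then show ?thesis using H_cases by (intro matching[OF \<rho>(1,3)]) auto
    next
      case False
      have "E = {(i, j). i \<in> {1..n} \<and> j \<in> {1..n} \<and> j \<noteq> \<pi> i}"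
      proof (rule diagonal_two_transitive[OF faithful(1) pi diag])
        fix i j k l assume r: "{i, j, k, l} \<subseteq> {1..n}" "i \<noteq> j" "k \<noteq> l"
        show "\<exists>h\<in>H. h i = k \<and> h j = l"
        proof (cases "H = Sym n")
          case True
          obtain g where "g permutes {1..n}" "g i = k" "g j = l"
            using Sym_2_transitive[of i n j k l] r by auto
          then show ?thesis using True Sym_iff by blast
        next
          case False
          then have "H = Alt n" "n \<ge> 4" using H_cases \<open>\<not> (n = 3 \<and> H = Alt 3)\<close> faithful(1) by auto
          moreover obtain g where "g \<in> Alt n" "g i = k" "g j = l"
            using Alt_2_transitive[of n i j k l] r \<open>n \<ge> 4\<close> by auto
          ultimately show ?thesis by blast
        qed
      qed
      moreover have "conj_right \<pi> = Diag H" using diag by (intro conj_right_Diag[OF pi]) simp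
      ultimately show ?thesis using H_cases by (intro matching[OF pi]) auto
    qed
    show ?thesis
    proof (cases "n = 3")
      case True
      have f3: "faithful_pairs 3 P" using faithful_pairs_axioms True by simp
      have "cyc3 1 2 3 \<in> fst ` P" using alt Alt_cyc3[of 1 2 3 n] True by auto
      then show ?thesis using rigid3[OF f3] case_diag True by metis
    next
      case False
      then have n4: "n \<ge> 4" using faithful(1) by simp
      have ex: "\<exists>s. (t, s) \<in> P" if "t \<in> cycles3 n" for t using subsetD[OF alt cycles3_Alt[OF that]] by auto
      show ?thesis
      proof (cases "\<forall>t\<in>cycles3 n. \<exists>s\<in>cycles3 n. (t, s) \<in> P")
        case True
        then show ?thesis using rigid[OF n4] case_diag by metis
      next
        case False
        then obtain t s where ts: "t \<in> cycles3 n" "(t, s) \<in> P" "s \<notin> cycles3 n" using ex by metis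
        then have n6: "n = 6" using cycles3_image(1)[OF alt_snd] by blast
        have ep: "exotic_pairs P"
          using faithful_pairs_axioms alt alt_snd ts n6
          by (intro exotic_pairs.intro exotic_pairs_axioms.intro) auto
        interpret X: exotic_pairs P by (rule ep)
        have full: "E = {1..n} \<times> {1..n}"
          using X.invariant_relation_full E_sub E_nonempty E_inv n6 by blast
        \<comment> \<open>The comparison is made at the first coordinates occurring in
          \<open>P\<close>, so the graph of \<phi> on all of Sym(6) also serves when
          \<open>H\<close> is Alt(6).\<close>
        obtain \<pi> where pi: "\<pi> permutes {1..6}"
          and eq: "\<And>h h' q. (h, h') \<in> P \<Longrightarrow> (h, q) \<in> {(h, \<phi> h) |h. h \<in> Sym 6} \<Longrightarrow> h' = \<pi> \<circ> q \<circ> inv' \<pi>"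
          using exotic_unique[OF ep exotic_outer_involution[OF phi[OF n6]]] by blast
        have pin: "\<pi> permutes {1..n}" using pi n6 by simp
        have "conj_right \<pi> = Diag_twisted \<phi> H"
        proof (rule conj_right_Diag[OF pin])
          fix h h' assume h: "(h, h') \<in> P"
          then have "h \<in> Sym 6" using permutes n6 Sym_iff by blast
          then show "h' = \<pi> \<circ> \<phi> h \<circ> inv' \<pi>" using eq[OF h] by blast
        qed
        moreover have "H \<in> {Alt 6, Sym 6}" using H_cases n6 by simp
        ultimately have "\<exists>H\<in>{Alt 6, Sym 6}. conj_right \<pi> = Diag_twisted \<phi> H" by (intro bexI)
        with n6 have "n = 6 \<and> (\<exists>H\<in>{Alt 6, Sym 6}. conj_right \<pi> = Diag_twisted \<phi> H)" ..
        then show ?thesis by (intro complete[OF pin full]) (simp only: simp_thms)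
      qed
    qed
  qed
qed

end

section \<open>Groups acting on a labelled bipartite graph\<close>

text \<open>\<open>induced_perm\<close> with separate labellings of source and target.
  Part-preserving and part-exchanging elements then obey one composition law,
  \<open>transfer_perm_comp\<close>.\<close>

definition transfer_perm :: "nat \<Rightarrow> (nat \<Rightarrow> 'a) \<Rightarrow> (nat \<Rightarrow> 'a) \<Rightarrow> ('a \<Rightarrow> 'a) \<Rightarrow> nat \<Rightarrow> nat" where
  "transfer_perm n v w g = (\<lambda>i. if i \<in> {1..n} then inv_into {1..n} w (g (v i)) else i)"

lemma induced_perm_eq_transfer: "induced_perm n v g = transfer_perm n v v g"
  by (simp add: induced_perm_def transfer_perm_def)

lemma transfer_perm:
  assumes v: "bij_betw v {1..n} A" and w: "bij_betw w {1..n} B" and g: "bij_betw g A B"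
  shows "transfer_perm n v w g permutes {1..n}"
    "i \<in> {1..n} \<Longrightarrow> w (transfer_perm n v w g i) = g (v i)"
proof -
  have "bij_betw (inv_into {1..n} w \<circ> (g \<circ> v)) {1..n} {1..n}"
    by (rule bij_betw_trans[OF bij_betw_trans[OF v g] bij_betw_inv_into[OF w]])
  then have "bij_betw (transfer_perm n v w g) {1..n} {1..n}"
    by (rule bij_betw_cong[THEN iffD1, rotated]) (simp add: transfer_perm_def)
  then show "transfer_perm n v w g permutes {1..n}"
    by (rule bij_imp_permutes) (simp add: transfer_perm_def del: atLeastAtMost_iff)
  assume i: "i \<in> {1..n}"
  then have "g (v i) \<in> B" using bij_betwE[OF v] bij_betwE[OF g] by blast
  then show "w (transfer_perm n v w g i) = g (v i)"
    using i bij_betw_inv_into_right[OF w] by (simp add: transfer_perm_def)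
qed

lemma transfer_perm_eqI:
  assumes "bij_betw v {1..n} A" "bij_betw w {1..n} B" "bij_betw g A B"
    and f: "f permutes {1..n}" "\<And>i. i \<in> {1..n} \<Longrightarrow> w (f i) = g (v i)"
  shows "transfer_perm n v w g = f"
proof (rule permutes_eqI[OF transfer_perm(1)[OF assms(1-3)] f(1)])
  fix i assume i: "i \<in> {1..n}"
  have "w (transfer_perm n v w g i) = w (f i)" using transfer_perm(2)[OF assms(1-3) i] f(2)[OF i] by simp
  moreover have "transfer_perm n v w g i \<in> {1..n}" "f i \<in> {1..n}"
    using i permutes_in_image f(1) transfer_perm(1)[OF assms(1-3)] by metis+
  ultimately show "transfer_perm n v w g i = f i"
    using assms(2) by (meson bij_betw_def inj_onD)
qed

lemma transfer_perm_comp: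
  assumes "bij_betw v {1..n} A" "bij_betw w {1..n} B" "bij_betw x {1..n} C"
    and "bij_betw g A B" "bij_betw h B C"
  shows "transfer_perm n v x (h \<circ> g) = transfer_perm n w x h \<circ> transfer_perm n v w g"
proof (rule transfer_perm_eqI[OF assms(1,3) bij_betw_trans[OF assms(4,5)]])
  note 1 = transfer_perm[OF assms(1,2,4)] and 2 = transfer_perm[OF assms(2,3,5)]
  show "transfer_perm n w x h \<circ> transfer_perm n v w g permutes {1..n}" using 1(1) 2(1) by (rule permutes_compose)
  fix i assume i: "i \<in> {1..n}"
  then have "transfer_perm n v w g i \<in> {1..n}" using permutes_in_image[OF 1(1)] by blast
  then show "x ((transfer_perm n w x h \<circ> transfer_perm n v w g) i) = (h \<circ> g) (v i)"
    using 1(2)[OF i] 2(2) by simp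
qed

lemma transfer_perm_id:
  assumes "bij_betw v {1..n} A" shows "transfer_perm n v v id = id"
  by (rule transfer_perm_eqI[OF assms assms]) (simp_all add: permutes_id)

lemma transfer_perm_inv:
  assumes v: "bij_betw v {1..n} A" and w: "bij_betw w {1..n} B" and g: "g permutes V" "bij_betw g A B"
  shows "bij_betw (inv' g) B A" "transfer_perm n w v (inv' g) = inv' (transfer_perm n v w g)"
proof -
  have inj: "inv' g (g x) = x" "g (inv' g x) = x" for x using permutes_inverses[OF g(1)] by auto
  show b: "bij_betw (inv' g) B A"
  proof (rule bij_betwI[of _ _ _ g])
    show "g \<in> A \<rightarrow> B" using bij_betwE[OF g(2)] by blast
    show "inv' g \<in> B \<rightarrow> A"
    proof
      fix y assume "y \<in> B"
      then obtain x where "x \<in> A" "y = g x" using bij_betw_imp_surj_on[OF g(2)] by blast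
      then show "inv' g y \<in> A" using inj by simp
    qed
  qed (simp_all add: inj)
  have "transfer_perm n v v (inv' g \<circ> g) = transfer_perm n w v (inv' g) \<circ> transfer_perm n v w g"
    by (rule transfer_perm_comp[OF v w v g(2) b])
  moreover have "inv' g \<circ> g = id" by (simp add: fun_eq_iff inj)
  ultimately have 1: "transfer_perm n w v (inv' g) \<circ> transfer_perm n v w g = id"
    using transfer_perm_id[OF v] by simp
  have p: "transfer_perm n v w g permutes {1..n}" by (rule transfer_perm(1)[OF v w g(2)])
  have "transfer_perm n w v (inv' g) \<circ> (transfer_perm n v w g \<circ> inv' (transfer_perm n v w g)) = inv' (transfer_perm n v w g)"
    using 1 by (simp flip: comp_assoc)
  then show "transfer_perm n w v (inv' g) = inv' (transfer_perm n v w g)"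
    using permutes_inv_o(1)[OF p] by simp
qed

locale bipartite_action =
  fixes \<Gamma> :: "'a pair_pre_digraph" and G :: "('a \<Rightarrow> 'a) set" and \<Delta> \<Delta>' :: "'a set"
    and v u :: "nat \<Rightarrow> 'a" and n :: nat
  assumes graph: "pair_graph \<Gamma>"
    and connected: "Digraph_Component.connected (with_proj \<Gamma>)"
    and bipartite: "bipartition \<Gamma> \<Delta> \<Delta>'"
    and labels: "bij_betw v {1..n} \<Delta>" "bij_betw u {1..n} \<Delta>'"
    and G: "subgroup G (aut_group \<Gamma>)"
    and vertex_trans: "vertex_transitive G \<Gamma>"
    and edge_trans: "edge_transitive G \<Gamma>"
    and alt_induced: "Alt n \<subseteq> induced_perm n v ` part_stabilizer G \<Delta> \<Delta>'"
begin

lemma verts: "pverts \<Gamma> = \<Delta> \<union> \<Delta>'" and disjoint: "\<Delta> \<inter> \<Delta>' = {}"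
  and arcs: "parcs \<Gamma> \<subseteq> \<Delta> \<times> \<Delta>' \<union> \<Delta>' \<times> \<Delta>"
  using bipartite by (auto simp: bipartition_def)

lemma arc_sym: "(x, y) \<in> parcs \<Gamma> \<Longrightarrow> (y, x) \<in> parcs \<Gamma>"
proof -
  interpret pair_graph \<Gamma> by (rule graph)
  show "(x, y) \<in> parcs \<Gamma> \<Longrightarrow> (y, x) \<in> parcs \<Gamma>" by (rule arcs_symmetric)
qed

text \<open>Connectedness as an induction along paths: a nonempty set that no arc enters or leaves
  is everything.\<close>

lemma closed_set_full:
  assumes S: "S \<subseteq> pverts \<Gamma>" "S \<noteq> {}" and closed: "\<And>x y. (x, y) \<in> parcs \<Gamma> \<Longrightarrow> x \<in> S \<longleftrightarrow> y \<in> S"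
  shows "S = pverts \<Gamma>"
proof
  show "pverts \<Gamma> \<subseteq> S"
  proof
    fix y assume y: "y \<in> pverts \<Gamma>"
    obtain x where x: "x \<in> S" using S(2) by blast
    have "(x, y) \<in> rtrancl_on (pverts \<Gamma>) ((parcs \<Gamma>)\<^sup>s)"
      using connected x y S(1) unfolding connected_conv with_proj_simps by blast
    then show "y \<in> S"
      by (induction rule: rtrancl_on_induct) (use x closed in \<open>auto simp: symcl_def\<close>)
  qed
qed (rule S(1))

section \<open>Elements of G preserve or exchange the parts\<close>

lemma G_D:
  assumes "g \<in> G"
  shows "g permutes pverts \<Gamma>" "x \<in> pverts \<Gamma> \<Longrightarrow> y \<in> pverts \<Gamma> \<Longrightarrow> (x, y) \<in> parcs \<Gamma> \<longleftrightarrow> (g x, g y) \<in> parcs \<Gamma>"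
proof -
  have "g \<in> carrier (aut_group \<Gamma>)" using assms subgroup.subset[OF G] by blast
  then show "g permutes pverts \<Gamma>" "x \<in> pverts \<Gamma> \<Longrightarrow> y \<in> pverts \<Gamma> \<Longrightarrow> (x, y) \<in> parcs \<Gamma> \<longleftrightarrow> (g x, g y) \<in> parcs \<Gamma>"
    by (simp_all add: aut_group_def)
qed

lemma G_id: "id \<in> G"
  using subgroup.one_closed[OF G] by (simp add: aut_group_def)

lemma G_comp: "g \<in> G \<Longrightarrow> h \<in> G \<Longrightarrow> g \<circ> h \<in> G"
  using subgroup.m_closed[OF G] by (simp add: aut_group_def)

text \<open>The inverse in \<open>aut_group\<close> is a definite description over a bare monoid
  record, so it is identified directly with the inverse function.\<close>

lemma G_inv:
  assumes g: "g \<in> G" shows "inv' g \<in> G"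
proof -
  note p = permutes_inverses[OF G_D(1)[OF g]]
  have ip: "inv' g permutes pverts \<Gamma>" using G_D(1)[OF g] by (rule permutes_inv)
  have "(x, y) \<in> parcs \<Gamma> \<longleftrightarrow> (inv' g x, inv' g y) \<in> parcs \<Gamma>" if "x \<in> pverts \<Gamma>" "y \<in> pverts \<Gamma>" for x y
    using G_D(2)[OF g, of "inv' g x" "inv' g y"] that permutes_in_image[OF ip] p by simp
  then have c: "inv' g \<in> carrier (aut_group \<Gamma>)" using ip by (simp add: aut_group_def)
  have "inv\<^bsub>aut_group \<Gamma>\<^esub> g = inv' g"
    unfolding m_inv_def
  proof (rule the_equality)
    show "inv' g \<in> carrier (aut_group \<Gamma>) \<and> g \<otimes>\<^bsub>aut_group \<Gamma>\<^esub> inv' g = \<one>\<^bsub>aut_group \<Gamma>\<^esub>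
        \<and> inv' g \<otimes>\<^bsub>aut_group \<Gamma>\<^esub> g = \<one>\<^bsub>aut_group \<Gamma>\<^esub>"
      using c permutes_inv_o[OF G_D(1)[OF g]] by (simp add: aut_group_def)
    fix y assume "y \<in> carrier (aut_group \<Gamma>) \<and> g \<otimes>\<^bsub>aut_group \<Gamma>\<^esub> y = \<one>\<^bsub>aut_group \<Gamma>\<^esub>
        \<and> y \<otimes>\<^bsub>aut_group \<Gamma>\<^esub> g = \<one>\<^bsub>aut_group \<Gamma>\<^esub>"
    then have "g (y x) = x" for x by (simp add: aut_group_def fun_eq_iff)
    then show "y = inv' g" using p by (metis ext)
  qed
  then show ?thesis using subgroup.m_inv_closed[OF G g] by simp
qed

definition preserves :: "('a \<Rightarrow> 'a) \<Rightarrow> bool" where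
  "preserves g \<longleftrightarrow> bij_betw g \<Delta> \<Delta> \<and> bij_betw g \<Delta>' \<Delta>'"

definition swaps :: "('a \<Rightarrow> 'a) \<Rightarrow> bool" where
  "swaps g \<longleftrightarrow> bij_betw g \<Delta> \<Delta>' \<and> bij_betw g \<Delta>' \<Delta>"

text \<open>Both ends of an arc agree on whether \<open>g\<close> keeps them in their part, because
  \<open>g\<close> maps arcs to arcs. By connectedness all vertices agree.\<close>

lemma preserves_or_swaps:
  assumes g: "g \<in> G" shows "preserves g \<or> swaps g"
proof -
  note p = G_D(1)[OF g]
  have im: "g x \<in> \<Delta> \<union> \<Delta>' \<longleftrightarrow> x \<in> \<Delta> \<union> \<Delta>'" for x using permutes_in_image[OF p] unfolding verts .
  have bij: "bij_betw g A B" if A: "g ` A \<subseteq> B" "g ` A' \<subseteq> B'" "A \<union> A' = \<Delta> \<union> \<Delta>'" "B \<union> B' = \<Delta> \<union> \<Delta>'" "B \<inter> B' = {}" for A B A' B'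
  proof -
    have "B \<subseteq> g ` A"
    proof
      fix y assume y: "y \<in> B"
      then obtain x where x: "x \<in> \<Delta> \<union> \<Delta>'" "y = g x"
        using permutes_image[OF p] A(4) unfolding verts by blast
      then have "x \<in> A" using A y by blast
      then show "y \<in> g ` A" using x by blast
    qed
    then show ?thesis using A(1) permutes_inj[OF p] by (auto simp: bij_betw_def inj_on_def dest: injD)
  qed
  define S where "S = {x \<in> pverts \<Gamma>. g x \<in> \<Delta> \<longleftrightarrow> x \<in> \<Delta>}"
  have "x \<in> S \<longleftrightarrow> y \<in> S" if xy: "(x, y) \<in> parcs \<Gamma>" for x y
  proof -
    have r: "x \<in> \<Delta> \<and> y \<in> \<Delta>' \<or> x \<in> \<Delta>' \<and> y \<in> \<Delta>" using xy arcs by blast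
    then have m: "x \<in> pverts \<Gamma>" "y \<in> pverts \<Gamma>" unfolding verts by blast+
    then have "(g x, g y) \<in> parcs \<Gamma>" using G_D(2)[OF g] xy by blast
    then have "g x \<in> \<Delta> \<and> g y \<in> \<Delta>' \<or> g x \<in> \<Delta>' \<and> g y \<in> \<Delta>" using arcs by blast
    then show ?thesis using r m disjoint unfolding S_def by blast
  qed
  then consider "S = {}" | "S = pverts \<Gamma>" using closed_set_full[of S] unfolding S_def by blast
  then show ?thesis
  proof cases
    case 1
    then have *: "g x \<in> \<Delta> \<longleftrightarrow> x \<notin> \<Delta>" if "x \<in> \<Delta> \<union> \<Delta>'" for x using that unfolding S_def verts by blast
    have "g ` \<Delta> \<subseteq> \<Delta>'" "g ` \<Delta>' \<subseteq> \<Delta>" using * im disjoint by blast+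
    then show ?thesis using bij[of \<Delta> \<Delta>' \<Delta>' \<Delta>] bij[of \<Delta>' \<Delta> \<Delta> \<Delta>'] disjoint unfolding swaps_def by blast
  next
    case 2
    then have *: "g x \<in> \<Delta> \<longleftrightarrow> x \<in> \<Delta>" if "x \<in> \<Delta> \<union> \<Delta>'" for x using that unfolding S_def verts by blast
    have "g ` \<Delta> \<subseteq> \<Delta>" "g ` \<Delta>' \<subseteq> \<Delta>'" using * im disjoint by blast+
    then show ?thesis using bij[of \<Delta> \<Delta> \<Delta>' \<Delta>'] bij[of \<Delta>' \<Delta>' \<Delta> \<Delta>] disjoint unfolding preserves_def by blast
  qed
qed

lemma part_stabilizer_iff: "g \<in> part_stabilizer G \<Delta> \<Delta>' \<longleftrightarrow> g \<in> G \<and> preserves g"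
proof
  assume g: "g \<in> part_stabilizer G \<Delta> \<Delta>'"
  then have "g \<in> G" "g ` \<Delta> = \<Delta>" "g ` \<Delta>' = \<Delta>'" by (simp_all add: part_stabilizer_def)
  then show "g \<in> G \<and> preserves g"
    using permutes_inj_on[OF G_D(1)] unfolding preserves_def bij_betw_def by blast
next
  assume "g \<in> G \<and> preserves g"
  then show "g \<in> part_stabilizer G \<Delta> \<Delta>'" by (simp add: part_stabilizer_def preserves_def bij_betw_def)
qed

abbreviation "T \<equiv> transfer_perm n"

definition P where "P = induced_pair n v u ` part_stabilizer G \<Delta> \<Delta>'"

definition E where "E = {(i, j). i \<in> {1..n} \<and> j \<in> {1..n} \<and> (v i, u j) \<in> parcs \<Gamma>}"

definition Q where "Q = (\<lambda>g. (T v u g, T u v g)) ` {g \<in> G. swaps g}"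

lemma P_iff: "x \<in> P \<longleftrightarrow> (\<exists>g. g \<in> G \<and> preserves g \<and> x = (T v v g, T u u g))"
  unfolding P_def induced_pair_def[abs_def] induced_perm_eq_transfer by (auto simp: part_stabilizer_iff)

lemma P_I: "g \<in> G \<Longrightarrow> preserves g \<Longrightarrow> (T v v g, T u u g) \<in> P"
  unfolding P_iff by blast

lemma P_E:
  assumes "(h, h') \<in> P"
  obtains g where "g \<in> G" "preserves g" "h = T v v g" "h' = T u u g"
  using assms unfolding P_iff by blast

lemma Q_E:
  assumes "(a, b) \<in> Q"
  obtains g where "g \<in> G" "swaps g" "a = T v u g" "b = T u v g"
  using assms unfolding Q_def by auto

lemma v_in: "i \<in> {1..n} \<Longrightarrow> v i \<in> \<Delta>" and u_in: "i \<in> {1..n} \<Longrightarrow> u i \<in> \<Delta>'"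
  using labels bij_betwE by blast+

lemma v_neq_u: "i \<in> {1..n} \<Longrightarrow> j \<in> {1..n} \<Longrightarrow> v i \<noteq> u j"
  using v_in[of i] u_in[of j] disjoint by (metis disjoint_iff)

lemma v_eq: "i \<in> {1..n} \<Longrightarrow> j \<in> {1..n} \<Longrightarrow> v i = v j \<longleftrightarrow> i = j"
  and u_eq: "i \<in> {1..n} \<Longrightarrow> j \<in> {1..n} \<Longrightarrow> u i = u j \<longleftrightarrow> i = j"
  using labels by (auto simp: bij_betw_def inj_on_eq_iff)

lemma v_surj: "x \<in> \<Delta> \<Longrightarrow> \<exists>i\<in>{1..n}. x = v i" and u_surj: "x \<in> \<Delta>' \<Longrightarrow> \<exists>i\<in>{1..n}. x = u i"
  using labels by (auto simp: bij_betw_def)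

lemma preserves_T:
  assumes "preserves g"
  shows "T v v g permutes {1..n}" "T u u g permutes {1..n}"
    "i \<in> {1..n} \<Longrightarrow> v (T v v g i) = g (v i)" "i \<in> {1..n} \<Longrightarrow> u (T u u g i) = g (u i)"
  using transfer_perm[OF labels(1) labels(1)] transfer_perm[OF labels(2) labels(2)] assms
  unfolding preserves_def by blast+

lemma swaps_T:
  assumes "swaps g"
  shows "T v u g permutes {1..n}" "T u v g permutes {1..n}"
    "i \<in> {1..n} \<Longrightarrow> u (T v u g i) = g (v i)" "i \<in> {1..n} \<Longrightarrow> v (T u v g i) = g (u i)"
  using transfer_perm[OF labels(1) labels(2)] transfer_perm[OF labels(2) labels(1)] assms
  unfolding swaps_def by blast+

lemma inv_preserves: "g \<in> G \<Longrightarrow> preserves g \<Longrightarrow> preserves (inv' g)"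
  and inv_swaps: "g \<in> G \<Longrightarrow> swaps g \<Longrightarrow> swaps (inv' g)"
  using transfer_perm_inv(1)[OF labels(1) labels(1)] transfer_perm_inv(1)[OF labels(2) labels(2)]
    transfer_perm_inv(1)[OF labels(1) labels(2)] transfer_perm_inv(1)[OF labels(2) labels(1)] G_D(1)
  unfolding preserves_def swaps_def by blast+

lemma comp_preserves: "preserves g \<Longrightarrow> preserves h \<Longrightarrow> preserves (g \<circ> h)"
  and comp_swaps: "swaps g \<Longrightarrow> swaps h \<Longrightarrow> preserves (g \<circ> h)"
  and comp_swaps_preserves: "swaps g \<Longrightarrow> preserves h \<Longrightarrow> swaps (g \<circ> h)"
  unfolding preserves_def swaps_def using bij_betw_trans by blast+

text \<open>Connectedness includes that there is a vertex.\<close>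

lemma n_pos: "n \<ge> 1"
proof (rule ccontr)
  assume "\<not> n \<ge> 1"
  then have "pverts \<Gamma> = {}" using labels unfolding verts by (simp add: bij_betw_def)
  then show False using connected unfolding connected_conv by simp
qed

text \<open>Vertex-transitivity is used twice: within the first part it makes \<open>P\<close>
  transitive there, and across the parts it provides an exchange. Edge-transitivity splits into the
  two alternatives of \<open>edge\<close> by \<open>preserves_or_swaps\<close>.\<close>

sublocale edge_pairs n P E Q
proof
  show "a permutes {1..n} \<and> b permutes {1..n}" if "(a, b) \<in> P" for a b
    using that preserves_T by (elim P_E) blast
  have "preserves id" by (simp add: preserves_def)
  then show "(id, id) \<in> P"
    using P_I[OF G_id] transfer_perm_id[OF labels(1)] transfer_perm_id[OF labels(2)] by simp
  show "(a \<circ> c, b \<circ> d) \<in> P" if ab: "(a, b) \<in> P" and cd: "(c, d) \<in> P" for a b c d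
  proof -
    obtain g where g: "g \<in> G" "preserves g" "a = T v v g" "b = T u u g" using ab by (rule P_E)
    obtain h where h: "h \<in> G" "preserves h" "c = T v v h" "d = T u u h" using cd by (rule P_E)
    have "T v v (g \<circ> h) = a \<circ> c" "T u u (g \<circ> h) = b \<circ> d"
      using transfer_perm_comp[OF labels(1) labels(1) labels(1)]
        transfer_perm_comp[OF labels(2) labels(2) labels(2)] g h unfolding preserves_def by auto
    then show ?thesis using P_I[OF G_comp[OF g(1) h(1)] comp_preserves[OF g(2) h(2)]] by simp
  qed
  show "(inv' a, inv' b) \<in> P" if ab: "(a, b) \<in> P" for a b
  proof -
    obtain g where g: "g \<in> G" "preserves g" "a = T v v g" "b = T u u g" using ab by (rule P_E)
    have "T v v (inv' g) = inv' a" "T u u (inv' g) = inv' b"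
      using transfer_perm_inv(2)[OF labels(1) labels(1) G_D(1)[OF g(1)]]
        transfer_perm_inv(2)[OF labels(2) labels(2) G_D(1)[OF g(1)]] g unfolding preserves_def by auto
    then show ?thesis using P_I[OF G_inv[OF g(1)] inv_preserves[OF g(1,2)]] by simp
  qed
  show "n \<ge> 1" by (rule n_pos)
  show "Alt n \<subseteq> fst ` P"
    using alt_induced unfolding P_def induced_pair_def[abs_def] image_image fst_conv .
  show "\<exists>h h'. (h, h') \<in> P \<and> h i = k" if ik: "i \<in> {1..n}" "k \<in> {1..n}" for i k
  proof -
    have "v i \<in> pverts \<Gamma>" "v k \<in> pverts \<Gamma>" using v_in ik verts by auto
    then obtain g where g: "g \<in> G" "g (v i) = v k" using vertex_trans unfolding vertex_transitive_def by blast
    have "\<not> swaps g"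
      using g(2) v_in[OF ik(1)] v_in[OF ik(2)] disjoint unfolding swaps_def by (metis bij_betwE disjoint_iff)
    then have pr: "preserves g" using preserves_or_swaps g(1) by blast
    then have "v (T v v g i) = v k" using preserves_T(3) ik g(2) by simp
    then have "T v v g i = k" using v_eq ik permutes_in_image[OF preserves_T(1)[OF pr]] by blast
    then show ?thesis using P_I[OF g(1) pr] by blast
  qed
  show "E \<subseteq> {1..n} \<times> {1..n}" by (auto simp: E_def)
  show "(h i, h' j) \<in> E" if ij: "(i, j) \<in> E" and h: "(h, h') \<in> P" for i j h h'
  proof -
    obtain g where g: "g \<in> G" "preserves g" "h = T v v g" "h' = T u u g" using h by (rule P_E)
    have r: "i \<in> {1..n}" "j \<in> {1..n}" "(v i, u j) \<in> parcs \<Gamma>" using ij unfolding E_def by blast+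
    have "h i \<in> {1..n}" "h' j \<in> {1..n}"
      using g(3,4) preserves_T(1,2)[OF g(2)] permutes_in_image r by metis+
    moreover have "(g (v i), g (u j)) \<in> parcs \<Gamma>"
      using G_D(2)[OF g(1), of "v i" "u j"] r v_in u_in verts by blast
    then have "(v (h i), u (h' j)) \<in> parcs \<Gamma>" using g preserves_T(3,4)[OF g(2)] r by simp
    ultimately show ?thesis unfolding E_def by blast
  qed
  show "A = {1..n} \<and> B = {1..n}"
    if A: "A \<subseteq> {1..n}" and B: "B \<subseteq> {1..n}" and ne: "A \<noteq> {} \<or> B \<noteq> {}"
      and AB: "\<And>i j. (i, j) \<in> E \<Longrightarrow> i \<in> A \<longleftrightarrow> j \<in> B" for A B
  proof -
    \<comment> \<open>\<open>A\<close> and \<open>B\<close> are merged into one vertex set;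
      injective labels and disjoint parts allow both to be read back from it.\<close>
    have vA: "v i \<in> v ` A \<union> u ` B \<longleftrightarrow> i \<in> A" if i: "i \<in> {1..n}" for i
    proof -
      have "v i \<notin> u ` B" using v_neq_u[OF i] B by (metis imageE subsetD)
      moreover have "v i \<in> v ` A \<longleftrightarrow> i \<in> A" using v_eq[OF i] A by blast
      ultimately show ?thesis by blast
    qed
    have uB: "u j \<in> v ` A \<union> u ` B \<longleftrightarrow> j \<in> B" if j: "j \<in> {1..n}" for j
    proof -
      have "u j \<notin> v ` A" using v_neq_u[OF _ j] A by (metis imageE subsetD)
      moreover have "u j \<in> u ` B \<longleftrightarrow> j \<in> B" using u_eq[OF j] B by blast
      ultimately show ?thesis by blast
    qed
    have half: "x \<in> v ` A \<union> u ` B \<longleftrightarrow> y \<in> v ` A \<union> u ` B"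
      if xy: "(x, y) \<in> parcs \<Gamma>" "x \<in> \<Delta>" "y \<in> \<Delta>'" for x y
    proof -
      obtain i j where ij: "i \<in> {1..n}" "x = v i" "j \<in> {1..n}" "y = u j" using v_surj u_surj xy by blast
      then have "(i, j) \<in> E" using xy(1) unfolding E_def by blast
      then have "i \<in> A \<longleftrightarrow> j \<in> B" by (rule AB)
      then show ?thesis unfolding ij(2,4) vA[OF ij(1)] uB[OF ij(3)] .
    qed
    have "v ` A \<union> u ` B = pverts \<Gamma>"
    proof (rule closed_set_full)
      show "v ` A \<union> u ` B \<subseteq> pverts \<Gamma>" using A B v_in u_in verts by blast
      show "v ` A \<union> u ` B \<noteq> {}" using ne by blast
      show "x \<in> v ` A \<union> u ` B \<longleftrightarrow> y \<in> v ` A \<union> u ` B" if xy: "(x, y) \<in> parcs \<Gamma>" for x y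
      proof -
        have "x \<in> \<Delta> \<and> y \<in> \<Delta>' \<or> x \<in> \<Delta>' \<and> y \<in> \<Delta>" using subsetD[OF arcs xy] by simp
        then show ?thesis
        proof (elim disjE conjE)
          assume "x \<in> \<Delta>" "y \<in> \<Delta>'" with xy show ?thesis by (rule half)
        next
          assume "x \<in> \<Delta>'" "y \<in> \<Delta>"
          then show ?thesis by (intro half[OF arc_sym[OF xy], symmetric])
        qed
      qed
    qed
    then have full: "v ` A \<union> u ` B = \<Delta> \<union> \<Delta>'" using verts by simp
    have iA: "i \<in> A" if "i \<in> {1..n}" for i using vA[OF that] v_in[OF that] unfolding full by blast
    have jB: "j \<in> B" if "j \<in> {1..n}" for j using uB[OF that] u_in[OF that] unfolding full by blast
    show ?thesis using subset_antisym[OF A subsetI[OF iA]] subset_antisym[OF B subsetI[OF jB]] by (rule conjI)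
  qed
  show "a permutes {1..n} \<and> b permutes {1..n}" if "(a, b) \<in> Q" for a b
    using that swaps_T by (elim Q_E) blast
  show "Q \<noteq> {}"
  proof -
    have 1: "v 1 \<in> \<Delta>" "u 1 \<in> \<Delta>'" using v_in u_in n_pos by auto
    then obtain g where g: "g \<in> G" "g (v 1) = u 1"
      using vertex_trans verts unfolding vertex_transitive_def by (metis UnCI)
    have "\<not> preserves g" using g(2) 1 disjoint unfolding preserves_def by (metis bij_betwE disjoint_iff)
    then have "swaps g" using preserves_or_swaps g(1) by blast
    then show ?thesis using g(1) unfolding Q_def by blast
  qed
  show "(b \<circ> h' \<circ> inv' b, a \<circ> h \<circ> inv' a) \<in> P" if ab: "(a, b) \<in> Q" and h: "(h, h') \<in> P" for a b h h'
  proof -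
    obtain g where g: "g \<in> G" "swaps g" "a = T v u g" "b = T u v g" using ab by (rule Q_E)
    obtain k where k: "k \<in> G" "preserves k" "h = T v v k" "h' = T u u k" using h by (rule P_E)
    have bg: "bij_betw g \<Delta> \<Delta>'" "bij_betw g \<Delta>' \<Delta>" and bk: "bij_betw k \<Delta> \<Delta>" "bij_betw k \<Delta>' \<Delta>'"
      using g(2) k(2) unfolding swaps_def preserves_def by blast+
    note p = G_D(1)[OF g(1)]
    have bi: "bij_betw (inv' g) \<Delta>' \<Delta>" "bij_betw (inv' g) \<Delta> \<Delta>'"
      by (rule transfer_perm_inv(1)[OF labels(1) labels(2) p bg(1)],
          rule transfer_perm_inv(1)[OF labels(2) labels(1) p bg(2)])
    have "T v v (g \<circ> k \<circ> inv' g) = T u v g \<circ> T u u k \<circ> T v u (inv' g)"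
      using transfer_perm_comp[OF labels(1) labels(2) labels(1) bi(2) bij_betw_trans[OF bk(2) bg(2)]]
        transfer_perm_comp[OF labels(2) labels(2) labels(1) bk(2) bg(2)] by (simp only:)
    also have "\<dots> = b \<circ> h' \<circ> inv' b"
      using transfer_perm_inv(2)[OF labels(2) labels(1) p bg(2)] g k by (simp only:)
    finally have 1: "T v v (g \<circ> k \<circ> inv' g) = b \<circ> h' \<circ> inv' b" .
    have "T u u (g \<circ> k \<circ> inv' g) = T v u g \<circ> T v v k \<circ> T u v (inv' g)"
      using transfer_perm_comp[OF labels(2) labels(1) labels(2) bi(1) bij_betw_trans[OF bk(1) bg(1)]]
        transfer_perm_comp[OF labels(1) labels(1) labels(2) bk(1) bg(1)] by (simp only:)
    also have "\<dots> = a \<circ> h \<circ> inv' a"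
      using transfer_perm_inv(2)[OF labels(1) labels(2) p bg(1)] g k by (simp only:)
    finally have 2: "T u u (g \<circ> k \<circ> inv' g) = a \<circ> h \<circ> inv' a" .
    have "g \<circ> k \<circ> inv' g \<in> G" using g k G_comp G_inv by blast
    moreover have "preserves (g \<circ> k \<circ> inv' g)"
      using comp_swaps comp_swaps_preserves inv_swaps g k by blast
    ultimately show ?thesis using P_I 1 2 by metis
  qed
  show "(inv' a' \<circ> a, inv' b' \<circ> b) \<in> P" if ab: "(a, b) \<in> Q" and ab': "(a', b') \<in> Q" for a b a' b'
  proof -
    obtain g where g: "g \<in> G" "swaps g" "a = T v u g" "b = T u v g" using ab by (rule Q_E)
    obtain k where k: "k \<in> G" "swaps k" "a' = T v u k" "b' = T u v k" using ab' by (rule Q_E)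
    have bg: "bij_betw g \<Delta> \<Delta>'" "bij_betw g \<Delta>' \<Delta>" and bk: "bij_betw k \<Delta> \<Delta>'" "bij_betw k \<Delta>' \<Delta>"
      using g(2) k(2) unfolding swaps_def by blast+
    note p = G_D(1)[OF k(1)]
    note i1 = transfer_perm_inv[OF labels(1) labels(2) p bk(1)]
      and i2 = transfer_perm_inv[OF labels(2) labels(1) p bk(2)]
    have "T v v (inv' k \<circ> g) = inv' a' \<circ> a"
      using transfer_perm_comp[OF labels(1) labels(2) labels(1) bg(1) i1(1)] i1(2) g k by (simp only:)
    moreover have "T u u (inv' k \<circ> g) = inv' b' \<circ> b"
      using transfer_perm_comp[OF labels(2) labels(1) labels(2) bg(2) i2(1)] i2(2) g k by (simp only:)
    moreover have "inv' k \<circ> g \<in> G" "preserves (inv' k \<circ> g)"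
      using g k G_comp G_inv comp_swaps inv_swaps by blast+
    ultimately show ?thesis using P_I by metis
  qed
  show "(\<exists>h h'. (h, h') \<in> P \<and> h i = k \<and> h' j = l) \<or> (\<exists>a b. (a, b) \<in> Q \<and> a i = l \<and> b j = k)"
    if ij: "(i, j) \<in> E" and kl: "(k, l) \<in> E" for i j k l
  proof -
    have r: "i \<in> {1..n}" "j \<in> {1..n}" "k \<in> {1..n}" "l \<in> {1..n}"
      and e: "(v i, u j) \<in> parcs \<Gamma>" "(v k, u l) \<in> parcs \<Gamma>" using ij kl unfolding E_def by blast+
    then have "{v i, u j} \<in> uedges \<Gamma>" "{v k, u l} \<in> uedges \<Gamma>" unfolding uedges_def by blast+
    then obtain g where g: "g \<in> G" "g ` {v i, u j} = {v k, u l}"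
      using edge_trans unfolding edge_transitive_def by blast
    have inD: "v i \<in> \<Delta>" "v k \<in> \<Delta>" "u j \<in> \<Delta>'" "u l \<in> \<Delta>'" using v_in u_in r by blast+
    from preserves_or_swaps[OF g(1)] show ?thesis
    proof
      assume pr: "preserves g"
      then have "g (v i) \<in> \<Delta>" "g (u j) \<in> \<Delta>'" using inD unfolding preserves_def by (metis bij_betwE)+
      then have "g (v i) \<noteq> u l" using inD disjoint by (metis disjoint_iff)
      then have "g (v i) = v k" "g (u j) = u l" using g(2) by (auto simp: doubleton_eq_iff)
      then have "v (T v v g i) = v k" "u (T u u g j) = u l" using preserves_T(3,4)[OF pr] r by simp_all
      moreover have "T v v g i \<in> {1..n}" "T u u g j \<in> {1..n}"
        using r permutes_in_image[OF preserves_T(1)[OF pr]] permutes_in_image[OF preserves_T(2)[OF pr]] by blast+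
      ultimately have "T v v g i = k" "T u u g j = l"
        using v_eq[OF _ r(3)] u_eq[OF _ r(4)] by blast+
      then show ?thesis using P_I[OF g(1) pr] by blast
    next
      assume sw: "swaps g"
      then have "g (v i) \<in> \<Delta>'" "g (u j) \<in> \<Delta>" using inD unfolding swaps_def by (metis bij_betwE)+
      then have "g (v i) \<noteq> v k" using inD disjoint by (metis disjoint_iff)
      then have "g (v i) = u l" "g (u j) = v k" using g(2) by (auto simp: doubleton_eq_iff)
      then have "u (T v u g i) = u l" "v (T u v g j) = v k" using swaps_T(3,4)[OF sw] r by simp_all
      moreover have "T v u g i \<in> {1..n}" "T u v g j \<in> {1..n}"
        using r permutes_in_image[OF swaps_T(1)[OF sw]] permutes_in_image[OF swaps_T(2)[OF sw]] by blast+
      ultimately have "T v u g i = l" "T u v g j = k"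
        using v_eq[OF _ r(3)] u_eq[OF _ r(4)] by blast+
      then show ?thesis using g(1) sw unfolding Q_def by blast
    qed
  qed
qed

end

section \<open>The graph and the conjugating element recovered from the index data\<close>

context bipartite_action
begin

lemma parcs_eq: "parcs \<Gamma> = {(v i, u j) |i j. (i, j) \<in> E} \<union> {(u j, v i) |i j. (i, j) \<in> E}"
proof (rule Set.set_eqI)
  fix e :: "'a \<times> 'a"
  obtain x y where e: "e = (x, y)" by (cases e)
  have half: "\<exists>i j. x = v i \<and> y = u j \<and> (i, j) \<in> E" if xy: "(x, y) \<in> parcs \<Gamma>" "x \<in> \<Delta>" "y \<in> \<Delta>'" for x y
  proof -
    obtain i j where ij: "i \<in> {1..n}" "x = v i" "j \<in> {1..n}" "y = u j" using v_surj u_surj xy by blast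
    then show ?thesis using xy(1) unfolding E_def by blast
  qed
  show "e \<in> parcs \<Gamma> \<longleftrightarrow> e \<in> {(v i, u j) |i j. (i, j) \<in> E} \<union> {(u j, v i) |i j. (i, j) \<in> E}"
  proof
    assume xy: "e \<in> parcs \<Gamma>"
    then have "x \<in> \<Delta> \<and> y \<in> \<Delta>' \<or> x \<in> \<Delta>' \<and> y \<in> \<Delta>" using subsetD[OF arcs xy] by (simp add: e)
    then show "e \<in> {(v i, u j) |i j. (i, j) \<in> E} \<union> {(u j, v i) |i j. (i, j) \<in> E}"
      using half[of x y] half[of y x] arc_sym xy unfolding e by blast
  next
    assume "e \<in> {(v i, u j) |i j. (i, j) \<in> E} \<union> {(u j, v i) |i j. (i, j) \<in> E}"
    then obtain i j where "e = (v i, u j) \<or> e = (u j, v i)" "(i, j) \<in> E" by blast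
    then show "e \<in> parcs \<Gamma>" using arc_sym unfolding E_def by blast
  qed
qed

lemma verts_eq: "pverts \<Gamma> = v ` {1..n} \<union> u ` {1..n}"
  using verts labels by (simp add: bij_betw_def)

lemma label_act_v:
  assumes i: "i \<in> {1..n}" shows "label_act n v u c (v i) = v (fst c i)"
  unfolding label_act_def if_P[OF imageI[OF i]] inv_into_f_f[OF bij_betw_imp_inj_on[OF labels(1)] i] ..

lemma label_act_u:
  assumes j: "j \<in> {1..n}" shows "label_act n v u c (u j) = u (snd c j)"
proof -
  have "u j \<notin> v ` {1..n}" using v_neq_u[OF _ j] by (metis imageE)
  then show ?thesis
    unfolding label_act_def
    by (simp only: if_False if_P[OF imageI[OF j]] inv_into_f_f[OF bij_betw_imp_inj_on[OF labels(2)] j])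
qed

lemma graph_image_label_act:
  assumes r: "\<rho> permutes {1..n}"
  shows "graph_image (label_act n v u (id, \<rho>)) \<Gamma> = \<lparr>pverts = v ` {1..n} \<union> u ` {1..n},
    parcs = {(v i, u (\<rho> j)) |i j. (i, j) \<in> E} \<union> {(u (\<rho> j), v i) |i j. (i, j) \<in> E}\<rparr>"
proof -
  let ?f = "label_act n v u (id, \<rho>)"
  have fv: "?f (v i) = v i" if "i \<in> {1..n}" for i using label_act_v[OF that, of "(id, \<rho>)"] by simp
  have fu: "?f (u j) = u (\<rho> j)" if "j \<in> {1..n}" for j using label_act_u[OF that, of "(id, \<rho>)"] by simp
  have "?f ` (v ` {1..n}) = v ` {1..n}" unfolding image_image by (rule image_cong[OF refl fv])
  moreover have "?f ` (u ` {1..n}) = u ` \<rho> ` {1..n}" unfolding image_image by (rule image_cong[OF refl fu])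
  ultimately have V: "?f ` pverts \<Gamma> = v ` {1..n} \<union> u ` {1..n}"
    unfolding verts_eq image_Un permutes_image[OF r] by simp
  have 1: "map_prod ?f ?f ` {(v i, u j) |i j. (i, j) \<in> E} = {(v i, u (\<rho> j)) |i j. (i, j) \<in> E}"
  proof -
    have "{(v i, u j) |i j. (i, j) \<in> E} = (\<lambda>(i, j). (v i, u j)) ` E" by force
    then have "map_prod ?f ?f ` {(v i, u j) |i j. (i, j) \<in> E} = (\<lambda>(i, j). (?f (v i), ?f (u j))) ` E"
      by (simp add: image_image case_prod_beta)
    also have "\<dots> = (\<lambda>(i, j). (v i, u (\<rho> j))) ` E"
      using E_sub by (intro image_cong) (auto simp: fv fu simp del: One_nat_def)
    also have "\<dots> = {(v i, u (\<rho> j)) |i j. (i, j) \<in> E}" by force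
    finally show ?thesis .
  qed
  have 2: "map_prod ?f ?f ` {(u j, v i) |i j. (i, j) \<in> E} = {(u (\<rho> j), v i) |i j. (i, j) \<in> E}"
  proof -
    have "{(u j, v i) |i j. (i, j) \<in> E} = (\<lambda>(i, j). (u j, v i)) ` E" by force
    then have "map_prod ?f ?f ` {(u j, v i) |i j. (i, j) \<in> E} = (\<lambda>(i, j). (?f (u j), ?f (v i))) ` E"
      by (simp add: image_image case_prod_beta)
    also have "\<dots> = (\<lambda>(i, j). (u (\<rho> j), v i)) ` E"
      using E_sub by (intro image_cong) (auto simp: fv fu simp del: One_nat_def)
    also have "\<dots> = {(u (\<rho> j), v i) |i j. (i, j) \<in> E}" by force
    finally show ?thesis .
  qed
  show ?thesis unfolding graph_image_def V parcs_eq image_Un 1 2 ..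
qed

lemma graph_image_id: "graph_image (label_act n v u (id, id)) \<Gamma> = \<Gamma>"
  unfolding graph_image_label_act[OF permutes_id] by (rule pair_pre_digraph.equality) (simp_all add: verts_eq parcs_eq)

text \<open>A complete bipartite graph is unchanged by any relabelling. Hence the identity shows
  that the graph itself is complete, and \<pi>^-1 may be chosen to suit the group alone.\<close>

lemma complete_image:
  assumes E: "E = {1..n} \<times> {1..n}" and r: "\<rho> permutes {1..n}"
  shows "graph_image (label_act n v u (id, \<rho>)) \<Gamma> = Knn n v u"
proof -
  have u: "(\<lambda>j. u (\<rho> j)) ` {1..n} = u ` {1..n}"
    using image_image[of u \<rho> "{1..n}"] permutes_image[OF r] by simp
  have "{(v i, u (\<rho> j)) |i j. (i, j) \<in> E} = v ` {1..n} \<times> (\<lambda>j. u (\<rho> j)) ` {1..n}"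
    unfolding E by blast
  then have 1: "{(v i, u (\<rho> j)) |i j. (i, j) \<in> E} = v ` {1..n} \<times> u ` {1..n}" unfolding u .
  have "{(u (\<rho> j), v i) |i j. (i, j) \<in> E} = (\<lambda>j. u (\<rho> j)) ` {1..n} \<times> v ` {1..n}"
    unfolding E by blast
  then have 2: "{(u (\<rho> j), v i) |i j. (i, j) \<in> E} = u ` {1..n} \<times> v ` {1..n}" unfolding u .
  show ?thesis unfolding graph_image_label_act[OF r] Knn_def 1 2 ..
qed

text \<open>Replacing the label j of the second part by k = \<pi>^-1 j turns the condition j
  \<noteq> \<pi> i into k \<noteq> i, the form in the standard graph.\<close>

lemma matching_image:
  assumes E: "E = {(i, j). i \<in> {1..n} \<and> j \<in> {1..n} \<and> j \<noteq> \<pi> i}" and p: "\<pi> permutes {1..n}"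
  shows "graph_image (label_act n v u (id, inv' \<pi>)) \<Gamma> = Knn_minus_matching n v u"
proof -
  note pinv = permutes_inverses[OF p]
  have im: "\<pi> k \<in> {1..n} \<longleftrightarrow> k \<in> {1..n}" "inv' \<pi> k \<in> {1..n} \<longleftrightarrow> k \<in> {1..n}" for k
    using permutes_in_image[OF p] permutes_in_image[OF permutes_inv[OF p]] by blast+
  have iff: "(\<exists>j. (i, j) \<in> E \<and> k = inv' \<pi> j) \<longleftrightarrow> i \<in> {1..n} \<and> k \<in> {1..n} \<and> k \<noteq> i" for i k
  proof
    assume "\<exists>j. (i, j) \<in> E \<and> k = inv' \<pi> j"
    then obtain j where j: "i \<in> {1..n}" "j \<in> {1..n}" "j \<noteq> \<pi> i" "k = inv' \<pi> j" unfolding E by blast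
    moreover have "k \<noteq> i" using j(3,4) pinv(1)[of j] by auto
    ultimately show "i \<in> {1..n} \<and> k \<in> {1..n} \<and> k \<noteq> i" using im(2) by blast
  next
    assume k: "i \<in> {1..n} \<and> k \<in> {1..n} \<and> k \<noteq> i"
    then have "\<pi> k \<noteq> \<pi> i" using permutes_eq_iff[OF p] by simp
    then show "\<exists>j. (i, j) \<in> E \<and> k = inv' \<pi> j"
      unfolding E using k im pinv by (intro exI[of _ "\<pi> k"]) simp
  qed
  have "{(v i, u (inv' \<pi> j)) |i j. (i, j) \<in> E} = {(v i, u k) |i k. \<exists>j. (i, j) \<in> E \<and> k = inv' \<pi> j}"
    by blast
  then have 1: "{(v i, u (inv' \<pi> j)) |i j. (i, j) \<in> E} = {(v i, u k) |i k. i \<in> {1..n} \<and> k \<in> {1..n} \<and> k \<noteq> i}"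
    unfolding iff .
  have "{(u (inv' \<pi> j), v i) |i j. (i, j) \<in> E} = {(u k, v i) |i k. \<exists>j. (i, j) \<in> E \<and> k = inv' \<pi> j}"
    by blast
  then have 2: "{(u (inv' \<pi> j), v i) |i j. (i, j) \<in> E} = {(u k, v i) |i k. i \<in> {1..n} \<and> k \<in> {1..n} \<and> k \<noteq> i}"
    unfolding iff .
  have arcs: "parcs (Knn_minus_matching n v u)
      = {(v i, u k) |i k. i \<in> {1..n} \<and> k \<in> {1..n} \<and> k \<noteq> i}
        \<union> {(u k, v i) |i k. i \<in> {1..n} \<and> k \<in> {1..n} \<and> k \<noteq> i}" (is "?L = ?R")
  proof (rule Set.set_eqI)
    fix e :: "'a \<times> 'a"
    have m: "e \<in> ?L \<longleftrightarrow> (\<exists>i\<in>{1..n}. \<exists>k\<in>{1..n}. e = (v i, u k) \<or> e = (u k, v i)) \<and>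
        \<not> (\<exists>i\<in>{1..n}. e = (v i, u i) \<or> e = (u i, v i))"
      unfolding Knn_minus_matching_def Knn_def by (auto simp del: atLeastAtMost_iff)
    have off: "(v i, u k) \<noteq> (v l, u l)" "(v i, u k) \<noteq> (u l, v l)" "(u k, v i) \<noteq> (v l, u l)" "(u k, v i) \<noteq> (u l, v l)"
      if r: "i \<in> {1..n}" "k \<in> {1..n}" "k \<noteq> i" "l \<in> {1..n}" for i k l
      using v_eq[OF r(1,4)] u_eq[OF r(2,4)] v_neq_u[OF r(1,4)] v_neq_u[OF r(4,2)] r(3) by auto
    show "e \<in> ?L \<longleftrightarrow> e \<in> ?R"
    proof
      assume "e \<in> ?L"
      then obtain i k where ik: "i \<in> {1..n}" "k \<in> {1..n}" "e = (v i, u k) \<or> e = (u k, v i)"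
        and nm: "\<not> (\<exists>i\<in>{1..n}. e = (v i, u i) \<or> e = (u i, v i))" unfolding m by blast
      have "k \<noteq> i" using nm ik by blast
      then show "e \<in> ?R" using ik by blast
    next
      assume "e \<in> ?R"
      then obtain i k where ik: "i \<in> {1..n}" "k \<in> {1..n}" "k \<noteq> i" "e = (v i, u k) \<or> e = (u k, v i)" by blast
      have "e \<noteq> (v l, u l) \<and> e \<noteq> (u l, v l)" if "l \<in> {1..n}" for l
        using off[OF ik(1-3) that] ik(4) by (elim disjE) simp_all
      then show "e \<in> ?L" unfolding m using ik by blast
    qed
  qed
  have "pverts (Knn_minus_matching n v u) = v ` {1..n} \<union> u ` {1..n}"
    by (simp add: Knn_minus_matching_def Knn_def)
  with arcs show ?thesis
    unfolding graph_image_label_act[OF permutes_inv[OF p]] 1 2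
    by (intro pair_pre_digraph.equality) simp_all
qed

lemma conj_P_eq:
  assumes p: "\<pi> permutes {1..n}"
  shows "(\<lambda>x. (id, inv' \<pi>) \<otimes>\<^bsub>sym_sym n\<^esub> x \<otimes>\<^bsub>sym_sym n\<^esub> inv\<^bsub>sym_sym n\<^esub> (id, inv' \<pi>)) ` P = conj_right \<pi>"
proof -
  have ii: "inv' (inv' \<pi>) = \<pi>" using p permutes_bij inv_inv_eq by blast
  have iv: "inv\<^bsub>sym_sym n\<^esub> (id, inv' \<pi>) = (id, \<pi>)"
    unfolding inv_sym_sym[OF permutes_id permutes_inv[OF p]] ii by simp
  have "(id, inv' \<pi>) \<otimes>\<^bsub>sym_sym n\<^esub> x \<otimes>\<^bsub>sym_sym n\<^esub> (id, \<pi>) = (\<lambda>(h, h'). (h, inv' \<pi> \<circ> h' \<circ> \<pi>)) x" for x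
    by (cases x) (simp only: sym_sym_simps prod.case comp_id id_comp)
  then show ?thesis unfolding iv conj_right_def by simp
qed

lemma conjugate_pairI:
  assumes p: "\<pi> permutes {1..n}"
    and "graph_image (label_act n v u (id, inv' \<pi>)) \<Gamma> = \<Gamma>'" "conj_right \<pi> = P'"
  shows "conjugate_pair n v u \<Gamma> P \<Gamma>' P'"
  unfolding conjugate_pair_def
  using assms(2,3) conj_P_eq[OF p] permutes_inv[OF p] permutes_id
  by (intro bexI[of _ "(id, inv' \<pi>)"]) (simp_all only: sym_sym_simps simp_thms)

end

theorem theorem1p3:
  fixes \<Gamma> :: "'a pair_pre_digraph"
    and G :: "('a \<Rightarrow> 'a) set"
    and \<Delta> \<Delta>' :: "'a set"
    and v u :: "nat \<Rightarrow> 'a"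
    and n :: nat
    and \<phi> :: "(nat \<Rightarrow> nat) \<Rightarrow> (nat \<Rightarrow> nat)"
  defines "Gplus \<equiv> part_stabilizer G \<Delta> \<Delta>'"
  defines "P \<equiv> induced_pair n v u ` Gplus"
  assumes graph: "pair_graph \<Gamma>"
    and connected: "Digraph_Component.connected (with_proj \<Gamma>)"
    and bipartite: "bipartition \<Gamma> \<Delta> \<Delta>'"
    and labels: "bij_betw v {1..n} \<Delta>" "bij_betw u {1..n} \<Delta>'"
    and G: "subgroup G (aut_group \<Gamma>)"
    and vertex_trans: "vertex_transitive G \<Gamma>"
    and edge_trans: "edge_transitive G \<Gamma>"
    and alt: "Alt n \<subseteq> induced_perm n v ` Gplus"
    and sym: "induced_perm n v ` Gplus \<subseteq> Sym n"
    and phi: "n = 6 \<Longrightarrow> outer_involution (sym_group 6) \<phi>"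
  shows "(\<Gamma> = Knn n v u \<or>
          (\<exists>c\<in>carrier (sym_sym n). graph_image (label_act n v u c) \<Gamma> = Knn_minus_matching n v u)) \<and>
         (conjugate_pair n v u \<Gamma> P (Knn n v u) (Alt n \<times> Alt n) \<or>
          conjugate_pair n v u \<Gamma> P (Knn n v u)
            (generate (sym_sym n) (Alt n \<times> Alt n \<union> {(transpose 1 2, transpose 1 2)})) \<or>
          conjugate_pair n v u \<Gamma> P (Knn n v u) (Sym n \<times> Sym n) \<or>
          conjugate_pair n v u \<Gamma> P (Knn_minus_matching n v u) (Diag (Sym n)) \<or>
          conjugate_pair n v u \<Gamma> P (Knn_minus_matching n v u) (Diag (Alt n)) \<or>
          (n = 6 \<and> (\<exists>H\<in>{Alt 6, Sym 6}.
             conjugate_pair n v u \<Gamma> P (Knn n v u) (Diag_twisted \<phi> H))) \<or>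
          (n = 4 \<and> (\<exists>H\<in>{Alt 4, Sym 4}.
             conjugate_pair n v u \<Gamma> P (Knn n v u)
               (generate (sym_sym n) (V4 \<times> V4 \<union> Diag H)))))"
proof -
  interpret A: bipartite_action \<Gamma> G \<Delta> \<Delta>' v u n
    using graph connected bipartite labels G vertex_trans edge_trans alt
    unfolding Gplus_def by (rule bipartite_action.intro)
  have P_eq: "A.P = P"
    unfolding A.P_def P_def Gplus_def ..
  show ?thesis
  proof (rule A.classification[OF phi])
    fix \<pi>
    assume p: "\<pi> permutes {1..n}" and full: "A.E = {1..n} \<times> {1..n}"
      and c: "A.conj_right \<pi> = Alt n \<times> Alt n
        \<or> A.conj_right \<pi> = generate (sym_sym n) (Alt n \<times> Alt n \<union> {(transpose 1 2, transpose 1 2)})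
        \<or> A.conj_right \<pi> = Sym n \<times> Sym n
        \<or> n = 6 \<and> (\<exists>H\<in>{Alt 6, Sym 6}. A.conj_right \<pi> = Diag_twisted \<phi> H)
        \<or> n = 4 \<and> (\<exists>H\<in>{Alt 4, Sym 4}. A.conj_right \<pi> = generate (sym_sym n) (V4 \<times> V4 \<union> Diag H))"
    \<comment> \<open>Relabelling by the identity gives equality of graphs, not merely
      conjugacy.\<close>
    have eq: "\<Gamma> = Knn n v u"
      using A.complete_image[OF full permutes_id] A.graph_image_id by simp
    note I = A.conjugate_pairI[OF p A.complete_image[OF full permutes_inv[OF p]]]
    from c show ?thesis
    proof (elim disjE conjE bexE)
      assume "A.conj_right \<pi> = Alt n \<times> Alt n"
      from eq I[OF this, unfolded P_eq] show ?thesis by blast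
    next
      assume "A.conj_right \<pi> = generate (sym_sym n) (Alt n \<times> Alt n \<union> {(transpose 1 2, transpose 1 2)})"
      from eq I[OF this, unfolded P_eq] show ?thesis by blast
    next
      assume "A.conj_right \<pi> = Sym n \<times> Sym n"
      from eq I[OF this, unfolded P_eq] show ?thesis by blast
    next
      fix H assume "n = 6" "H \<in> {Alt 6, Sym 6}" and H: "A.conj_right \<pi> = Diag_twisted \<phi> H"
      with eq I[OF H, unfolded P_eq] show ?thesis by blast
    next
      fix H assume "n = 4" "H \<in> {Alt 4, Sym 4}"
        and H: "A.conj_right \<pi> = generate (sym_sym n) (V4 \<times> V4 \<union> Diag H)"
      with eq I[OF H, unfolded P_eq] show ?thesis by blast
    qed
  next
    fix \<pi>
    assume p: "\<pi> permutes {1..n}"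
      and E: "A.E = {(i, j). i \<in> {1..n} \<and> j \<in> {1..n} \<and> j \<noteq> \<pi> i}"
      and c: "A.conj_right \<pi> = Diag (Sym n) \<or> A.conj_right \<pi> = Diag (Alt n)"
    have "(id, inv' \<pi>) \<in> carrier (sym_sym n)"
      using permutes_inv[OF p] by (simp only: sym_sym_simps permutes_id simp_thms)
    with A.matching_image[OF E p]
    have "\<exists>c\<in>carrier (sym_sym n). graph_image (label_act n v u c) \<Gamma> = Knn_minus_matching n v u"
      by (rule bexI)
    note ex = this and I = A.conjugate_pairI[OF p A.matching_image[OF E p]]
    from c show ?thesis
    proof
      assume "A.conj_right \<pi> = Diag (Sym n)"
      from ex I[OF this, unfolded P_eq] show ?thesis by blast
    next
      assume "A.conj_right \<pi> = Diag (Alt n)"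
      from ex I[OF this, unfolded P_eq] show ?thesis by blast
    qed
  qed
qed

end
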